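(* $\Delta_{\mathcal C}(8,4)=4$; that is, the maximum circuit diameter over all (bounded or unbounded) $4$-dimensional polyhedra with $8$ facets equals $4$.
   Context: Polyhedra are given by irredundant full-dimensional systems $P=\{z\in\mathbb{R}^d: Az\ge b\}$, each row defining a facet. Circuits of $P$: nonzero vectors $g$ such that the support of $Ag$ is inclusion-minimal among supports of $Ax$, $x\ne0$, normalized to coprime integers. A circuit walk is a sequence $y^{(0)},\dots,y^{(k)}$ of points of $P$ with $y^{(i+1)}-y^{(i)}=\alpha_i g^{(i)}$, $g^{(i)}$ a circuit, $\alpha_i>0$, and $y^{(i)}+\alpha g^{(i)}\notin P$ for all $\alpha>\alpha_i$; length $k$. Circuit distance between vertices = minimum length of a circuit walk from the first to the second; circuit diameter = maximum circuit distance over ordered pairs of vertices; $\Delta_{\mathcal C}(f,d)$ = maximum circuit diameter over $d$-dimensional polyhedra with $f$ facets. *)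

theory Defs
  imports "HOL-Analysis.Analysis" "HOL-Library.Extended_Nat" "HOL-Library.Numeral_Type"
begin

text \<open>The order on \<^typ>\<open>real ^ 'f\<close> is componentwise. The dimension is \<open>CARD('d)\<close> and the
  number of inequalities is \<open>CARD('f)\<close>.\<close>

definition polyhedron_of :: "real ^ 'd ^ 'f \<Rightarrow> real ^ 'f \<Rightarrow> (real ^ 'd) set" where
  "polyhedron_of A b = {z. b \<le> A *v z}"

text \<open>Under these conditions distinct rows define distinct facets and every facet comes from a
  row, so the polyhedron has exactly \<open>CARD('f)\<close> facets.\<close>

definition facet_system :: "real ^ 'd ^ 'f \<Rightarrow> real ^ 'f \<Rightarrow> bool" where
  "facet_system A b \<longleftrightarrow>
     aff_dim (polyhedron_of A b) = int CARD('d) \<and>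
     (\<forall>i. {z. \<forall>j. j \<noteq> i \<longrightarrow> b $ j \<le> (A *v z) $ j} \<noteq> polyhedron_of A b) \<and>
     (\<forall>i. {z \<in> polyhedron_of A b. (A *v z) $ i = b $ i} facet_of polyhedron_of A b)"

definition supp :: "real ^ 'n \<Rightarrow> 'n set" where
  "supp x = {i. x $ i \<noteq> 0}"

definition integral_vec :: "real ^ 'n \<Rightarrow> bool" where
  "integral_vec g \<longleftrightarrow> (\<forall>i. g $ i \<in> \<int>)"

definition coprime_integral_vec :: "real ^ 'n \<Rightarrow> bool" where
  "coprime_integral_vec g \<longleftrightarrow>
     (\<exists>z :: 'n \<Rightarrow> int. (\<forall>i. g $ i = of_int (z i)) \<and> Gcd (range z) = 1)"

text \<open>A circuit is normalized to coprime integers whenever some multiple of it is integral,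
  which is always the case for rational \<open>A\<close> of full column rank. For real \<open>A\<close> a circuit
  direction need not contain an integral vector, and then any vector on it is admitted.
  The choice of the positive scale has no influence on circuit walks, because
  the step length absorbs it.\<close>

definition circuit :: "real ^ 'd ^ 'f \<Rightarrow> real ^ 'd \<Rightarrow> bool" where
  "circuit A g \<longleftrightarrow>
     g \<noteq> 0 \<and>
     \<not> (\<exists>x. x \<noteq> 0 \<and> supp (A *v x) \<subset> supp (A *v g)) \<and>
     ((\<exists>c>0. integral_vec (c *\<^sub>R g)) \<longrightarrow> coprime_integral_vec g)"

definition circuit_step ::
  "real ^ 'd ^ 'f \<Rightarrow> real ^ 'f \<Rightarrow> real ^ 'd \<Rightarrow> real ^ 'd \<Rightarrow> bool" where
  "circuit_step A b y y' \<longleftrightarrow>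
     (\<exists>g \<alpha>. circuit A g \<and> \<alpha> > 0 \<and> y' - y = \<alpha> *\<^sub>R g \<and>
        (\<forall>\<beta>>\<alpha>. y + \<beta> *\<^sub>R g \<notin> polyhedron_of A b))"

definition circuit_walk ::
  "real ^ 'd ^ 'f \<Rightarrow> real ^ 'f \<Rightarrow> nat \<Rightarrow> (nat \<Rightarrow> real ^ 'd) \<Rightarrow> bool" where
  "circuit_walk A b k y \<longleftrightarrow>
     (\<forall>i\<le>k. y i \<in> polyhedron_of A b) \<and> (\<forall>i<k. circuit_step A b (y i) (y (Suc i)))"

text \<open>In \<^typ>\<open>enat\<close> the infimum of the empty set is \<open>\<infinity>\<close>, so the distance is \<open>\<infinity>\<close> if there is no
  circuit walk. A nonempty set with a finite supremum attains it, so the suprema below are maxima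
  whenever they are finite. A polyhedron without vertices gets diameter \<open>0\<close>.\<close>

definition circuit_distance ::
  "real ^ 'd ^ 'f \<Rightarrow> real ^ 'f \<Rightarrow> real ^ 'd \<Rightarrow> real ^ 'd \<Rightarrow> enat" where
  "circuit_distance A b u v =
     Inf {enat k | k. \<exists>y. circuit_walk A b k y \<and> y 0 = u \<and> y k = v}"

definition circuit_diameter :: "real ^ 'd ^ 'f \<Rightarrow> real ^ 'f \<Rightarrow> enat" where
  "circuit_diameter A b =
     Sup {circuit_distance A b u v | u v.
       u extreme_point_of polyhedron_of A b \<and> v extreme_point_of polyhedron_of A b}"

definition max_circuit_diameter :: "'f::finite itself \<Rightarrow> 'd::finite itself \<Rightarrow> enat" where
  "max_circuit_diameter _ _ =
     Sup {circuit_diameter A b | (A :: real ^ 'd ^ 'f) (b :: real ^ 'f). facet_system A b}"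

end

theory Submission
  imports Defs
begin

text \<open>Upper bound. Let \<open>u\<close>, \<open>v\<close> be vertices and \<open>F\<close> the smallest face containing both. The rows tight at
  \<open>u\<close> but not on \<open>F\<close> contain a coordinate system of \<open>F\<close>, and so do those at \<open>v\<close>; counting rows leaves
  at most \<open>dim F\<close> + 4 rows that matter on \<open>F\<close>. In a two-dimensional face given by six rows, from any
  point one can slide parallel to suitable edges into an edge at \<open>v\<close> and needs at most four steps,
  or three from the boundary away from \<open>v\<close>. If \<open>F\<close> has dimension three, one step leads from
  \<open>u\<close> to the boundary of a two-dimensional face containing \<open>v\<close>.

  If \<open>F\<close> has dimension four, choose coordinates \<open>x\<close> with \<open>u = 0\<close>, \<open>v = (1, 1, 1, 1)\<close>, such that the
  polyhedron is given by \<open>x \<ge> 0\<close> and \<open>w = 1 - M x \<ge> 0\<close>, where the rows of \<open>M\<close> sum to 1, and let \<open>Q\<close> be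
  the inverse of \<open>M\<close>. Let \<open>c l\<close> be the inequality on \<open>x\<close> that ends the edge at \<open>v\<close> along which only \<open>w l\<close> grows.
  From a point with \<open>w j = w k = 0\<close> the vertex \<open>v\<close> is two steps away unless, for the remaining indices
  \<open>l\<close> and \<open>m\<close>, the coordinates \<open>x (c l)\<close> and \<open>x (c m)\<close> both exceed 1, and \<open>Q (c l) m\<close> and \<open>Q (c m) l\<close>
  are negative. After a first step along an edge into a facet \<open>w j = 0\<close>, the candidate second steps
  change two coordinates \<open>a\<close>, \<open>b\<close>, and if such a step fails then \<open>{a, b} = {c l, c m}\<close>. Since \<open>c\<close> has at most three
  values outside \<open>j\<close>, few pairs can fail. The sign conditions on a column of \<open>Q\<close>, which is orthogonal to
  all rows of \<open>M\<close> but one, exclude that all steps fail.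

  Lower bound. The circuits of the cube are parallel to the coordinate axes, so every step changes only one
  coordinate.\<close>

section \<open>Two-dimensional faces\<close>

text \<open>\<open>R k p q\<close> stands for: the vertex \<open>(0, 0)\<close> can be reached from \<open>(p, q)\<close> in at most \<open>k\<close> circuit steps.
  A step is described by its two endpoints: some inequality is constant along it, and some inequality
  is tight at the second endpoint only.\<close>

locale polygon =
  fixes R :: "nat \<Rightarrow> real \<Rightarrow> real \<Rightarrow> bool"
    and I :: "'i set" and ca cb cc :: "'i \<Rightarrow> real"
  assumes finite_I: "finite I"
    and cc_nonneg: "i \<in> I \<Longrightarrow> 0 \<le> cc i"
    and cc_zero: "i \<in> I \<Longrightarrow> cc i = 0 \<Longrightarrow> ca i \<le> 0 \<and> cb i \<le> 0"
    and R_zero: "R 0 0 0"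
    and R_mono: "R k p q \<Longrightarrow> R (Suc k) p q"
    and R_step: "\<lbrakk>0 \<le> p; 0 \<le> q; \<forall>i\<in>I. ca i * p + cb i * q \<le> cc i;
        0 \<le> p'; 0 \<le> q'; \<forall>i\<in>I. ca i * p' + cb i * q' \<le> cc i;
        p' \<noteq> p \<or> q' \<noteq> q;
        p' = p \<or> q' = q \<or>
          (\<exists>i\<in>I. (ca i \<noteq> 0 \<or> cb i \<noteq> 0) \<and> ca i * p' + cb i * q' = ca i * p + cb i * q);
        p' = 0 \<and> 0 < p \<or> q' = 0 \<and> 0 < q \<or>
          (\<exists>i\<in>I. ca i * p' + cb i * q' = cc i \<and> ca i * p + cb i * q < cc i);
        R k p' q'\<rbrakk> \<Longrightarrow> R (Suc k) p q"
begin

definition feas :: "real \<Rightarrow> real \<Rightarrow> bool" where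
  "feas p q \<longleftrightarrow> 0 \<le> p \<and> 0 \<le> q \<and> (\<forall>i\<in>I. ca i * p + cb i * q \<le> cc i)"

lemma R_le: "R k p q \<Longrightarrow> k \<le> m \<Longrightarrow> R m p q"
  by (induction m) (auto simp: le_Suc_eq intro: R_mono)

lemma step:
  assumes "feas p q" "feas p' q'" "p' \<noteq> p \<or> q' \<noteq> q"
    "p' = p \<or> q' = q \<or>
       (\<exists>i\<in>I. (ca i \<noteq> 0 \<or> cb i \<noteq> 0) \<and> ca i * p' + cb i * q' = ca i * p + cb i * q)"
    "p' = 0 \<and> 0 < p \<or> q' = 0 \<and> 0 < q \<or>
       (\<exists>i\<in>I. ca i * p' + cb i * q' = cc i \<and> ca i * p + cb i * q < cc i)"
    "R k p' q'"
  shows "R (Suc k) p q"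
  using R_step[of p q p' q' k] assms unfolding feas_def by blast

section \<open>Moves onto the two edges at the vertex\<close>

lemma feas_zero: "feas 0 0"
  by (simp add: feas_def cc_nonneg)

lemma axis_q:
  assumes "feas 0 q" shows "R 1 0 q"
proof (cases "q = 0")
  case True then show ?thesis using R_mono[OF R_zero] by simp
next
  case False
  then have "0 < q" using assms by (simp add: feas_def)
  then show ?thesis using step[OF assms feas_zero _ _ _ R_zero] by auto
qed

lemma axis_p:
  assumes "feas p 0" shows "R 1 p 0"
proof (cases "p = 0")
  case True then show ?thesis using R_mono[OF R_zero] by simp
next
  case False
  then have "0 < p" using assms by (simp add: feas_def)
  then show ?thesis using step[OF assms feas_zero _ _ _ R_zero] by auto
qed

lemma two_if_axis_q:
  assumes "feas p q" "feas 0 q" shows "R 2 p q"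
proof (cases "p = 0")
  case True then show ?thesis using R_le[OF axis_q, of q 2] assms by simp
next
  case False
  then have "0 < p" using assms by (simp add: feas_def)
  then show ?thesis
    using step[OF assms, of 1] axis_q[OF assms(2)] by (simp add: numeral_2_eq_2)
qed

lemma two_if_axis_p:
  assumes "feas p q" "feas p 0" shows "R 2 p q"
proof (cases "q = 0")
  case True then show ?thesis using R_le[OF axis_p, of p 2] assms by simp
next
  case False
  then have "0 < q" using assms by (simp add: feas_def)
  then show ?thesis
    using step[OF assms, of 1] axis_p[OF assms(2)] by (simp add: numeral_2_eq_2)
qed

text \<open>The constraint violated at \<open>(0, q)\<close> holds at \<open>(p, q)\<close>, which
  forces \<open>ca i < 0\<close>. By \<open>cc_zero\<close> a constraint through the vertex holds on
  the whole quadrant, hence \<open>0 < cc i\<close>.\<close>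

lemma infeas_axis_q:
  assumes "feas p q" "\<not> feas 0 q"
  obtains i where "i \<in> I" "cc i < cb i * q" "0 < cb i" "ca i < 0" "0 < cc i"
proof -
  obtain i where i: "i \<in> I" "cc i < cb i * q"
    using assms by (auto simp: feas_def not_le)
  have q: "0 \<le> q" "0 \<le> p" "ca i * p + cb i * q \<le> cc i"
    using assms i by (auto simp: feas_def)
  have "0 < cb i * q" using i cc_nonneg[of i] by linarith
  then have cb: "0 < cb i" using q by (simp add: zero_less_mult_iff)
  have "ca i * p < 0" using q i by linarith
  then have ca: "ca i < 0" using q by (simp add: mult_less_0_iff)
  have "0 < cc i" using cb cc_zero[OF i(1)] cc_nonneg[OF i(1)] by force
  then show ?thesis using that i cb ca by blast
qed

section \<open>Constraints that block sliding towards an edge\<close>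

text \<open>Constraints that lie below a line of positive slope, with intercept
  \<open>cc i / cb i\<close> on the edge \<open>p = 0\<close>. Only they can block a decrease of
  \<open>p\<close> alone, and only those in \<open>TJ\<close> a decrease of \<open>q\<close>
  alone.\<close>

definition TI :: "'i set" where "TI = {i\<in>I. ca i < 0 \<and> 0 < cb i}"
definition TJ :: "'i set" where "TJ = {i\<in>I. cb i < 0 \<and> 0 < ca i}"

lemma finite_TI: "finite TI" using finite_I by (simp add: TI_def)

lemma cc_TI: "i \<in> TI \<Longrightarrow> 0 < cc i"
  using cc_zero[of i] cc_nonneg[of i] unfolding TI_def by force

text \<open>A constraint whose coefficients have the same sign survives a decrease of both
  coordinates: its left side does not grow, or it is nonpositive anyway.\<close>

lemma feas_down:
  assumes "feas p q" "0 \<le> p'" "p' \<le> p" "0 \<le> q'" "q' \<le> q"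
    "\<And>i. i \<in> TI \<Longrightarrow> ca i * p' + cb i * q' \<le> cc i"
    "\<And>i. i \<in> TJ \<Longrightarrow> ca i * p' + cb i * q' \<le> cc i"
  shows "feas p' q'"
  unfolding feas_def
proof (intro conjI ballI)
  fix i assume i: "i \<in> I"
  have f: "ca i * p + cb i * q \<le> cc i" using assms i by (auto simp: feas_def)
  consider "i \<in> TI" | "i \<in> TJ" | "0 \<le> ca i" "0 \<le> cb i" | "ca i \<le> 0" "cb i \<le> 0"
    using i by (fastforce simp: TI_def TJ_def)
  then show "ca i * p' + cb i * q' \<le> cc i"
  proof cases
    case 3
    then have "ca i * p' \<le> ca i * p" "cb i * q' \<le> cb i * q"
      using assms by (auto intro: mult_left_mono)
    then show ?thesis using f by linarith
  next
    case 4
    then have "ca i * p' \<le> 0" "cb i * q' \<le> 0"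
      using assms by (auto simp: mult_le_0_iff)
    then show ?thesis using cc_nonneg[OF i] by linarith
  qed (use assms in auto)
qed (use assms in auto)

text \<open>When moving down along the line of \<open>i\<close>, only other constraints in \<open>TI\<close> can get in the way: a
  constraint in \<open>TJ\<close> holds at both ends, as the line meets \<open>p = 0\<close> at some \<open>q \<ge> 0\<close>.\<close>

lemma line_TI_aux:
  assumes "feas p q" "i \<in> TI" "ca i * p + cb i * q = cc i"
    and "0 \<le> p'" "p' \<le> p" "ca i * p' + cb i * q' = cc i"
  shows "0 \<le> q'" "q' \<le> q" "k \<in> TJ \<Longrightarrow> ca k * p' + cb k * q' \<le> cc k"
proof -
  have i: "ca i < 0" "0 < cb i" "i \<in> I" using assms(2) by (auto simp: TI_def)
  have ci: "0 < cc i" using assms(2) by (rule cc_TI)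
  have "cb i * q' = cc i - ca i * p'" using assms by linarith
  moreover have "ca i * p' \<le> 0" using i assms by (simp add: mult_le_0_iff)
  ultimately have "0 < cb i * q'" using ci by linarith
  then show q': "0 \<le> q'" using i by (simp add: zero_less_mult_iff)
  have "ca i * p \<le> ca i * p'" using i assms by (simp add: mult_left_mono_neg)
  then have "cb i * q' \<le> cb i * q" using assms by linarith
  then show "q' \<le> q" using i by simp
  assume k: "k \<in> TJ"
  then have kk: "cb k < 0" "0 < ca k" "k \<in> I" by (auto simp: TJ_def)
  show "ca k * p' + cb k * q' \<le> cc k"
  proof (cases "p = 0")
    case True
    then have "p' = 0" using assms by simp
    then show ?thesis using kk q' cc_nonneg[of k] by (simp add: mult_nonneg_nonpos2 mult.commute)
        (smt (verit) mult_nonneg_nonpos2 mult.commute)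
  next
    case False
    then have p: "0 < p" using assms by simp
    \<comment> \<open>The point \<open>(p', q')\<close> is the convex combination of
      \<open>(p, q)\<close> and the intercept \<open>(0, q0)\<close> with weight \<open>s\<close> on
      the former, and constraint \<open>k\<close> holds at both.\<close>
    define s where "s = p' / p"
    have s: "0 \<le> s" "s \<le> 1" "p' = s * p" using p assms by (auto simp: s_def)
    define q0 where "q0 = cc i / cb i"
    have q0: "0 \<le> q0" using ci i by (simp add: q0_def)
    have "cb i * q' = cb i * (s * q + (1 - s) * q0)"
    proof -
      have "cb i * q0 = cc i" using i by (simp add: q0_def)
      then have "cb i * (s * q + (1 - s) * q0) = s * (cb i * q) + (1 - s) * cc i"
        by (simp add: algebra_simps)
      also have "\<dots> = s * (cc i - ca i * p) + (1 - s) * cc i"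
        using assms(3) by (metis add_diff_cancel_left')
      also have "\<dots> = cc i - ca i * p'" using s by (simp add: algebra_simps)
      also have "\<dots> = cb i * q'" using assms(6) by linarith
      finally show ?thesis by (rule sym)
    qed
    then have qq: "q' = s * q + (1 - s) * q0" using i by (metis less_irrefl mult_left_cancel)
    have "ca k * p + cb k * q \<le> cc k" using assms(1) kk by (auto simp: feas_def)
    moreover have "cb k * q0 \<le> cc k"
      using kk q0 cc_nonneg[of k] by (smt (verit) mult_nonneg_nonpos2 mult.commute)
    ultimately have "s * (ca k * p + cb k * q) + (1 - s) * (cb k * q0) \<le> s * cc k + (1 - s) * cc k"
      using s by (intro add_mono mult_left_mono) auto
    then show ?thesis unfolding s(3) qq by (simp add: algebra_simps)
  qed
qed

text \<open>The slide along the line of \<open>i\<close> ends at \<open>(0, cc i / cb i)\<close>. As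
  this intercept is the lowest one, the endpoint satisfies all constraints in \<open>TI\<close>. One
  step along the edge \<open>p = 0\<close> remains.\<close>

lemma two_on_tight_line:
  assumes "feas p q" "i \<in> TI" "ca i * p + cb i * q = cc i"
    and min: "\<And>k. k \<in> TI \<Longrightarrow> cc i / cb i \<le> cc k / cb k"
  shows "R 2 p q"
proof -
  have i: "ca i < 0" "0 < cb i" "i \<in> I" using assms(2) by (auto simp: TI_def)
  define q' where "q' = cc i / cb i"
  have p: "0 \<le> p" using assms by (simp add: feas_def)
  have e: "ca i * 0 + cb i * q' = cc i" using i by (simp add: q'_def)
  note aux = line_TI_aux[OF assms(1-3) _ p e]
  have "feas 0 q'"
  proof (rule feas_down[OF assms(1)])
    fix k assume k: "k \<in> TI"
    then have "0 < cb k" by (simp add: TI_def)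
    then show "ca k * 0 + cb k * q' \<le> cc k"
      using min[OF k] by (simp add: q'_def field_simps)
  qed (use aux p in auto)
  show ?thesis
  proof (cases "p = 0")
    case True
    then show ?thesis using R_le[OF axis_q] assms by fastforce
  next
    case False
    then show ?thesis
      using step[OF assms(1) \<open>feas 0 q'\<close>, of 1] axis_q[OF \<open>feas 0 q'\<close>] i e assms(3) p
      by (simp add: numeral_2_eq_2) (metis order_less_le)
  qed
qed

text \<open>Decrease \<open>p\<close> until the first line of \<open>TI\<close> is met:
  \<open>x i\<close> is the abscissa of the line of \<open>i\<close> at height \<open>q\<close>, and
  \<open>p'\<close> is the largest of these. If \<open>p' = p\<close>, no step is made.\<close>

lemma left_move:
  assumes "feas p q" "\<not> feas 0 q"
  obtains i p' where "i \<in> TI" "feas p' q" "ca i * p' + cb i * q = cc i"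
    "\<And>k. R k p' q \<Longrightarrow> R (Suc k) p q"
proof -
  define x where "x i = (cb i * q - cc i) / (- ca i)" for i
  obtain i0 where i0: "i0 \<in> I" "cc i0 < cb i0 * q" "0 < cb i0" "ca i0 < 0" "0 < cc i0"
    using infeas_axis_q[OF assms] .
  then have ne: "TI \<noteq> {}" "i0 \<in> TI" by (auto simp: TI_def)
  define p' where "p' = Max (x ` TI)"
  have "p' \<in> x ` TI" unfolding p'_def using finite_TI ne by (intro Max_in) auto
  then obtain i where i: "i \<in> TI" "p' = x i" by auto
  then have ii: "ca i < 0" "0 < cb i" "i \<in> I" by (auto simp: TI_def)
  have mx: "x k \<le> p'" if "k \<in> TI" for k unfolding p'_def using that finite_TI by auto
  have "0 < x i0" using i0 by (simp add: x_def divide_pos_neg)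
  then have p'0: "0 < p'" using mx[OF ne(2)] by linarith
  have e: "ca i * p' + cb i * q = cc i" using ii by (simp add: i(2) x_def field_simps)
  have pq: "0 \<le> p" "0 \<le> q" "ca i * p + cb i * q \<le> cc i"
    using assms ii by (auto simp: feas_def)
  then have "ca i * p \<le> ca i * p'" using e by linarith
  then have le: "p' \<le> p" using ii by simp
  have feas: "feas p' q"
  proof (rule feas_down[OF assms(1)])
    fix k assume k: "k \<in> TI"
    then have "ca k < 0" by (simp add: TI_def)
    then show "ca k * p' + cb k * q \<le> cc k" using mx[OF k] by (simp add: x_def field_simps)
  next
    fix k assume k: "k \<in> TJ"
    then have "ca k * p' \<le> ca k * p" using le by (simp add: TJ_def)
    moreover have "ca k * p + cb k * q \<le> cc k" using assms(1) k by (simp add: TJ_def feas_def)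
    ultimately show "ca k * p' + cb k * q \<le> cc k" by linarith
  qed (use p'0 le pq in auto)
  have "R (Suc k) p q" if "R k p' q" for k
  proof (cases "p' = p")
    case True then show ?thesis using that R_mono by simp
  next
    case False
    then have "ca i * p < ca i * p'" using le ii by simp
    then have "ca i * p + cb i * q < cc i" using e by linarith
    then show ?thesis using step[OF assms(1) feas] that False e ii by blast
  qed
  then show ?thesis using that i feas e by blast
qed

text \<open>Let \<open>h\<close> have the lowest intercept. Sliding down the line of
  \<open>i\<close> meets the line of \<open>h\<close>, the only other one in \<open>TI\<close>, and
  \<open>two_on_tight_line\<close> finishes from there. If the intercepts agree or \<open>h\<close>
  is already tight, that lemma applies at once.\<close>

lemma three_if_on_line:
  assumes "feas p q" "i \<in> TI" "ca i * p + cb i * q = cc i" and card: "card TI \<le> 2"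
  shows "R 3 p q"
proof -
  have i: "ca i < 0" "0 < cb i" "i \<in> I" using assms(2) by (auto simp: TI_def)
  have ci: "0 < cc i" using assms(2) by (rule cc_TI)
  define h where "h = arg_min_on (\<lambda>k. cc k / cb k) TI"
  have ne: "TI \<noteq> {}" using assms by auto
  have h: "h \<in> TI" unfolding h_def using arg_min_if_finite(1)[OF finite_TI ne] .
  have min: "cc h / cb h \<le> cc k / cb k" if "k \<in> TI" for k
    unfolding h_def using arg_min_least[OF finite_TI ne that] .
  have hh: "ca h < 0" "0 < cb h" "h \<in> I" using h by (auto simp: TI_def)
  have pq: "0 \<le> p" "0 \<le> q" "ca h * p + cb h * q \<le> cc h" using assms hh by (auto simp: feas_def)
  show ?thesis
  proof (cases "cc h / cb h = cc i / cb i \<or> ca h * p + cb h * q = cc h")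
    case True
    then have "R 2 p q" using two_on_tight_line[OF assms(1)] assms h min by metis
    then show ?thesis by (rule R_le) simp
  next
    case False
    then have lt: "cc h / cb h < cc i / cb i" "ca h * p + cb h * q < cc h"
      using min[OF assms(2)] pq by auto
    then have hi: "h \<noteq> i" by auto
    have TI: "TI = {i, h}"
      using card_seteq[OF finite_TI, of "{i,h}"] assms(2) h hi card by auto
    \<comment> \<open>\<open>\<phi>0\<close> is the violation of \<open>h\<close> at the intercept
      of \<open>i\<close>, and \<open>\<phi>1\<close> its slack at \<open>(p, q)\<close>; the weight
      \<open>s\<close> makes \<open>h\<close> tight at the convex combination
      \<open>(p', q')\<close> of these two points.\<close>
    define \<phi>0 where "\<phi>0 = cb h * (cc i / cb i) - cc h"
    have "cb h * (cc h / cb h) < cb h * (cc i / cb i)" using lt hh by (intro mult_strict_left_mono)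
    then have \<phi>0: "0 < \<phi>0" using hh by (simp add: \<phi>0_def)
    define \<phi>1 where "\<phi>1 = cc h - ca h * p - cb h * q"
    have \<phi>1: "0 < \<phi>1" using lt by (simp add: \<phi>1_def)
    define s where "s = \<phi>0 / (\<phi>0 + \<phi>1)"
    have s: "0 < s" "s < 1" using \<phi>0 \<phi>1 by (auto simp: s_def)
    have s': "s * \<phi>1 = (1 - s) * \<phi>0" using \<phi>0 \<phi>1 by (simp add: s_def field_simps)
    define p' where "p' = s * p"
    define q' where "q' = s * q + (1 - s) * (cc i / cb i)"
    have e: "ca i * p' + cb i * q' = cc i"
    proof -
      have "cb i * (cc i / cb i) = cc i" using i by simp
      moreover have "ca i * p' + cb i * q' = s * (ca i * p + cb i * q) + (1 - s) * (cb i * (cc i / cb i))"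
        unfolding p'_def q'_def by (simp only: algebra_simps)
      ultimately have "ca i * p' + cb i * q' = s * cc i + (1 - s) * cc i" by (simp only: assms(3))
      also have "\<dots> = cc i" by (simp add: algebra_simps)
      finally show ?thesis .
    qed
    have eh: "ca h * p' + cb h * q' = cc h"
    proof -
      have "ca h * p' + cb h * q' = s * (ca h * p + cb h * q) + (1 - s) * (cb h * (cc i / cb i))"
        by (simp add: p'_def q'_def algebra_simps)
      also have "\<dots> = s * (cc h - \<phi>1) + (1 - s) * (cc h + \<phi>0)"
        by (simp add: \<phi>0_def \<phi>1_def)
      also have "\<dots> = cc h" using s' by (simp add: algebra_simps)
      finally show ?thesis .
    qed
    have p': "0 \<le> p'" "p' \<le> p" using s pq by (auto simp: p'_def mult_left_le_one_le)
    note aux = line_TI_aux[OF assms(1-3) p' e]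
    have feas: "feas p' q'"
      by (rule feas_down[OF assms(1)]) (use aux p' e eh TI in auto)
    have "R 2 p' q'" by (rule two_on_tight_line[OF feas h eh min])
    moreover have "p' \<noteq> p \<or> q' \<noteq> q" using lt eh by auto
    ultimately have "R (Suc 2) p q"
      using step[OF assms(1) feas] i hh e assms(3) eh lt by (metis less_irrefl)
    then show ?thesis by (simp add: numeral_3_eq_3)
  qed
qed

lemma three_if_few_TI:
  assumes "feas p q" "card TI \<le> 1"
  shows "R 3 p q"
proof (cases "feas 0 q")
  case True
  then show ?thesis using R_le[OF two_if_axis_q[OF assms(1)]] by simp
next
  case False
  obtain i p' where i: "i \<in> TI" "feas p' q" "ca i * p' + cb i * q = cc i"
    "\<And>k. R k p' q \<Longrightarrow> R (Suc k) p q" using left_move[OF assms(1) False] by blast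
  have "TI = {i}" using card_seteq[OF finite_TI, of "{i}"] i assms by auto
  then have "R 2 p' q" using two_on_tight_line i by auto
  then show ?thesis using i(4) by (metis numeral_3_eq_3 numeral_2_eq_2)
qed

lemma four_if_two_TI:
  assumes "feas p q" "card TI \<le> 2"
  shows "R 4 p q"
proof (cases "feas 0 q")
  case True
  then show ?thesis using R_le[OF two_if_axis_q[OF assms(1)]] by simp
next
  case False
  obtain i p' where i: "i \<in> TI" "feas p' q" "ca i * p' + cb i * q = cc i"
    "\<And>k. R k p' q \<Longrightarrow> R (Suc k) p q" using left_move[OF assms(1) False] by blast
  then have "R (Suc 3) p q" using three_if_on_line assms by blast
  then show ?thesis by simp
qed

lemma swap: "polygon (\<lambda>k p q. R k q p) I cb ca cc"
proof
  fix p q p' q' :: real and k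
  assume *: "0 \<le> p" "0 \<le> q" "\<forall>i\<in>I. cb i * p + ca i * q \<le> cc i"
    "0 \<le> p'" "0 \<le> q'" "\<forall>i\<in>I. cb i * p' + ca i * q' \<le> cc i"
    "p' \<noteq> p \<or> q' \<noteq> q"
    "p' = p \<or> q' = q \<or>
      (\<exists>i\<in>I. (cb i \<noteq> 0 \<or> ca i \<noteq> 0) \<and> cb i * p' + ca i * q' = cb i * p + ca i * q)"
    "p' = 0 \<and> 0 < p \<or> q' = 0 \<and> 0 < q \<or>
      (\<exists>i\<in>I. cb i * p' + ca i * q' = cc i \<and> cb i * p + ca i * q < cc i)"
    "R k q' p'"
  show "R (Suc k) q p"
    by (rule R_step[of q p q' p' k]) (use * in \<open>auto simp: add.commute\<close>)
qed (use finite_I cc_nonneg cc_zero R_zero R_mono in auto)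

end

text \<open>\<open>TI\<close> and \<open>TJ\<close> are disjoint parts of \<open>I\<close>, so one
  of them has at most two elements. For a point on a line that misses the vertex, either one of them
  has at most one element, or both have two and exhaust \<open>I\<close>, so that the line belongs
  to one of them.\<close>

lemma (in polygon) four_if_card_4:
  assumes "feas p q" "card I \<le> 4"
  shows "R 4 p q"
    and "i \<in> I \<Longrightarrow> ca i * p + cb i * q = cc i \<Longrightarrow> 0 < cc i \<Longrightarrow> R 3 p q"
proof -
  interpret S: polygon "\<lambda>k p q. R k q p" I cb ca cc by (rule swap)
  have fS: "S.feas q p" using assms by (auto simp: S.feas_def feas_def add.commute)
  have S: "S.TI = TJ" by (simp add: S.TI_def TJ_def)
  have un: "TI \<union> TJ \<subseteq> I" "TI \<inter> TJ = {}" by (auto simp: TI_def TJ_def)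
  have fin: "finite TI" "finite TJ" using finite_TI S.finite_TI S by auto
  have le: "card TI + card TJ \<le> 4"
    using card_mono[OF finite_I un(1)] card_Un_disjoint[OF fin un(2)] assms(2) by linarith
  then show "R 4 p q"
    using four_if_two_TI[OF assms(1)] S.four_if_two_TI[OF fS] S by (cases "card TI \<le> 2") auto
  assume i: "i \<in> I" "ca i * p + cb i * q = cc i" "0 < cc i"
  show "R 3 p q"
  proof (cases "card TI \<le> 1 \<or> card TJ \<le> 1")
    case True
    then show ?thesis using three_if_few_TI[OF assms(1)] S.three_if_few_TI[OF fS] S by auto
  next
    case False
    then have c: "card TI = 2" "card TJ = 2" using le by auto
    then have "card (TI \<union> TJ) = 4" using card_Un_disjoint[OF fin un(2)] by simp
    then have "TI \<union> TJ = I" using card_seteq[OF finite_I un(1)] assms(2) by simp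
    then show ?thesis
      using i three_if_on_line[OF assms(1), of i] S.three_if_on_line[OF fS, of i] S c
      by (auto simp: add.commute)
  qed
qed

section \<open>Two simple vertices without a common facet\<close>

text \<open>By bilinearity of the determinant, a weighted double sum of 2x2 minors of two rows is
  the minor of the weighted sums. In this way sums along rows force the sign of some minor.\<close>

lemma sum_bracket:
  fixes r f g :: "'a \<Rightarrow> real"
  shows "(\<Sum>p\<in>P. \<Sum>n\<in>N. g p * g n * (r p * f n - r n * f p)) =
    (\<Sum>p\<in>P. r p * g p) * (\<Sum>n\<in>N. f n * g n) - (\<Sum>p\<in>P. f p * g p) * (\<Sum>n\<in>N. r n * g n)"
  unfolding sum_product sum_subtractf[symmetric] by (simp add: algebra_simps)

lemma sum_pos_obtains:
  fixes g :: "'a \<Rightarrow> real"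
  assumes "0 < sum g A"
  obtains a where "a \<in> A" "0 < g a"
proof -
  have "\<exists>a\<in>A. 0 < g a"
  proof (rule ccontr)
    assume "\<not> ?thesis"
    then have "sum g A \<le> 0" by (intro sum_nonpos) (auto simp: not_less)
    then show False using assms by simp
  qed
  then show ?thesis using that by blast
qed

lemma UNIV_4_distinct:
  assumes "distinct [i, j, k, l :: 4]"
  shows "UNIV = {i, j, k, l}"
proof -
  have "card {i, j, k, l} = card (UNIV :: 4 set)" using assms by simp
  then show ?thesis by (metis card_subset_eq finite subset_UNIV)
qed

lemma sum_4_distinct:
  fixes f :: "4 \<Rightarrow> real"
  assumes "distinct [i, j, k, l]"
  shows "sum f UNIV = f i + f j + f k + f l"
  using assms by (simp add: UNIV_4_distinct[OF assms])

lemma exhaust_4_distinct: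
  assumes "distinct [i, j, k, l :: 4]"
  shows "x = i \<or> x = j \<or> x = k \<or> x = l"
  using UNIV_4_distinct[OF assms] by blast

lemma fourth_index: "\<exists>l :: 4. l \<noteq> i \<and> l \<noteq> j \<and> l \<noteq> k"
proof -
  have "card {i, j, k} < card (UNIV :: 4 set)"
    using card_insert_le_m1[of 3 "{j,k}" i] card_insert_le_m1[of 2 "{k}" j] by simp
  then have "{i, j, k} \<noteq> UNIV" by auto
  then show ?thesis by blast
qed

lemma complete_pair_4:
  assumes "j \<noteq> (k :: 4)"
  obtains l m where "distinct [j, k, l, m]"
proof -
  obtain l where l: "l \<noteq> j" "l \<noteq> k" using fourth_index by blast
  obtain m where "m \<noteq> j" "m \<noteq> k" "m \<noteq> l" using fourth_index by blast
  then show ?thesis using that[of l m] l assms by auto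
qed

lemma collinear_2:
  fixes a b :: real
  assumes "a * x + b * y = 0" "a * u + b * v = 0" "a \<noteq> 0 \<or> b \<noteq> 0" "u \<noteq> 0 \<or> v \<noteq> 0"
  shows "\<exists>c. x = c * u \<and> y = c * v"
proof -
  have e: "x * v = y * u"
  proof (cases "a = 0")
    case True then show ?thesis using assms by auto
  next
    case False
    have "a * (x * v - y * u) = (a * x + b * y) * v - (a * u + b * v) * y"
      by (simp add: algebra_simps)
    also have "\<dots> = 0" using assms by simp
    finally show ?thesis using False by simp
  qed
  show ?thesis
  proof (cases "u = 0")
    case True
    then have "x = (y / v) * u \<and> y = (y / v) * v" using e assms by auto
    then show ?thesis by blast
  next
    case False
    then have "x = (x / u) * u \<and> y = (x / u) * v" using e by (auto simp: field_simps)
    then show ?thesis by blast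
  qed
qed

text \<open>The sign contradictions of \<open>two_hits_share\<close>: \<open>r\<close> and \<open>f\<close> are two rows of \<open>M\<close>, and \<open>z\<close> is a
  column of \<open>Q\<close> orthogonal to both.\<close>

lemma no_bracket_signs_pos:
  fixes rs :: real
  assumes r: "rs * zs + rt * zt + ru * zu + rh * zh = 0"
    and f: "fs * zs + ft * zt + fu * zu + fh * zh = 0"
    and z: "0 < zs" "zt < 0" "zu < 0"
    and rho: "0 < rs" "rt \<le> 0" "ru \<le> 0"
    and br: "0 < rs * ft - rt * fs" "0 < rs * fu - ru * fs"
    and h1: "0 < rh \<Longrightarrow> rh * ft - rt * fh \<le> 0" "0 < rh \<Longrightarrow> rh * fu - ru * fh \<le> 0"
    and h2: "rh \<le> 0 \<Longrightarrow> rs * fh - rh * fs \<le> 0"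
  shows False
proof (cases "rh \<le> 0")
  case True
  \<comment> \<open>Eliminating \<open>zs\<close> from the two equations leaves a relation between
    brackets. Its first two terms are negative, so the third is positive and \<open>zh\<close> is
    negative; then all terms of the equation for \<open>r\<close> are nonnegative and one is
    positive.\<close>
  have "(rs * ft - rt * fs) * zt + (rs * fu - ru * fs) * zu + (rs * fh - rh * fs) * zh =
      rs * (fs * zs + ft * zt + fu * zu + fh * zh) - fs * (rs * zs + rt * zt + ru * zu + rh * zh)"
    by (simp add: algebra_simps)
  then have "(rs * ft - rt * fs) * zt + (rs * fu - ru * fs) * zu + (rs * fh - rh * fs) * zh = 0"
    using r f by simp
  moreover have "(rs * ft - rt * fs) * zt < 0" "(rs * fu - ru * fs) * zu < 0"
    using br z by (auto simp: mult_pos_neg)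
  ultimately have "0 < (rs * fh - rh * fs) * zh" by linarith
  then have "zh < 0" using h2[OF True] by (auto simp: zero_less_mult_iff)
  then have "0 \<le> rh * zh" using True by (simp add: mult_nonpos_nonpos)
  moreover have "0 < rs * zs" "0 \<le> rt * zt" "0 \<le> ru * zu"
    using z rho by (auto simp: mult_nonpos_nonpos)
  ultimately show False using r by linarith
next
  case False
  then have rh: "0 < rh" by simp
  have "0 < rs * zs" "0 \<le> rt * zt" "0 \<le> ru * zu"
    using z rho by (auto simp: mult_nonpos_nonpos)
  then have "rh * zh < 0" using r by linarith
  then have zh: "zh < 0" using rh by (simp add: mult_less_0_iff)
  \<comment> \<open>Expansion of a 3x3 determinant in which the row \<open>r\<close> occurs twice:
    two of the brackets determine the sign of the third. Afterwards \<open>zh\<close> is eliminated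
    from the two equations.\<close>
  have "rt * (rh * fs - rs * fh) = rs * (rh * ft - rt * fh) - rh * (rs * ft - rt * fs)"
    by (simp add: algebra_simps)
  moreover have "rs * (rh * ft - rt * fh) \<le> 0" using h1(1)[OF rh] rho by (simp add: mult_le_0_iff)
  moreover have "0 < rh * (rs * ft - rt * fs)" using rh br by simp
  ultimately have "rt * (rh * fs - rs * fh) < 0" by linarith
  then have "0 < rh * fs - rs * fh" using rho by (auto simp: mult_less_0_iff)
  then have "0 < (rh * fs - rs * fh) * zs" using z by simp
  moreover have "0 \<le> (rh * ft - rt * fh) * zt" "0 \<le> (rh * fu - ru * fh) * zu"
    using h1[OF rh] z by (auto simp: mult_nonpos_nonpos)
  moreover have "(rh * fs - rs * fh) * zs + (rh * ft - rt * fh) * zt + (rh * fu - ru * fh) * zu =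
      rh * (fs * zs + ft * zt + fu * zu + fh * zh) - fh * (rs * zs + rt * zt + ru * zu + rh * zh)"
    by (simp add: algebra_simps)
  ultimately show False using r f by simp
qed

lemma no_bracket_signs_neg:
  fixes rs :: real
  assumes r: "rs * zs + rt * zt + ru * zu + rh * zh = 0"
    and f: "fs * zs + ft * zt + fu * zu + fh * zh = 0"
    and z: "0 < zs" "zt < 0" "zu < 0"
    and rho: "rs \<le> 0" "0 < rt" "0 < ru"
    and br: "0 < rt * fs - rs * ft" "0 < ru * fs - rs * fu"
    and h1: "rh \<le> 0 \<Longrightarrow> rt * fh - rh * ft \<le> 0" "rh \<le> 0 \<Longrightarrow> ru * fh - rh * fu \<le> 0"
    and h2: "0 < rh \<Longrightarrow> rh * fs - rs * fh \<le> 0"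
  shows False
proof (cases "rh \<le> 0")
  case True
  have "rs * zs \<le> 0" "rt * zt < 0" "ru * zu < 0"
    using z rho by (auto simp: mult_pos_neg mult_le_0_iff)
  then have "0 < rh * zh" using r by linarith
  then have zh: "zh < 0" "rh < 0" using True by (auto simp: zero_less_mult_iff)
  have "rt * (rh * fs - rs * fh) = rh * (rt * fs - rs * ft) - rs * (rt * fh - rh * ft)"
    by (simp add: algebra_simps)
  moreover have "0 \<le> rs * (rt * fh - rh * ft)" using h1(1)[OF True] rho by (simp add: mult_nonpos_nonpos)
  moreover have "rh * (rt * fs - rs * ft) < 0" using zh br by (simp add: mult_neg_pos)
  ultimately have "rt * (rh * fs - rs * fh) < 0" by linarith
  then have "rh * fs - rs * fh < 0" using rho by (auto simp: mult_less_0_iff)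
  then have "(rh * fs - rs * fh) * zs < 0" using z by (simp add: mult_neg_pos)
  moreover have "(rh * ft - rt * fh) * zt \<le> 0" "(rh * fu - ru * fh) * zu \<le> 0"
    using h1[OF True] z by (auto simp: mult_le_0_iff)
  moreover have "(rh * fs - rs * fh) * zs + (rh * ft - rt * fh) * zt + (rh * fu - ru * fh) * zu =
      rh * (fs * zs + ft * zt + fu * zu + fh * zh) - fh * (rs * zs + rt * zt + ru * zu + rh * zh)"
    by (simp add: algebra_simps)
  ultimately show False using r f by simp
next
  case False
  then have rh: "0 < rh" by simp
  have "(rs * ft - rt * fs) * zt + (rs * fu - ru * fs) * zu + (rs * fh - rh * fs) * zh =
      rs * (fs * zs + ft * zt + fu * zu + fh * zh) - fs * (rs * zs + rt * zt + ru * zu + rh * zh)"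
    by (simp add: algebra_simps)
  then have "(rs * ft - rt * fs) * zt + (rs * fu - ru * fs) * zu + (rs * fh - rh * fs) * zh = 0"
    using r f by simp
  moreover have "0 < (rs * ft - rt * fs) * zt" "0 < (rs * fu - ru * fs) * zu"
    using br z by (auto simp: mult_neg_neg)
  ultimately have "(rs * fh - rh * fs) * zh < 0" by linarith
  then have "zh < 0" using h2[OF rh] by (auto simp: mult_less_0_iff)
  then have "rh * zh < 0" using rh by (simp add: mult_pos_neg)
  moreover have "rs * zs \<le> 0" "rt * zt < 0" "ru * zu < 0"
    using z rho by (auto simp: mult_pos_neg mult_le_0_iff)
  ultimately show False using r by linarith
qed

definition slack :: "(4 \<Rightarrow> 4 \<Rightarrow> real) \<Rightarrow> (4 \<Rightarrow> real) \<Rightarrow> 4 \<Rightarrow> real" where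
  "slack M x j = 1 - (\<Sum>i\<in>UNIV. M j i * x i)"

definition feasible :: "(4 \<Rightarrow> 4 \<Rightarrow> real) \<Rightarrow> (4 \<Rightarrow> real) \<Rightarrow> bool" where
  "feasible M x \<longleftrightarrow> (\<forall>i. 0 \<le> x i) \<and> (\<forall>j. 0 \<le> slack M x j)"

text \<open>Here \<open>x\<close> and \<open>slack M x\<close> are the slacks of the four rows tight at \<open>u\<close> and of the four rows tight
  at \<open>v\<close>, scaled to 1 at the other vertex; \<open>R n x\<close> stands for: the vertex \<open>v\<close>, which is \<open>\<lambda>_. 1\<close>,
  can be reached from \<open>x\<close> in at most \<open>n\<close> circuit steps.\<close>

locale spindle =
  fixes M Q :: "4 \<Rightarrow> 4 \<Rightarrow> real" and R :: "nat \<Rightarrow> (4 \<Rightarrow> real) \<Rightarrow> bool"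
  assumes row_sum: "(\<Sum>i\<in>UNIV. M j i) = 1"
    and MQ: "(\<Sum>i\<in>UNIV. M j i * Q i k) = (if j = k then 1 else 0)"
    and QM: "(\<Sum>j\<in>UNIV. Q i j * M j k) = (if i = k then 1 else 0)"
    and R_one: "R 0 (\<lambda>_. 1)"
    and R_mono: "R n x \<Longrightarrow> R (Suc n) x"
    and R_step: "\<lbrakk>feasible M x; feasible M y; \<exists>i. x i \<noteq> y i;
       \<And>h. (\<And>i. x i = y i \<Longrightarrow> h i = 0) \<Longrightarrow>
         (\<And>j. slack M x j = slack M y j \<Longrightarrow> (\<Sum>i\<in>UNIV. M j i * h i) = 0) \<Longrightarrow>
         \<exists>c. \<forall>i. h i = c * (y i - x i);
       (\<exists>i. y i = 0 \<and> 0 < x i) \<or> (\<exists>j. slack M y j = 0 \<and> 0 < slack M x j); R n y\<rbrakk> \<Longrightarrow>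
       R (Suc n) x"
begin

abbreviation w :: "(4 \<Rightarrow> real) \<Rightarrow> 4 \<Rightarrow> real" where "w \<equiv> slack M"
abbreviation feas :: "(4 \<Rightarrow> real) \<Rightarrow> bool" where "feas \<equiv> feasible M"

lemmas w_def = slack_def
lemmas feas_def = feasible_def

lemma R_le: "R n x \<Longrightarrow> n \<le> m \<Longrightarrow> R m x"
  by (induction m) (auto simp: le_Suc_eq intro: R_mono)

section \<open>Coordinates on the faces through \<open>v\<close>\<close>

lemma h_eq_QMh: "h i = (\<Sum>j\<in>UNIV. Q i j * (\<Sum>k\<in>UNIV. M j k * h k))"
proof -
  have "(\<Sum>j\<in>UNIV. Q i j * (\<Sum>k\<in>UNIV. M j k * h k)) =
      (\<Sum>k\<in>UNIV. (\<Sum>j\<in>UNIV. Q i j * M j k) * h k)"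
    by (simp add: sum_distrib_left sum_distrib_right mult.assoc) (rule sum.swap)
  also have "\<dots> = (\<Sum>k\<in>UNIV. if i = k then h k else 0)"
    by (intro sum.cong) (auto simp: QM)
  also have "\<dots> = h i" by simp
  finally show ?thesis by simp
qed

lemma Q_row_sum: "(\<Sum>j\<in>UNIV. Q i j) = 1"
  using h_eq_QMh[of "\<lambda>_. 1" i] by (simp add: row_sum)

text \<open>As the rows of \<open>M\<close> sum to 1, the slack vector is \<open>M\<close> applied
  to \<open>1 - x\<close>; applying \<open>Q\<close> recovers the point from its slacks.\<close>

lemma point_eq: "x i = 1 - (\<Sum>j\<in>UNIV. Q i j * w x j)"
  using h_eq_QMh[of x i] Q_row_sum[of i]
  by (simp add: w_def right_diff_distrib sum_subtractf)

text \<open>For distinct \<open>l\<close> and \<open>m\<close> this is the point with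
  \<open>w l = p\<close>, \<open>w m = q\<close> and the other two slacks zero, so \<open>p\<close>
  and \<open>q\<close> are coordinates on a two-dimensional face with \<open>v\<close> at the
  origin.\<close>

definition pt :: "4 \<Rightarrow> 4 \<Rightarrow> real \<Rightarrow> real \<Rightarrow> 4 \<Rightarrow> real" where
  "pt l m p q i = 1 - Q i l * p - Q i m * q"

lemma w_pt: "w (pt l m p q) j = (if j = l then p else 0) + (if j = m then q else 0)"
proof -
  have "(\<Sum>i\<in>UNIV. M j i * pt l m p q i) =
      (\<Sum>i\<in>UNIV. M j i) - (\<Sum>i\<in>UNIV. M j i * Q i l) * p - (\<Sum>i\<in>UNIV. M j i * Q i m) * q"
    by (simp add: pt_def algebra_simps sum_subtractf sum.distrib sum_distrib_left sum_distrib_right)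
  then show ?thesis by (simp add: w_def row_sum MQ)
qed

text \<open>The constraints \<open>0 \<le> x i\<close> become
  \<open>Q i l * p + Q i m * q \<le> 1\<close>. A direction that keeps \<open>w j\<close> and
  \<open>w k\<close> constant is a combination of the columns \<open>l\<close> and \<open>m\<close>
  of \<open>Q\<close>, and one more constant constraint fixes it up to scale.\<close>

lemma polygon_pt:
  assumes "distinct [j, k, l, m]"
  shows "polygon (\<lambda>n p q. R n (pt l m p q)) UNIV (\<lambda>i. Q i l) (\<lambda>i. Q i m) (\<lambda>_. 1)"
proof
  show "R 0 (pt l m 0 0)" using R_one by (simp add: pt_def[abs_def])
  fix n p q assume "R n (pt l m p q)" then show "R (Suc n) (pt l m p q)" by (rule R_mono)
next
  have lm: "l \<noteq> m" using assms by auto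
  fix p q p' q' :: real and n
  assume 1: "0 \<le> p" "0 \<le> q" "\<forall>i\<in>UNIV. Q i l * p + Q i m * q \<le> 1"
    and 2: "0 \<le> p'" "0 \<le> q'" "\<forall>i\<in>UNIV. Q i l * p' + Q i m * q' \<le> 1"
    and ne: "p' \<noteq> p \<or> q' \<noteq> q"
    and el: "p' = p \<or> q' = q \<or>
      (\<exists>i\<in>UNIV. (Q i l \<noteq> 0 \<or> Q i m \<noteq> 0) \<and> Q i l * p' + Q i m * q' = Q i l * p + Q i m * q)"
    and bl: "p' = 0 \<and> 0 < p \<or> q' = 0 \<and> 0 < q \<or>
      (\<exists>i\<in>UNIV. Q i l * p' + Q i m * q' = 1 \<and> Q i l * p + Q i m * q < 1)"
    and R: "R n (pt l m p' q')"
  let ?x = "pt l m p q" and ?y = "pt l m p' q'"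
  have wl: "w (pt l m p q) l = p" "w (pt l m p q) m = q" for p q
    using lm by (auto simp: w_pt)
  show "R (Suc n) ?x"
  proof (rule R_step[OF _ _ _ _ _ R])
    have f: "feas (pt l m p q)" if "0 \<le> p" "0 \<le> q" "\<forall>i\<in>UNIV. Q i l * p + Q i m * q \<le> 1" for p q
      using that unfolding feas_def by (auto simp: w_pt pt_def algebra_simps)
    show "feas ?x" "feas ?y" using f 1 2 by auto
    show "\<exists>i. ?x i \<noteq> ?y i"
    proof (rule ccontr)
      assume "\<not> ?thesis"
      then have "?x = ?y" by auto
      then show False using ne wl[of p q] wl[of p' q'] by simp
    qed
    show "(\<exists>i. ?y i = 0 \<and> 0 < ?x i) \<or> (\<exists>j. w ?y j = 0 \<and> 0 < w ?x j)"
    proof -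
      from bl consider "p' = 0" "0 < p" | "q' = 0" "0 < q"
        | i where "Q i l * p' + Q i m * q' = 1" "Q i l * p + Q i m * q < 1" by blast
      then show ?thesis
      proof cases
        case 3
        then have "?y i = 0" "0 < ?x i" by (auto simp: pt_def)
        then show ?thesis by blast
      next
        case 1 then show ?thesis using wl(1)[of p q] wl(1)[of p' q'] by (intro disjI2 exI[of _ l]) simp
      next
        case 2 then show ?thesis using wl(2)[of p q] wl(2)[of p' q'] by (intro disjI2 exI[of _ m]) simp
      qed
    qed
    fix h :: "4 \<Rightarrow> real"
    assume h0: "\<And>i. ?x i = ?y i \<Longrightarrow> h i = 0"
      and hw: "\<And>j. w ?x j = w ?y j \<Longrightarrow> (\<Sum>i\<in>UNIV. M j i * h i) = 0"
    define \<alpha> where "\<alpha> = (\<Sum>i\<in>UNIV. M l i * h i)"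
    define \<beta> where "\<beta> = (\<Sum>i\<in>UNIV. M m i * h i)"
    have "(\<Sum>i\<in>UNIV. M j i * h i) = 0" "(\<Sum>i\<in>UNIV. M k i * h i) = 0"
      using hw[of j] hw[of k] assms by (auto simp: w_pt)
    then have h: "h i = Q i l * \<alpha> + Q i m * \<beta>" for i
      using h_eq_QMh[of h i] sum_4_distinct[OF assms, of "\<lambda>j. Q i j * (\<Sum>k\<in>UNIV. M j k * h k)"]
      by (simp add: \<alpha>_def \<beta>_def)
    have "\<exists>c. \<alpha> = c * (p - p') \<and> \<beta> = c * (q - q')"
    proof -
      from el consider "p' = p" | "q' = q"
        | i where "Q i l \<noteq> 0 \<or> Q i m \<noteq> 0" "Q i l * p' + Q i m * q' = Q i l * p + Q i m * q"
        by blast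
      then show ?thesis
      proof cases
        case 1
        then have "\<alpha> = 0" using hw[of l] wl by (simp add: \<alpha>_def)
        then show ?thesis using 1 ne by (intro exI[of _ "\<beta> / (q - q')"]) auto
      next
        case 2
        then have "\<beta> = 0" using hw[of m] wl by (simp add: \<beta>_def)
        then show ?thesis using 2 ne by (intro exI[of _ "\<alpha> / (p - p')"]) auto
      next
        case 3
        then have "h i = 0" using h0[of i] by (simp add: pt_def algebra_simps)
        then have "Q i l * \<alpha> + Q i m * \<beta> = 0" using h[of i] by simp
        moreover have "Q i l * (p - p') + Q i m * (q - q') = 0" using 3 by (simp add: algebra_simps)
        ultimately show ?thesis by (rule collinear_2) (use 3(1) ne in auto)
      qed
    qed
    then obtain c where c: "\<alpha> = c * (p - p')" "\<beta> = c * (q - q')" by blast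
    have "h i = c * (?y i - ?x i)" for i
      by (simp add: h c pt_def algebra_simps)
    then show "\<exists>c. \<forall>i. h i = c * (?y i - ?x i)" by blast
  qed
qed auto

text \<open>Along the edge at \<open>v\<close> on which only \<open>w l\<close> grows,
  \<open>x i\<close> starts at 1 and decreases at rate \<open>Q i l\<close>. If some rate is
  positive, \<open>x (c l)\<close> is a first coordinate to vanish; ties are broken
  arbitrarily.\<close>

definition c :: "4 \<Rightarrow> 4" where
  "c l = (SOME i. \<forall>i'. Q i' l \<le> Q i l)"

lemma c_max: "Q i l \<le> Q (c l) l"
proof -
  obtain i0 where "Q i0 l = Max (range (\<lambda>i. Q i l))"
    using Max_in[of "range (\<lambda>i. Q i l)"] by fastforce
  then have "\<forall>i'. Q i' l \<le> Q i0 l" by simp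
  then show ?thesis unfolding c_def by (rule someI2) blast
qed

text \<open>The point \<open>(p, 0)\<close> is infeasible, as otherwise two steps suffice. The
  constraint \<open>c l\<close> is the tightest on that axis and so is violated there, which yields
  both signs. If \<open>x (c l)\<close> were at most 1, sliding with \<open>x (c l)\<close> constant
  would lead to a feasible point of the axis.\<close>

lemma two_face:
  assumes d: "distinct [j, k, l, m]" and x: "feas x" "w x j = 0" "w x k = 0" "\<not> R 2 x"
  shows "0 < Q (c l) l" "Q (c l) m < 0" "1 < x (c l)"
proof -
  interpret S: polygon "\<lambda>n p q. R n (pt l m p q)" UNIV "\<lambda>i. Q i l" "\<lambda>i. Q i m" "\<lambda>_. 1"
    by (rule polygon_pt[OF d])
  define p where "p = w x l"
  define q where "q = w x m"
  have x_eq: "x = pt l m p q"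
  proof
    fix i
    show "x i = pt l m p q i"
      using point_eq[of x i] x sum_4_distinct[OF d, of "\<lambda>j. Q i j * w x j"]
      by (simp add: pt_def p_def q_def)
  qed
  have xi: "x i = 1 - Q i l * p - Q i m * q" for i unfolding x_eq pt_def by simp
  have pq: "0 \<le> p" "0 \<le> q" using x(1) by (auto simp: p_def q_def feas_def)
  have x0: "0 \<le> x i" for i using x(1) by (simp add: feas_def)
  have f: "S.feas p q" unfolding S.feas_def using pq x0 xi by (auto simp: algebra_simps)
  have nR: "\<not> R 2 (pt l m p q)" using x(4) x_eq by simp
  have "\<not> S.feas p 0" using S.two_if_axis_p[OF f] nR by blast
  then obtain i where "1 < Q i l * p" using pq by (auto simp: S.feas_def not_le)
  moreover have "Q i l * p \<le> Q (c l) l * p" using c_max pq by (intro mult_right_mono) auto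
  ultimately have cp: "1 < Q (c l) l * p" by linarith
  then have cl: "0 < Q (c l) l" using pq by (smt (verit) mult_nonpos_nonneg)
  then show "0 < Q (c l) l" .
  have "Q (c l) m * q < 0" using x0[of "c l"] xi[of "c l"] cp by linarith
  then show cm: "Q (c l) m < 0" using pq by (simp add: mult_less_0_iff)
  show "1 < x (c l)"
  proof (rule ccontr)
    assume "\<not> 1 < x (c l)"
    then have le: "- Q (c l) m * q \<le> Q (c l) l * p" using xi[of "c l"] by linarith
    \<comment> \<open>The line through \<open>(p, q)\<close> on which \<open>x (c l)\<close> is
      constant meets the axis \<open>q = 0\<close> at \<open>p'\<close>.\<close>
    define p' where "p' = p + Q (c l) m * q / Q (c l) l"
    have e: "Q (c l) l * p' = Q (c l) l * p + Q (c l) m * q"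
      using cl by (simp add: p'_def field_simps)
    then have "0 \<le> Q (c l) l * p'" using le by linarith
    then have p'0: "0 \<le> p'" using cl by (simp add: zero_le_mult_iff)
    have "Q (c l) l * p' \<le> 1" using e x0[of "c l"] xi[of "c l"] by linarith
    then have "Q i l * p' \<le> 1" for i
      using c_max[of i l] p'0 by (meson mult_right_mono order_trans)
    then have f': "S.feas p' 0" using p'0 by (simp add: S.feas_def)
    have q0: "0 < q" using \<open>Q (c l) m * q < 0\<close> cm pq by (auto simp: mult_less_0_iff)
    have "R (Suc 1) (pt l m p q)"
    proof (rule S.step[OF f f' _ _ _ S.axis_p[OF f']])
      show "p' = p \<or> 0 = q \<or> (\<exists>i\<in>UNIV. (Q i l \<noteq> 0 \<or> Q i m \<noteq> 0) \<and>
          Q i l * p' + Q i m * 0 = Q i l * p + Q i m * q)"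
        using e cl by (intro disjI2 bexI[of _ "c l"]) auto
    qed (use q0 in auto)
    then show False using nR by (simp add: numeral_2_eq_2)
  qed
qed

text \<open>What is left to hold if a step inside the facet \<open>w j = 0\<close> changes only \<open>x a\<close> and \<open>x b\<close>, reaches a second
  facet \<open>w k = 0\<close>, and is not followed by two steps to \<open>v\<close>.\<close>

definition exit_pair :: "4 \<Rightarrow> 4 \<Rightarrow> 4 \<Rightarrow> bool" where
  "exit_pair j a b \<longleftrightarrow> (\<exists>k l m. distinct [j, k, l, m] \<and> c l = a \<and> c m = b \<and>
     0 < Q a l \<and> 0 < Q b m \<and> Q a m < 0 \<and> Q b l < 0)"

lemma exit_pair_sym: "exit_pair j a b \<Longrightarrow> exit_pair j b a"
  unfolding exit_pair_def
proof -
  assume "\<exists>k l m. distinct [j, k, l, m] \<and> c l = a \<and> c m = b \<and>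
     0 < Q a l \<and> 0 < Q b m \<and> Q a m < 0 \<and> Q b l < 0"
  then obtain k l m where "distinct [j, k, l, m]" "c l = a" "c m = b"
    "0 < Q a l" "0 < Q b m" "Q a m < 0" "Q b l < 0" by blast
  then show "\<exists>k l m. distinct [j, k, l, m] \<and> c l = b \<and> c m = a \<and>
     0 < Q b l \<and> 0 < Q a m \<and> Q b m < 0 \<and> Q a l < 0"
    by (intro exI[of _ k] exI[of _ m] exI[of _ l]) auto
qed

lemma exit_pair_mem: "exit_pair j a b \<Longrightarrow> a \<in> c ` (- {j}) \<and> b \<in> c ` (- {j})"
  unfolding exit_pair_def by auto

lemma card_c_image: "card (c ` (- {j})) \<le> 3"
proof -
  have "card (- {j} :: 4 set) = 3" by (simp add: Compl_eq_Diff_UNIV)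
  then show ?thesis by (metis card_image_le finite)
qed

text \<open>By \<open>two_face\<close> for both orders of \<open>l\<close> and \<open>m\<close>, the
  coordinates \<open>x (c l)\<close> and \<open>x (c m)\<close> exceed 1, so \<open>c l\<close> and
  \<open>c m\<close> lie among \<open>p\<close> and \<open>n\<close>. They differ because
  \<open>Q (c l) l\<close> is positive and \<open>Q (c m) l\<close> negative.\<close>

lemma two_face_exit_pair:
  assumes "feas x" "w x j = 0" "w x k = 0" "j \<noteq> k" "\<not> R 2 x" "\<And>i. i \<noteq> p \<Longrightarrow> i \<noteq> n \<Longrightarrow> x i \<le> 1"
  shows "exit_pair j p n \<and> 1 < x p \<and> 1 < x n"
proof -
  obtain l m where d: "distinct [j, k, l, m]" using complete_pair_4[OF assms(4)] .
  then have d': "distinct [j, k, m, l]" by auto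
  note a = two_face[OF d assms(1,2,3,5)] and b = two_face[OF d' assms(1,2,3,5)]
  have ne: "c l \<noteq> c m" using a b by auto
  have "c l \<in> {p, n}" "c m \<in> {p, n}" using a(3) b(3) assms(6) by force+
  then consider "c l = p" "c m = n" | "c l = n" "c m = p" using ne by auto
  then show ?thesis
  proof cases
    case 1 then show ?thesis unfolding exit_pair_def using a b d by blast
  next
    case 2 then show ?thesis unfolding exit_pair_def using a b d' by blast
  qed
qed

text \<open>Let \<open>l\<close> and \<open>l'\<close> represent \<open>\<sigma>\<close> in the two
  pairs. If they differed, \<open>l'\<close> and \<open>m'\<close> would both be the index
  \<open>k\<close> left over by the first pair. So a single column of \<open>Q\<close> carries the
  signs of both pairs.\<close>

lemma exit_pair_shared:
  assumes "exit_pair j \<sigma> \<tau>" "exit_pair j \<sigma> \<tau>'" "distinct [\<sigma>, \<tau>, \<tau>']"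
  obtains s where "s \<noteq> j" "c s = \<sigma>" "0 < Q \<sigma> s" "Q \<tau> s < 0" "Q \<tau>' s < 0"
proof -
  obtain k l m where 1: "distinct [j, k, l, m]" "c l = \<sigma>" "c m = \<tau>"
    "0 < Q \<sigma> l" "Q \<tau> l < 0"
    using assms(1) unfolding exit_pair_def by blast
  obtain k' l' m' where 2: "distinct [j, k', l', m']" "c l' = \<sigma>" "c m' = \<tau>'" "Q \<tau>' l' < 0"
    using assms(2) unfolding exit_pair_def by blast
  have "l' = l"
  proof (rule ccontr)
    assume "l' \<noteq> l"
    moreover have "l' \<noteq> m" "m' \<noteq> l" "m' \<noteq> m" using 1 2 assms(3) by auto
    moreover have "l' \<noteq> j" "m' \<noteq> j" "l' \<noteq> m'" using 2 by auto
    ultimately have "l' = k" "m' = k" using exhaust_4_distinct[OF 1(1)] by metis+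
    then show False using \<open>l' \<noteq> m'\<close> by simp
  qed
  then show ?thesis using that[of l] 1 2 by auto
qed

text \<open>The rate at which \<open>w t\<close> decreases when \<open>x k\<close> grows at rate \<open>M j i\<close> and \<open>x i\<close> shrinks at rate
  \<open>M j k\<close>, which keeps \<open>w j\<close> constant.\<close>

definition bracket :: "4 \<Rightarrow> 4 \<Rightarrow> 4 \<Rightarrow> 4 \<Rightarrow> real" where
  "bracket j t i k = M j i * M t k - M j k * M t i"

text \<open>The column \<open>s\<close> of \<open>Q\<close> shared by both pairs is positive at
  \<open>\<sigma>\<close>, negative at \<open>\<tau>\<close> and \<open>\<tau>'\<close>, and
  orthogonal to row \<open>j\<close> and to any row \<open>t\<close> other than \<open>j\<close> and
  \<open>s\<close>. The two alternatives differ in the side of row \<open>j\<close>, positive or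
  nonpositive, on which \<open>\<sigma>\<close> lies; each has its own sign contradiction.\<close>

lemma two_hits_share:
  assumes exit_pair: "exit_pair j \<sigma> \<tau>" "exit_pair j \<sigma> \<tau>'" and d: "distinct [\<sigma>, \<tau>, \<tau>', \<theta>]"
    and *: "0 < M j \<sigma> \<and> M j \<tau> \<le> 0 \<and> M j \<tau>' \<le> 0 \<and>
        (\<forall>t. t \<noteq> j \<longrightarrow> 0 < bracket j t \<sigma> \<tau> \<and> 0 < bracket j t \<sigma> \<tau>' \<and>
          (0 < M j \<theta> \<longrightarrow> bracket j t \<theta> \<tau> \<le> 0 \<and> bracket j t \<theta> \<tau>' \<le> 0) \<and>
          (M j \<theta> \<le> 0 \<longrightarrow> bracket j t \<sigma> \<theta> \<le> 0)) \<or>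
      M j \<sigma> \<le> 0 \<and> 0 < M j \<tau> \<and> 0 < M j \<tau>' \<and>
        (\<forall>t. t \<noteq> j \<longrightarrow> 0 < bracket j t \<tau> \<sigma> \<and> 0 < bracket j t \<tau>' \<sigma> \<and>
          (M j \<theta> \<le> 0 \<longrightarrow> bracket j t \<tau> \<theta> \<le> 0 \<and> bracket j t \<tau>' \<theta> \<le> 0) \<and>
          (0 < M j \<theta> \<longrightarrow> bracket j t \<theta> \<sigma> \<le> 0))"
  shows False
proof -
  have "distinct [\<sigma>, \<tau>, \<tau>']" using d by auto
  then obtain s where s: "s \<noteq> j" "0 < Q \<sigma> s" "Q \<tau> s < 0" "Q \<tau>' s < 0"
    using exit_pair_shared[OF exit_pair] by metis
  obtain t where t: "t \<noteq> j" "t \<noteq> s" using fourth_index by blast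
  have r: "M j \<sigma> * Q \<sigma> s + M j \<tau> * Q \<tau> s + M j \<tau>' * Q \<tau>' s + M j \<theta> * Q \<theta> s = 0"
    using MQ[of j s] s sum_4_distinct[OF d, of "\<lambda>i. M j i * Q i s"] by simp
  have f: "M t \<sigma> * Q \<sigma> s + M t \<tau> * Q \<tau> s + M t \<tau>' * Q \<tau>' s + M t \<theta> * Q \<theta> s = 0"
    using MQ[of t s] t sum_4_distinct[OF d, of "\<lambda>i. M t i * Q i s"] by simp
  from * show False
  proof
    assume *: "0 < M j \<sigma> \<and> M j \<tau> \<le> 0 \<and> M j \<tau>' \<le> 0 \<and>
      (\<forall>t. t \<noteq> j \<longrightarrow> 0 < bracket j t \<sigma> \<tau> \<and> 0 < bracket j t \<sigma> \<tau>' \<and>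
        (0 < M j \<theta> \<longrightarrow> bracket j t \<theta> \<tau> \<le> 0 \<and> bracket j t \<theta> \<tau>' \<le> 0) \<and>
        (M j \<theta> \<le> 0 \<longrightarrow> bracket j t \<sigma> \<theta> \<le> 0))"
    show False
      by (rule no_bracket_signs_pos[OF r f s(2-4)]) (use * t(1) in \<open>auto simp: bracket_def\<close>)
  next
    assume *: "M j \<sigma> \<le> 0 \<and> 0 < M j \<tau> \<and> 0 < M j \<tau>' \<and>
      (\<forall>t. t \<noteq> j \<longrightarrow> 0 < bracket j t \<tau> \<sigma> \<and> 0 < bracket j t \<tau>' \<sigma> \<and>
        (M j \<theta> \<le> 0 \<longrightarrow> bracket j t \<tau> \<theta> \<le> 0 \<and> bracket j t \<tau>' \<theta> \<le> 0) \<and>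
        (0 < M j \<theta> \<longrightarrow> bracket j t \<theta> \<sigma> \<le> 0))"
    show False
      by (rule no_bracket_signs_neg[OF r f s(2-4)]) (use * t(1) in \<open>auto simp: bracket_def\<close>)
  qed
qed

text \<open>Opposite signs make the pairs with positive bracket a bipartite graph on the at most three
  values of \<open>c\<close>; so if there are always two of them, they share an index.\<close>

lemma no_two_pairs_per_row:
  assumes hit: "\<And>p n t. t \<noteq> j \<Longrightarrow> 0 < M j p \<Longrightarrow> M j n \<le> 0 \<Longrightarrow> 0 < bracket j t p n \<Longrightarrow> exit_pair j p n"
    and row: "\<And>t p0 n0. t \<noteq> j \<Longrightarrow>
      \<exists>p n. (p \<noteq> p0 \<or> n \<noteq> n0) \<and> 0 < M j p \<and> M j n \<le> 0 \<and> 0 < bracket j t p n"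
  shows False
proof -
  obtain t where t: "t \<noteq> j" using fourth_index by blast
  obtain p n where 1: "0 < M j p" "M j n \<le> 0" "0 < bracket j t p n" using row[OF t] by blast
  obtain p' n' where 2: "p' \<noteq> p \<or> n' \<noteq> n" "0 < M j p'" "M j n' \<le> 0" "0 < bracket j t p' n'"
    using row[OF t] by blast
  have exit_pair: "exit_pair j p n" "exit_pair j p' n'" using hit t 1 2 by auto
  have mem: "{p, n, p', n'} \<subseteq> c ` (- {j})" using exit_pair exit_pair_mem by blast
  have pn: "p \<noteq> n" "p' \<noteq> n'" "p \<noteq> n'" "p' \<noteq> n" using 1 2 by auto
  have "p' = p \<or> n' = n"
  proof (rule ccontr)
    assume "\<not> ?thesis"
    then have "card {p, n, p', n'} = 4" using pn by auto
    then show False using card_mono[OF _ mem] card_c_image[of j] by simp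
  qed
  then consider "p' = p" "n' \<noteq> n" | "n' = n" "p' \<noteq> p" using 2 by auto
  then show False
  proof cases
    case 1
    obtain \<theta> where th: "\<theta> \<noteq> p" "\<theta> \<noteq> n" "\<theta> \<noteq> n'" using fourth_index by blast
    have d: "distinct [p, n, n', \<theta>]" using th pn 1 by auto
    \<comment> \<open>The indices \<open>p\<close>, \<open>n\<close>, \<open>n'\<close> use up the
      at most three values of \<open>c\<close> outside \<open>j\<close>, so \<open>\<theta>\<close>
      belongs to no exit pair, and by \<open>hit\<close> no bracket of a positive with a nonpositive
      entry that involves \<open>\<theta>\<close> is positive.\<close>
    have C: "\<theta> \<notin> c ` (- {j})"
    proof
      assume "\<theta> \<in> c ` (- {j})"
      then have "{p, n, n', \<theta>} \<subseteq> c ` (- {j})" using mem by auto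
      then have "card {p, n, n', \<theta>} \<le> 3" using card_mono card_c_image[of j] by (meson finite le_trans)
      then show False using d by simp
    qed
    have hth: "\<theta> \<noteq> u \<and> \<theta> \<noteq> v" if "exit_pair j u v" for u v using exit_pair_mem[OF that] C by auto
    have side: "(0 < M j u \<longrightarrow> u \<noteq> \<theta> \<longrightarrow> u = p) \<and> (M j u \<le> 0 \<longrightarrow> u \<noteq> \<theta> \<longrightarrow> u \<in> {n, n'})" for u
      using exhaust_4_distinct[OF d, of u] \<open>0 < M j p\<close> \<open>M j n \<le> 0\<close> \<open>M j n' \<le> 0\<close> by auto
    \<comment> \<open>The two different pairs that \<open>row\<close> provides for \<open>t\<close>
      avoid \<open>\<theta>\<close>, so they are exactly \<open>(p, n)\<close> and
      \<open>(p, n')\<close>.\<close>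
    have pos: "0 < bracket j t p n \<and> 0 < bracket j t p n'" if "t \<noteq> j" for t
    proof -
      obtain p1 n1 where a: "0 < M j p1" "M j n1 \<le> 0" "0 < bracket j t p1 n1" using row[OF \<open>t \<noteq> j\<close>] by blast
      obtain p2 n2 where b: "p2 \<noteq> p1 \<or> n2 \<noteq> n1" "0 < M j p2" "M j n2 \<le> 0" "0 < bracket j t p2 n2"
        using row[OF \<open>t \<noteq> j\<close>] by blast
      have "exit_pair j p1 n1" "exit_pair j p2 n2" using hit that a b by auto
      then have "p1 = p" "p2 = p" "n1 \<in> {n, n'}" "n2 \<in> {n, n'}"
        using side a b hth by blast+
      then show ?thesis using a b by auto
    qed
    have th_le: "bracket j t u v \<le> 0" if "t \<noteq> j" "0 < M j u" "M j v \<le> 0" "u = \<theta> \<or> v = \<theta>" for t u v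
      using hit[OF that(1-3)] hth[of u v] that(4) by (meson not_le)
    have exit_pair': "exit_pair j p n'" using exit_pair(2) 1(1) by simp
    have "0 < M j p \<and> M j n \<le> 0 \<and> M j n' \<le> 0 \<and>
        (\<forall>t. t \<noteq> j \<longrightarrow> 0 < bracket j t p n \<and> 0 < bracket j t p n' \<and>
          (0 < M j \<theta> \<longrightarrow> bracket j t \<theta> n \<le> 0 \<and> bracket j t \<theta> n' \<le> 0) \<and>
          (M j \<theta> \<le> 0 \<longrightarrow> bracket j t p \<theta> \<le> 0))"
      using pos th_le \<open>0 < M j p\<close> \<open>M j n \<le> 0\<close> \<open>M j n' \<le> 0\<close> by blast
    then show False by (rule two_hits_share[OF exit_pair(1) exit_pair' d disjI1])
  next
    case 2
    obtain \<theta> where th: "\<theta> \<noteq> n" "\<theta> \<noteq> p" "\<theta> \<noteq> p'" using fourth_index by blast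
    have d: "distinct [n, p, p', \<theta>]" using th pn 2 by auto
    have C: "\<theta> \<notin> c ` (- {j})"
    proof
      assume "\<theta> \<in> c ` (- {j})"
      then have "{n, p, p', \<theta>} \<subseteq> c ` (- {j})" using mem by auto
      then have "card {n, p, p', \<theta>} \<le> 3" using card_mono card_c_image[of j] by (meson finite le_trans)
      then show False using d by simp
    qed
    have hth: "\<theta> \<noteq> u \<and> \<theta> \<noteq> v" if "exit_pair j u v" for u v using exit_pair_mem[OF that] C by auto
    have side: "(0 < M j u \<longrightarrow> u \<noteq> \<theta> \<longrightarrow> u \<in> {p, p'}) \<and> (M j u \<le> 0 \<longrightarrow> u \<noteq> \<theta> \<longrightarrow> u = n)" for u
      using exhaust_4_distinct[OF d, of u] \<open>0 < M j p\<close> \<open>0 < M j p'\<close> \<open>M j n \<le> 0\<close> by auto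
    have pos: "0 < bracket j t p n \<and> 0 < bracket j t p' n" if "t \<noteq> j" for t
    proof -
      obtain p1 n1 where a: "0 < M j p1" "M j n1 \<le> 0" "0 < bracket j t p1 n1" using row[OF \<open>t \<noteq> j\<close>] by blast
      obtain p2 n2 where b: "p2 \<noteq> p1 \<or> n2 \<noteq> n1" "0 < M j p2" "M j n2 \<le> 0" "0 < bracket j t p2 n2"
        using row[OF \<open>t \<noteq> j\<close>] by blast
      have "exit_pair j p1 n1" "exit_pair j p2 n2" using hit that a b by auto
      then have "n1 = n" "n2 = n" "p1 \<in> {p, p'}" "p2 \<in> {p, p'}"
        using side a b hth by blast+
      then show ?thesis using a b by auto
    qed
    have th_le: "bracket j t u v \<le> 0" if "t \<noteq> j" "0 < M j u" "M j v \<le> 0" "u = \<theta> \<or> v = \<theta>" for t u v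
      using hit[OF that(1-3)] hth[of u v] that(4) by (meson not_le)
    have exit_pair': "exit_pair j n p'" using exit_pair_sym[OF exit_pair(2)] 2(1) by simp
    have "M j n \<le> 0 \<and> 0 < M j p \<and> 0 < M j p' \<and>
        (\<forall>t. t \<noteq> j \<longrightarrow> 0 < bracket j t p n \<and> 0 < bracket j t p' n \<and>
          (M j \<theta> \<le> 0 \<longrightarrow> bracket j t p \<theta> \<le> 0 \<and> bracket j t p' \<theta> \<le> 0) \<and>
          (0 < M j \<theta> \<longrightarrow> bracket j t \<theta> n \<le> 0))"
      using pos th_le \<open>0 < M j p\<close> \<open>0 < M j p'\<close> \<open>M j n \<le> 0\<close> by blast
    then show False by (rule two_hits_share[OF exit_pair_sym[OF exit_pair(1)] exit_pair' d disjI2])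
  qed
qed

section \<open>Steps within a facet \<open>w j = 0\<close>\<close>

lemma slack_move:
  fixes x :: "4 \<Rightarrow> real"
  assumes "p \<noteq> n"
  shows "w (x(p := x p + t * \<alpha>, n := x n + t * \<beta>)) k = w x k - t * (M k p * \<alpha> + M k n * \<beta>)"
proof -
  obtain l m where d: "distinct [p, n, l, m]" using complete_pair_4[OF assms] .
  show ?thesis
    using d by (auto simp: w_def sum_4_distinct[OF d] algebra_simps)
qed

text \<open>Only \<open>x p\<close> and \<open>x n\<close> change, and the nontrivial equation of
  row \<open>j\<close> between them leaves a single direction; hence the move is along a
  circuit.\<close>

lemma pair_step:
  assumes x: "feas x" and y: "feas y" and pn: "p \<noteq> n"
    and y_def: "y = x(p := x p + t * \<alpha>, n := x n + t * \<beta>)"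
    and t: "0 < t" and ab: "\<alpha> \<noteq> 0 \<or> \<beta> \<noteq> 0"
    and j: "M j p * \<alpha> + M j n * \<beta> = 0" "M j p \<noteq> 0 \<or> M j n \<noteq> 0"
    and bl: "w y k = 0" "0 < w x k" and R: "R i y"
  shows "R (Suc i) x"
proof (rule R_step[OF x y _ _ _ R])
  show "(\<exists>i. y i = 0 \<and> 0 < x i) \<or> (\<exists>j. w y j = 0 \<and> 0 < w x j)" using bl by blast
  show "\<exists>i. x i \<noteq> y i" using bl by (metis ext less_irrefl)
  fix h :: "4 \<Rightarrow> real"
  assume h0: "\<And>i. x i = y i \<Longrightarrow> h i = 0"
    and hw: "\<And>j. w x j = w y j \<Longrightarrow> (\<Sum>i\<in>UNIV. M j i * h i) = 0"
  obtain l m where d: "distinct [p, n, l, m]" using complete_pair_4[OF pn] .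
  have hl: "h l = 0" "h m = 0" using h0[of l] h0[of m] d by (auto simp: y_def)
  have "w x j = w y j" using j by (simp add: y_def slack_move[OF pn])
  then have "M j p * h p + M j n * h n = 0"
    using hw[of j] sum_4_distinct[OF d, of "\<lambda>i. M j i * h i"] hl by simp
  from collinear_2[OF this j(1) j(2) ab]
  obtain e where e: "h p = e * \<alpha>" "h n = e * \<beta>" by blast
  have "h i = (e / t) * (y i - x i)" for i
    using exhaust_4_distinct[OF d, of i] e hl t pn d by (auto simp: y_def)
  then show "\<exists>c. \<forall>i. h i = c * (y i - x i)" by blast
qed

text \<open>Move until another facet of \<open>v\<close> is reached, with \<open>t\<close> from the
  ratio test; \<open>nonneg\<close> guarantees that no coordinate becomes negative before. The
  endpoint lies on two facets of \<open>v\<close> and is not two steps away from \<open>v\<close>,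
  since \<open>R 3 x\<close> fails, so \<open>two_face_exit_pair\<close> applies.\<close>

lemma hit:
  fixes x :: "4 \<Rightarrow> real"
  assumes x: "feas x" "w x j = 0" "\<And>k. k \<noteq> j \<Longrightarrow> 0 < w x k" "\<not> R 3 x"
    and pn: "p \<noteq> n" "\<alpha> \<noteq> 0 \<or> \<beta> \<noteq> 0"
    and j: "M j p * \<alpha> + M j n * \<beta> = 0" "M j p \<noteq> 0 \<or> M j n \<noteq> 0"
    and pos: "0 < M k p * \<alpha> + M k n * \<beta>"
    and nonneg: "\<And>t. 0 \<le> t \<Longrightarrow> (\<forall>k. t * (M k p * \<alpha> + M k n * \<beta>) \<le> w x k) \<Longrightarrow>
      0 \<le> x p + t * \<alpha> \<and> 0 \<le> x n + t * \<beta>"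
    and others: "\<And>i. i \<noteq> p \<Longrightarrow> i \<noteq> n \<Longrightarrow> x i \<le> 1"
  obtains t where "0 < t" "exit_pair j p n" "1 < x p + t * \<alpha>" "1 < x n + t * \<beta>"
    "\<And>k. t * (M k p * \<alpha> + M k n * \<beta>) \<le> w x k"
proof -
  define F where "F k = M k p * \<alpha> + M k n * \<beta>" for k
  define K where "K = {k. 0 < F k}"
  have K: "finite K" "K \<noteq> {}" using pos by (auto simp: K_def F_def)
  define t where "t = Min ((\<lambda>k. w x k / F k) ` K)"
  have "t \<in> (\<lambda>k. w x k / F k) ` K" unfolding t_def using K by (intro Min_in) auto
  then obtain k0 where k0: "0 < F k0" "t = w x k0 / F k0" by (auto simp: K_def)
  have k0j: "k0 \<noteq> j" using k0 j by (auto simp: F_def)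
  then have w0: "0 < w x k0" using x(3) by blast
  then have t0: "0 < t" using k0 by simp
  have tF: "t * F k \<le> w x k" for k
  proof (cases "0 < F k")
    case True
    then have "t \<le> w x k / F k" unfolding t_def using K by (intro Min_le) (auto simp: K_def)
    then show ?thesis using True by (simp add: field_simps)
  next
    case False
    then have "t * F k \<le> 0" using t0 by (simp add: mult_le_0_iff)
    moreover have "0 \<le> w x k" using x(1) by (simp add: feas_def)
    ultimately show ?thesis by linarith
  qed
  define y where "y = x(p := x p + t * \<alpha>, n := x n + t * \<beta>)"
  have wy: "w y k = w x k - t * F k" for k by (simp add: y_def F_def slack_move[OF pn(1)])
  have ypn: "0 \<le> x p + t * \<alpha>" "0 \<le> x n + t * \<beta>"
    using nonneg[of t] t0 tF by (auto simp: F_def)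
  have y: "feas y"
    unfolding feas_def using ypn x(1) wy tF by (auto simp: y_def feas_def)
  have yj: "w y j = 0" using wy[of j] x(2) j by (simp add: F_def)
  have yk: "w y k0 = 0" using wy[of k0] k0 by simp
  have "\<not> R 2 y"
  proof
    assume "R 2 y"
    then have "R (Suc 2) x" by (rule pair_step[OF x(1) y pn(1) y_def t0 pn(2) j yk w0])
    then show False using x(4) by (simp add: eval_nat_numeral)
  qed
  moreover have "y i \<le> 1" if "i \<noteq> p" "i \<noteq> n" for i using others that by (simp add: y_def)
  ultimately have "exit_pair j p n \<and> 1 < y p \<and> 1 < y n"
    using two_face_exit_pair[OF y yj yk] k0j by blast
  then show ?thesis using that[of t] t0 tF pn(1) by (auto simp: y_def F_def)
qed

section \<open>First steps along the edges at \<open>u\<close>\<close>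

text \<open>The point where the edge at \<open>u\<close> in direction \<open>a\<close> meets the
  hyperplane \<open>w j = 0\<close>. It is the end of the edge if \<open>M j a\<close> is positive
  and the largest entry of its column.\<close>

definition edge_end :: "4 \<Rightarrow> 4 \<Rightarrow> 4 \<Rightarrow> real" where
  "edge_end j a = (\<lambda>i. if i = a then 1 / M j a else 0)"

lemma w_edge_end: "w (edge_end j a) k = 1 - M k a / M j a"
  by (simp add: w_def edge_end_def if_distrib cong: if_cong)

text \<open>A tie in column \<open>a\<close> would put the endpoint on two facets of
  \<open>v\<close>; then \<open>two_face_exit_pair\<close> would produce two coordinates above 1,
  but only one is nonzero.\<close>

lemma first_step:
  assumes "0 < M j a" "\<And>k. M k a \<le> M j a" "\<not> R 4 (\<lambda>_. 0)"
  shows "feas (edge_end j a)" "w (edge_end j a) j = 0" "\<not> R 3 (edge_end j a)" "k \<noteq> j \<Longrightarrow> M k a < M j a"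
    "k \<noteq> j \<Longrightarrow> 0 < w (edge_end j a) k"
proof -
  show f: "feas (edge_end j a)"
  proof -
    have "0 \<le> edge_end j a i" for i using assms by (simp add: edge_end_def)
    moreover have "0 \<le> w (edge_end j a) k" for k using assms by (simp add: w_edge_end)
    ultimately show ?thesis by (simp add: feas_def)
  qed
  show wj: "w (edge_end j a) j = 0" using assms by (simp add: w_edge_end)
  show nR: "\<not> R 3 (edge_end j a)"
  proof
    assume R: "R 3 (edge_end j a)"
    have "R (Suc 3) (\<lambda>_. 0)"
    proof (rule R_step[OF _ f _ _ _ R])
      show "feas (\<lambda>_. 0)" by (simp add: feas_def w_def)
      show "\<exists>i. 0 \<noteq> edge_end j a i" using assms by (intro exI[of _ a]) (simp add: edge_end_def)
      show "(\<exists>i. edge_end j a i = 0 \<and> 0 < (0::real)) \<or> (\<exists>k. w (edge_end j a) k = 0 \<and> 0 < w (\<lambda>_. 0) k)"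
        using wj by (auto simp: w_def)
      fix h :: "4 \<Rightarrow> real"
      assume h0: "\<And>i. 0 = edge_end j a i \<Longrightarrow> h i = 0"
      have "h i = (h a * M j a) * (edge_end j a i - 0)" for i
        using h0[of i] assms by (auto simp: edge_end_def)
      then show "\<exists>c. \<forall>i. h i = c * (edge_end j a i - 0)" by blast
    qed
    then show False using assms by simp
  qed
  assume k: "k \<noteq> j"
  show lt: "M k a < M j a"
  proof (rule ccontr)
    assume "\<not> ?thesis"
    then have e: "M k a = M j a" using assms(2)[of k] by linarith
    then have wk: "w (edge_end j a) k = 0" using assms by (simp add: w_edge_end)
    have "\<not> R 2 (edge_end j a)" using nR R_le[of 2 _ 3] by auto
    obtain n :: 4 where n: "n \<noteq> a" using fourth_index by blast
    have "exit_pair j a n \<and> 1 < edge_end j a a \<and> 1 < edge_end j a n"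
      by (rule two_face_exit_pair[OF f wj wk k[symmetric] \<open>\<not> R 2 (edge_end j a)\<close>]) (simp add: edge_end_def)
    then show False using n by (simp add: edge_end_def)
  qed
  then show "0 < w (edge_end j a) k" using assms by (simp add: w_edge_end)
qed

text \<open>If the largest entry of a column is at least 1, all coordinates of the edge end are at
  most 1. From there every positive bracket between a positive and a nonpositive entry of row
  \<open>j\<close> yields an exit pair. It remains to find two such brackets for each other
  row.\<close>

lemma no_entry_ge_1:
  assumes nR: "\<not> R 4 (\<lambda>_. 0)"
  shows "M j0 a < 1"
proof (rule ccontr)
  assume "\<not> ?thesis"
  then have ge0: "1 \<le> M j0 a" by simp
  obtain j where j: "\<And>k. M k a \<le> M j a"
  proof -
    obtain j where "M j a = Max (range (\<lambda>k. M k a))"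
      using Max_in[of "range (\<lambda>k. M k a)"] by fastforce
    then have "\<And>k. M k a \<le> M j a" by simp
    then show ?thesis using that by blast
  qed
  have ge: "1 \<le> M j a" using j[of j0] ge0 by linarith
  then have pos: "0 < M j a" by simp
  note fs = first_step[OF pos j nR]
  have y1_le: "edge_end j a i \<le> 1" for i using ge by (simp add: edge_end_def)
  have y1_ge: "0 \<le> edge_end j a i" for i using pos by (simp add: edge_end_def)
  have hit1: "exit_pair j p n \<and> (\<exists>t>0. 1 < edge_end j a p + t * - M j n \<and> 1 < t * M j p \<and>
      (\<forall>k. t * bracket j k p n \<le> w (edge_end j a) k))"
    if h: "t \<noteq> j" "0 < M j p" "M j n \<le> 0" "0 < bracket j t p n" for p n t
  proof -
    have pn: "p \<noteq> n" using h by auto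
    have y1n: "edge_end j a n = 0" using h pos by (auto simp: edge_end_def)
    have F: "M k p * - M j n + M k n * M j p = bracket j k p n" for k by (simp add: bracket_def)
    have nn: "0 \<le> edge_end j a p + s * - M j n" "0 \<le> edge_end j a n + s * M j p" if "0 \<le> s" for s
    proof -
      have "s * M j n \<le> 0" "0 \<le> s * M j p" using that h by (auto simp: mult_le_0_iff)
      then show "0 \<le> edge_end j a p + s * - M j n" "0 \<le> edge_end j a n + s * M j p"
        using y1_ge[of p] y1_ge[of n] by auto
    qed
    obtain s where "0 < s" "exit_pair j p n" "1 < edge_end j a p + s * - M j n" "1 < edge_end j a n + s * M j p"
      "\<And>k. s * (M k p * - M j n + M k n * M j p) \<le> w (edge_end j a) k"
      by (rule hit[OF fs(1,2,5,3) pn, of "- M j n" "M j p" t])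
        (use h y1_le nn in \<open>auto simp: bracket_def algebra_simps\<close>)
    then show ?thesis unfolding F using y1n by auto
  qed
  \<comment> \<open>The vector from the edge end to \<open>v\<close>. Its image under
    \<open>M\<close> is the slack vector at the edge end, which vanishes in row
    \<open>j\<close>.\<close>
  define \<xi> where "\<xi> i = 1 - edge_end j a i" for i
  have \<xi>: "0 \<le> \<xi> i" "\<xi> i \<le> 1" for i using y1_le[of i] y1_ge[of i] by (auto simp: \<xi>_def)
  have M\<xi>: "(\<Sum>i\<in>UNIV. M k i * \<xi> i) = w (edge_end j a) k" for k
    using row_sum[of k] by (simp add: \<xi>_def w_def algebra_simps sum_subtractf)
  define P where "P = {i. 0 < M j i}"
  define N where "N = {i. M j i \<le> 0}"
  have un: "UNIV = P \<union> N" "P \<inter> N = {}" by (auto simp: P_def N_def)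
  have split: "(\<Sum>i\<in>UNIV. g i) = (\<Sum>i\<in>P. g i) + (\<Sum>i\<in>N. g i)" for g :: "4 \<Rightarrow> real"
    unfolding un(1) using un(2) by (intro sum.union_disjoint) auto
  define T where "T = (\<Sum>p\<in>P. M j p * \<xi> p)"
  have TN: "(\<Sum>n\<in>N. M j n * \<xi> n) = - T"
    using M\<xi>[of j] fs(2) by (simp add: split T_def)
  have T0: "0 \<le> T" unfolding T_def using \<xi> by (intro sum_nonneg) (auto simp: P_def)
  have ident: "(\<Sum>p\<in>P. \<Sum>n\<in>N. \<xi> p * \<xi> n * bracket j t p n) = T * w (edge_end j a) t" for t
  proof -
    have "(\<Sum>p\<in>P. \<Sum>n\<in>N. \<xi> p * \<xi> n * bracket j t p n) =
        (\<Sum>p\<in>P. M j p * \<xi> p) * (\<Sum>n\<in>N. M t n * \<xi> n) - (\<Sum>p\<in>P. M t p * \<xi> p) * (\<Sum>n\<in>N. M j n * \<xi> n)"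
      unfolding bracket_def by (rule sum_bracket)
    also have "\<dots> = T * (\<Sum>i\<in>UNIV. M t i * \<xi> i)"
      unfolding TN T_def[symmetric] split by (simp add: distrib_left)
    finally show ?thesis by (simp add: M\<xi>)
  qed
  show False
  proof (rule no_two_pairs_per_row[of j])
    show "exit_pair j p n" if "t \<noteq> j" "0 < M j p" "M j n \<le> 0" "0 < bracket j t p n" for p n t
      using hit1 that by blast
    fix t p0 n0 assume t: "t \<noteq> j"
    have \<omega>: "0 < w (edge_end j a) t" using fs(5) t by blast
    show "\<exists>p n. (p \<noteq> p0 \<or> n \<noteq> n0) \<and> 0 < M j p \<and> M j n \<le> 0 \<and> 0 < bracket j t p n"
    proof (rule ccontr)
      assume "\<not> ?thesis"
      then have only: "bracket j t p n \<le> 0" if "p \<noteq> p0 \<or> n \<noteq> n0" "p \<in> P" "n \<in> N" for p n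
        using that by (force simp: P_def N_def)
      show False
      proof (cases "T = 0")
        case True
        \<comment> \<open>Here \<open>\<xi>\<close> vanishes on \<open>P\<close>, and on
          \<open>N\<close> it is supported where row \<open>j\<close> is zero. This gives an
          \<open>n\<close> with \<open>M j n = 0\<close> and a positive bracket with
          \<open>a\<close>; but the corresponding step leaves \<open>x a\<close> unchanged and thus
          at most 1.\<close>
        have "M j p * \<xi> p = 0" if "p \<in> P" for p
          using that True \<xi> sum_nonneg_eq_0_iff[of P "\<lambda>p. M j p * \<xi> p"] by (auto simp: T_def P_def)
        then have \<xi>P: "\<xi> p = 0" if "p \<in> P" for p using that by (force simp: P_def)
        have "(\<Sum>n\<in>N. M t n * \<xi> n) = w (edge_end j a) t" using M\<xi>[of t] \<xi>P by (simp add: split)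
        then have "0 < (\<Sum>n\<in>N. M t n * \<xi> n)" using \<omega> by simp
        then obtain n where n: "n \<in> N" "0 < M t n * \<xi> n" by (rule sum_pos_obtains)
        have "- (M j n * \<xi> n) = 0"
        proof -
          have "(\<Sum>n\<in>N. - (M j n * \<xi> n)) = 0" using TN True by (simp add: sum_negf)
          moreover have "0 \<le> - (M j n * \<xi> n)" if "n \<in> N" for n
            using that \<xi> by (simp add: N_def mult_le_0_iff)
          ultimately show ?thesis using n(1) sum_nonneg_eq_0_iff[of N "\<lambda>n. - (M j n * \<xi> n)"] by auto
        qed
        then have Mn: "M j n = 0" using n by auto
        have "0 < M t n" using n \<xi>[of n] by (auto simp: zero_less_mult_iff)
        then have "0 < bracket j t a n" using Mn pos by (simp add: bracket_def)
        then obtain s where "1 < edge_end j a a + s * - M j n"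
          using hit1[OF t pos eq_refl[OF Mn]] by blast
        then show False using y1_le[of a] Mn by simp
      next
        case False
        then have Tp: "0 < T" using T0 by simp
        then have S: "0 < (\<Sum>p\<in>P. \<Sum>n\<in>N. \<xi> p * \<xi> n * bracket j t p n)" using ident \<omega> by simp
        then obtain p where p: "p \<in> P" "0 < (\<Sum>n\<in>N. \<xi> p * \<xi> n * bracket j t p n)"
          by (rule sum_pos_obtains)
        obtain n where n: "n \<in> N" "0 < \<xi> p * \<xi> n * bracket j t p n"
          using p(2) by (rule sum_pos_obtains)
        have "0 \<le> \<xi> p * \<xi> n" using \<xi> by simp
        then have brp: "0 < bracket j t p n"
          using n(2) mult_nonneg_nonpos[of "\<xi> p * \<xi> n" "bracket j t p n"] by linarith
        then have eq: "p0 = p" "n0 = n" using only p n by force+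
        have le: "\<xi> u * \<xi> v * bracket j t u v \<le> (if u = p \<and> v = n then \<xi> p * \<xi> n * bracket j t p n else 0)"
          if "u \<in> P" "v \<in> N" for u v
          using only[of u v] that \<xi>[of u] \<xi>[of v] eq by (auto simp: mult_le_0_iff)
        have "(\<Sum>u\<in>P. \<Sum>v\<in>N. \<xi> u * \<xi> v * bracket j t u v) \<le>
            (\<Sum>u\<in>P. \<Sum>v\<in>N. (if u = p \<and> v = n then \<xi> p * \<xi> n * bracket j t p n else 0))"
          using le by (intro sum_mono) auto
        also have "\<dots> = (\<Sum>u\<in>P. (if u = p then \<xi> p * \<xi> n * bracket j t p n else 0))"
          using n(1) by (intro sum.cong) auto
        also have "\<dots> = \<xi> p * \<xi> n * bracket j t p n" using p(1) by simp
        finally have b1: "T * w (edge_end j a) t \<le> \<xi> p * \<xi> n * bracket j t p n" by (simp add: ident)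
        obtain s where s: "0 < s" "1 < s * M j p" "s * bracket j t p n \<le> w (edge_end j a) t"
          using hit1[OF t _ _ brp] p n by (auto simp: P_def N_def)
        \<comment> \<open>A single positive bracket bounds the whole sum \<open>T * w\<close>. With
          the bound on the step length \<open>s\<close>, cancelling the bracket gives
          \<open>T * s \<le> \<xi> p\<close>. Since \<open>M j p * \<xi> p\<close> is one of the
          terms of \<open>T\<close>, \<open>s * M j p\<close>, the new value of \<open>x n\<close>,
          is at most 1.\<close>
        have "T * (s * bracket j t p n) \<le> \<xi> p * \<xi> n * bracket j t p n"
          using b1 mult_left_mono[OF s(3), of T] Tp by linarith
        then have "(T * s) * bracket j t p n \<le> (\<xi> p * \<xi> n) * bracket j t p n" by (simp add: algebra_simps)
        then have "T * s \<le> \<xi> p * \<xi> n" using brp by simp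
        also have "\<dots> \<le> \<xi> p" using \<xi>[of p] \<xi>[of n] by (simp add: mult_left_le)
        finally have "T * s * M j p \<le> \<xi> p * M j p"
          using p by (intro mult_right_mono) (auto simp: P_def)
        also have "\<xi> p * M j p \<le> T"
          unfolding T_def using member_le_sum[of p P "\<lambda>p. M j p * \<xi> p"] p \<xi>
          by (auto simp: P_def algebra_simps)
        finally have "T * (s * M j p) \<le> T * 1" by (simp add: algebra_simps)
        then show False using Tp s(2) by simp
      qed
    qed
  qed
qed

text \<open>The edge at \<open>u\<close> in direction \<open>a\<close> ends in the facet \<open>w j = 0\<close> and in no other facet of \<open>v\<close>.\<close>

definition ends_in :: "4 \<Rightarrow> 4 \<Rightarrow> bool" where
  "ends_in j a \<longleftrightarrow> 0 < M j a \<and> (\<forall>k. k \<noteq> j \<longrightarrow> M k a < M j a)"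

lemma ends_in_unique: "ends_in j a \<Longrightarrow> ends_in k a \<Longrightarrow> j = k"
  unfolding ends_in_def by (metis less_asym)

lemma ends_in_exists:
  assumes nR: "\<not> R 4 (\<lambda>_. 0)" and pos: "0 < M j0 a"
  obtains j where "ends_in j a"
proof -
  obtain j where "M j a = Max (range (\<lambda>k. M k a))"
    using Max_in[of "range (\<lambda>k. M k a)"] by fastforce
  then have j: "\<And>k. M k a \<le> M j a" by simp
  have p: "0 < M j a" using j[of j0] pos by linarith
  show ?thesis using that[of j] first_step(4)[OF p j nR] p by (auto simp: ends_in_def)
qed

text \<open>At the end of the edge, \<open>x b\<close> grows and \<open>x a\<close> compensates to
  keep \<open>w j = 0\<close>. If \<open>M j b \<le> 0\<close>, then \<open>x a\<close> does not
  decrease; if \<open>M j b < M k b\<close>, then \<open>w k\<close> vanishes no later than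
  \<open>x a\<close>. So \<open>hit\<close> applies, and \<open>X\<close> and \<open>Y\<close> are
  the final values of \<open>x a\<close> and \<open>x b\<close>.\<close>

lemma ends_in_hit:
  assumes nR: "\<not> R 4 (\<lambda>_. 0)" and a: "ends_in j a" and b: "b \<noteq> a" "0 < bracket j k a b"
    and side: "M j b \<le> 0 \<or> M j b < M k b"
  shows "exit_pair j a b"
    and "\<exists>X>1. \<exists>Y>1. M j a * X + M j b * Y = 1 \<and> (\<forall>k. M k a * X + M k b * Y \<le> 1)"
proof -
  have pos: "0 < M j a" and le: "\<And>k. M k a \<le> M j a"
    using a unfolding ends_in_def by (auto intro: less_imp_le) 
  note fs = first_step[OF pos le nR]
  have edge_end: "edge_end j a a = 1 / M j a" "edge_end j a b = 0" using b by (auto simp: edge_end_def)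
  have nn: "0 \<le> 1 / M j a + t * - M j b"
    if t: "0 \<le> t" "\<forall>k. t * (M k a * - M j b + M k b * M j a) \<le> w (edge_end j a) k" for t
  proof (cases "M j b \<le> 0")
    case True
    then have "t * M j b \<le> 0" using t by (simp add: mult_le_0_iff)
    moreover have "0 \<le> 1 / M j a" using pos by simp
    ultimately show ?thesis unfolding mult_minus_right by linarith
  next
    case False
    then have jb: "0 < M j b" "M j b < M k b" using side by auto
    have br: "bracket j k a b = M j a * M k b - M j b * M k a" by (simp add: bracket_def)
    have "t * bracket j k a b \<le> 1 - M k a / M j a"
      using t(2)[rule_format, of k] by (simp add: w_edge_end br algebra_simps)
    then have "M j a * (t * bracket j k a b) \<le> M j a * (1 - M k a / M j a)"
      using pos by (intro mult_left_mono) auto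
    also have "\<dots> = M j a - M k a" using pos by (simp add: field_simps)
    finally have 1: "M j a * t * bracket j k a b \<le> M j a - M k a" by (simp add: mult.assoc)
    have "M j b * (M j a - M k a) \<le> bracket j k a b"
    proof -
      have "M j a * M j b \<le> M j a * M k b" using jb pos by simp
      then show ?thesis by (simp add: br algebra_simps)
    qed
    moreover have "M j b * (M j a * t * bracket j k a b) \<le> M j b * (M j a - M k a)"
      using 1 jb by (intro mult_left_mono) auto
    ultimately have "(M j b * M j a * t) * bracket j k a b \<le> 1 * bracket j k a b" by (simp add: algebra_simps)
    then have "M j b * M j a * t \<le> 1" using b(2) by (simp only: mult_le_cancel_right_pos)
    then show ?thesis using pos by (simp add: field_simps)
  qed
  obtain t where t: "0 < t" "exit_pair j a b" "1 < edge_end j a a + t * - M j b" "1 < edge_end j a b + t * M j a"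
    "\<And>k. t * (M k a * - M j b + M k b * M j a) \<le> w (edge_end j a) k"
  proof (rule hit[OF fs(1,2,5,3), of a b "- M j b" "M j a" k])
    fix t :: real
    assume "0 \<le> t" "\<forall>k. t * (M k a * - M j b + M k b * M j a) \<le> w (edge_end j a) k"
    then show "0 \<le> edge_end j a a + t * - M j b \<and> 0 \<le> edge_end j a b + t * M j a"
      using nn[of t] edge_end pos by simp
  qed (use b pos in \<open>auto simp: bracket_def algebra_simps edge_end_def\<close>)
  then show "exit_pair j a b" by simp
  define X where "X = 1 / M j a + t * - M j b"
  define Y where "Y = t * M j a"
  have "1 < X" "1 < Y" using t edge_end by (auto simp: X_def Y_def)
  moreover have "M j a * X + M j b * Y = 1" using pos by (simp add: X_def Y_def field_simps)
  moreover have "M k a * X + M k b * Y \<le> 1" for k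
    using t(5)[of k] by (simp add: w_edge_end X_def Y_def algebra_simps)
  ultimately show "\<exists>X>1. \<exists>Y>1. M j a * X + M j b * Y = 1 \<and> (\<forall>k. M k a * X + M k b * Y \<le> 1)"
    by blast
qed

text \<open>Column \<open>b\<close> has its maximum in another row \<open>k\<close>, so
  \<open>M j b < M k b\<close> and \<open>M k a < M j a\<close>; together these make the bracket
  positive.\<close>

lemma ends_in_hit_pos:
  assumes nR: "\<not> R 4 (\<lambda>_. 0)" and a: "ends_in j a" and b: "0 < M j b" "\<not> ends_in j b"
  shows "exit_pair j a b"
    and "\<exists>X>1. \<exists>Y>1. M j a * X + M j b * Y = 1 \<and> (\<forall>k. M k a * X + M k b * Y \<le> 1)"
    and "\<exists>k. k \<noteq> j \<and> ends_in k b"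
proof -
  obtain k where k: "ends_in k b" using ends_in_exists[OF nR b(1)] .
  then have kj: "k \<noteq> j" using b by auto
  then show "\<exists>k. k \<noteq> j \<and> ends_in k b" using k by blast
  have ba: "b \<noteq> a" using a b by auto
  have lt: "M j b < M k b" "M k a < M j a" "0 < M j a" using k a kj by (auto simp: ends_in_def)
  have "M j b * M k a < M j b * M j a" using lt b by simp
  also have "\<dots> < M k b * M j a" using lt by simp
  finally have "0 < bracket j k a b" by (simp add: bracket_def mult.commute)
  from ends_in_hit[OF nR a ba this disjI2[OF lt(1)]]
  show "exit_pair j a b" "\<exists>X>1. \<exists>Y>1. M j a * X + M j b * Y = 1 \<and> (\<forall>k. M k a * X + M k b * Y \<le> 1)"
    by auto
qed

text \<open>Otherwise every positive bracket of row \<open>j\<close> yields an exit pair by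
  \<open>ends_in_hit\<close>, and each other row has two of them: the brackets that avoid a
  prescribed positive index still have a positive sum.\<close>

lemma not_all_top:
  assumes nR: "\<not> R 4 (\<lambda>_. 0)" and a: "ends_in j a"
  shows "\<exists>b. 0 < M j b \<and> \<not> ends_in j b"
proof (rule ccontr)
  assume "\<not> ?thesis"
  then have all: "\<And>b. 0 < M j b \<Longrightarrow> ends_in j b" by blast
  have lt1: "M k i < 1" for k i using no_entry_ge_1[OF nR] .
  show False
  proof (rule no_two_pairs_per_row[of j])
    fix p n t assume h: "t \<noteq> j" "0 < M j p" "M j n \<le> 0" "0 < bracket j t p n"
    moreover have "n \<noteq> p" using h by auto
    ultimately show "exit_pair j p n" using ends_in_hit(1)[OF nR all[OF h(2)], of n t] by auto
  next
    fix t p0 n0 assume t: "t \<noteq> j"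
    define P where "P = {i. 0 < M j i}"
    define N where "N = {i. M j i \<le> 0}"
    have un: "UNIV = P \<union> N" "P \<inter> N = {}" by (auto simp: P_def N_def)
    \<comment> \<open>The index to avoid. If \<open>p0\<close> is not in \<open>P\<close>, then
      every \<open>p\<close> in \<open>P\<close> differs from it, and \<open>a\<close> serves as a
      default.\<close>
    define p1 where "p1 = (if p0 \<in> P then p0 else a)"
    have p1: "p1 \<in> P" using a by (simp add: p1_def P_def ends_in_def)
    define P' where "P' = P - {p1}"
    have split: "(\<Sum>i\<in>UNIV. g i) = g p1 + (\<Sum>i\<in>P'. g i) + (\<Sum>i\<in>N. g i)" for g :: "4 \<Rightarrow> real"
    proof -
      have "(\<Sum>i\<in>UNIV. g i) = (\<Sum>i\<in>P. g i) + (\<Sum>i\<in>N. g i)"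
        unfolding un(1) using un(2) by (intro sum.union_disjoint) auto
      then show ?thesis using p1 by (simp add: P'_def sum.remove)
    qed
    define rP where "rP = (\<Sum>i\<in>P'. M j i)"
    define fP where "fP = (\<Sum>i\<in>P'. M t i)"
    define rN where "rN = (\<Sum>i\<in>N. M j i)"
    define fN where "fN = (\<Sum>i\<in>N. M t i)"
    have s: "M j p1 + rP + rN = 1" "M t p1 + fP + fN = 1"
      using row_sum[of j] row_sum[of t] by (auto simp: split rP_def fP_def rN_def fN_def)
    have "rN \<le> 0" unfolding rN_def by (intro sum_nonpos) (auto simp: N_def)
    then have rP: "0 < rP" using s lt1[of j p1] by linarith
    then have ne: "P' \<noteq> {}" by (auto simp: rP_def)
    have lt: "M t i < M j i" if "i \<in> P" for i using all[of i] that t by (auto simp: P_def ends_in_def)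
    have fP: "fP < rP" unfolding fP_def rP_def using ne lt by (intro sum_strict_mono) (auto simp: P'_def)
    have "(\<Sum>p\<in>P'. \<Sum>n\<in>N. bracket j t p n) = rP * fN - rN * fP"
      using sum_bracket[of "\<lambda>_. 1" "M j" "M t" N P']
      by (simp add: rP_def fP_def rN_def fN_def bracket_def mult.commute)
    also have "\<dots> = rP * (1 - M t p1) - fP * (1 - M j p1)"
    proof -
      have fN: "fN = 1 - M t p1 - fP" and rN: "rN = 1 - M j p1 - rP" using s by auto
      show ?thesis unfolding fN rN by (simp add: algebra_simps)
    qed
    also have "\<dots> > 0"
    proof -
      have "fP * (1 - M j p1) < rP * (1 - M j p1)" using fP lt1[of j p1] by simp
      also have "\<dots> < rP * (1 - M t p1)" using rP lt[OF p1] by simp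
      finally show ?thesis by simp
    qed
    finally have "0 < (\<Sum>p\<in>P'. \<Sum>n\<in>N. bracket j t p n)" .
    then obtain p where p: "p \<in> P'" "0 < (\<Sum>n\<in>N. bracket j t p n)" by (rule sum_pos_obtains)
    obtain n where n: "n \<in> N" "0 < bracket j t p n" using p(2) by (rule sum_pos_obtains)
    have "p \<noteq> p0" using p(1) by (auto simp: P'_def p1_def split: if_splits)
    then show "\<exists>p n. (p \<noteq> p0 \<or> n \<noteq> n0) \<and> 0 < M j p \<and> M j n \<le> 0 \<and> 0 < bracket j t p n"
      using p n by (auto simp: P'_def P_def N_def)
  qed
qed

text \<open>By \<open>not_all_top\<close> some positive entry \<open>b\<close> has its edge end
  elsewhere. Pairing with \<open>a\<close> or with \<open>b\<close> puts every positive index into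
  the image of \<open>c\<close> on \<open>- {j}\<close>, which has at most three elements. As
  \<open>X\<close> and \<open>Y\<close> exceed 1, \<open>M j a + M j b < 1\<close>, so there is a
  third positive entry, and the image is exactly the set of positive indices.\<close>

lemma ends_in_row:
  assumes nR: "\<not> R 4 (\<lambda>_. 0)" and a: "ends_in j a"
  obtains d where "M j d \<le> 0" "\<And>i. i \<noteq> d \<Longrightarrow> 0 < M j i" "c ` (- {j}) = - {d}"
    "inj_on c (- {j})" "\<And>a k. ends_in j a \<Longrightarrow> k \<noteq> j \<Longrightarrow> bracket j k a d \<le> 0"
proof -
  obtain b where b: "0 < M j b" "\<not> ends_in j b" using not_all_top[OF nR a] by blast
  have Ma: "0 < M j a" using a by (simp add: ends_in_def)
  have ab: "a \<noteq> b" using a b by auto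
  have C: "p \<in> c ` (- {j})" if "0 < M j p" for p
    using ends_in_hit_pos(1)[OF nR a, of p] ends_in_hit_pos(1)[OF nR _ b, of p] that exit_pair_mem by blast
  obtain X Y where XY: "1 < X" "1 < Y" "M j a * X + M j b * Y = 1"
    using ends_in_hit_pos(2)[OF nR a b] by blast
  have "\<exists>e. e \<noteq> a \<and> e \<noteq> b \<and> 0 < M j e"
  proof (rule ccontr)
    assume n: "\<not> ?thesis"
    obtain e f where d: "distinct [a, b, e, f]" using complete_pair_4[OF ab] .
    then have "M j e \<le> 0" "M j f \<le> 0" using n by (auto simp: not_less)
    then have "1 \<le> M j a + M j b" using row_sum[of j] sum_4_distinct[OF d, of "M j"] by simp
    moreover have "M j a < M j a * X" "M j b < M j b * Y" using XY Ma b by auto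
    ultimately show False using XY by linarith
  qed
  then obtain e where e: "e \<noteq> a" "e \<noteq> b" "0 < M j e" by blast
  obtain d where d: "d \<noteq> a" "d \<noteq> b" "d \<noteq> e" using fourth_index by blast
  have dist: "distinct [a, b, e, d]" using d e ab by auto
  have sub: "{a, b, e} \<subseteq> c ` (- {j})" using C Ma b e by auto
  have c3: "card {a, b, e} = 3" using dist by auto
  have eq: "c ` (- {j}) = {a, b, e}"
    using card_seteq[OF _ sub] c3 card_c_image[of j] by simp
  have dC: "d \<notin> c ` (- {j})" using eq d by auto
  have compl: "- {d} = {a, b, e}" using exhaust_4_distinct[OF dist] dist by auto
  have "card (- {j} :: 4 set) = 3" by (simp add: Compl_eq_Diff_UNIV)
  then have "inj_on c (- {j})" using eq c3 by (intro eq_card_imp_inj_on) auto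
  moreover have Md: "M j d \<le> 0" using C dC by (meson not_le)
  moreover have "bracket j k u d \<le> 0" if u: "ends_in j u" and k: "k \<noteq> j" for u k
  proof (rule ccontr)
    assume "\<not> ?thesis"
    moreover have "d \<noteq> u" using u Md by (auto simp: ends_in_def)
    ultimately have "exit_pair j u d" using ends_in_hit(1)[OF nR u, of d k] Md by auto
    then show False using exit_pair_mem dC by blast
  qed
  moreover have "0 < M j i" if "i \<noteq> d" for i
    using exhaust_4_distinct[OF dist, of i] that Ma b(1) e(3) by blast
  ultimately show ?thesis using that[of d] eq compl by simp
qed

section \<open>Distribution of the edge ends over the facets of \<open>v\<close>\<close>

text \<open>Both \<open>(a, b)\<close> and \<open>(a, e)\<close> are exit pairs of row
  \<open>j1\<close>, so they share a column \<open>s1\<close> of \<open>Q\<close>. In both rows the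
  brackets between \<open>a\<close> and each of \<open>b\<close> and \<open>e\<close>, suitably
  oriented, are positive. With these signs, rows \<open>j1\<close>, \<open>j2\<close> and a further
  row \<open>t\<close> cannot have the products with column \<open>s1\<close> that \<open>MQ\<close>
  prescribes.\<close>

lemma two_tops:
  assumes nR: "\<not> R 4 (\<lambda>_. 0)" and d: "distinct [a, b, e, d]" and j12: "j1 \<noteq> j2"
    and top: "ends_in j1 a" "ends_in j2 b" "ends_in j2 e"
    and neg: "\<And>k. M k d \<le> 0" and pos: "\<And>i. i \<noteq> d \<Longrightarrow> 0 < M j1 i \<and> 0 < M j2 i"
    and br: "\<And>k. k \<noteq> j1 \<Longrightarrow> bracket j1 k a d \<le> 0" "\<And>k. k \<noteq> j2 \<Longrightarrow> bracket j2 k b d \<le> 0"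
      "\<And>k. k \<noteq> j2 \<Longrightarrow> bracket j2 k e d \<le> 0"
    and inj: "inj_on c (- {j2})"
  shows False
proof -
  note sum4 = sum_4_distinct[OF d]
  have lt1: "M k i < 1" for k i using no_entry_ge_1[OF nR] .
  have nt: "\<not> ends_in j1 b" "\<not> ends_in j1 e" "\<not> ends_in j2 a" using top ends_in_unique j12 by blast+
  have p: "0 < M j1 a" "0 < M j1 b" "0 < M j1 e" "0 < M j2 a" "0 < M j2 b" "0 < M j2 e"
    using pos d by auto
  note h1b = ends_in_hit_pos[OF nR top(1) p(2) nt(1)] and h1e = ends_in_hit_pos[OF nR top(1) p(3) nt(2)]
  note h2b = ends_in_hit_pos[OF nR top(2) p(4) nt(3)] and h2e = ends_in_hit_pos[OF nR top(3) p(4) nt(3)]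
  have lt: "M k a < M j1 a" if "k \<noteq> j1" for k using top that by (auto simp: ends_in_def)
  have lt2: "M k b < M j2 b" "M k e < M j2 e" if "k \<noteq> j2" for k using top that by (auto simp: ends_in_def)
  \<comment> \<open>Since rows sum to 1, the brackets at a fixed index add up to a difference in one
    column. An upper bound for one bracket thus gives positivity of another.\<close>
  have brsum: "bracket j k i a + bracket j k i b + bracket j k i e + bracket j k i d = M j i - M k i" for j k i
  proof -
    have "bracket j k i a + bracket j k i b + bracket j k i e + bracket j k i d =
        M j i * (M k a + M k b + M k e + M k d) - M k i * (M j a + M j b + M j e + M j d)"
      by (simp add: bracket_def algebra_simps)
    then show ?thesis using row_sum[of j] row_sum[of k] by (simp add: sum4)
  qed
  have br_self: "bracket j k i i = 0" for j k i by (simp add: bracket_def)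
  have lt_br: "bracket j1 k a x < M j1 a - M k a"
    if k: "k \<noteq> j1" and ex: "\<exists>X>1. \<exists>Y>1. M j1 a * X + M j1 x * Y = 1 \<and> (\<forall>k. M k a * X + M k x * Y \<le> 1)"
    for k x
  proof -
    obtain X Y where XY: "1 < X" "1 < Y" "M j1 a * X + M j1 x * Y = 1" "M k a * X + M k x * Y \<le> 1"
      using ex by blast
    have "Y * bracket j1 k a x = M j1 a * (M k a * X + M k x * Y) - M k a * (M j1 a * X + M j1 x * Y)"
      by (simp add: bracket_def algebra_simps)
    also have "\<dots> \<le> M j1 a - M k a" using XY p(1) by (simp add: mult_left_le)
    finally have le: "Y * bracket j1 k a x \<le> M j1 a - M k a" .
    show ?thesis
    proof (cases "0 < bracket j1 k a x")
      case True
      then have "bracket j1 k a x < Y * bracket j1 k a x" using XY by simp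
      then show ?thesis using le by linarith
    next
      case False then show ?thesis using lt[OF k] by linarith
    qed
  qed
  have br1: "0 < bracket j1 k a b" "0 < bracket j1 k a e" if "k \<noteq> j1" for k
    using brsum[of j1 k a] br_self[of j1 k a] lt_br[OF that h1b(2)] lt_br[OF that h1e(2)]
      br(1)[OF that] by linarith+
  have part: "bracket j2 k x y < M j2 x - M k x"
    if "k \<noteq> j2" "0 < M j2 x" "0 < M j2 y" "M k y < M j2 y" "M k x < M j2 x" for k x y
  proof -
    have "bracket j2 k x y < M j2 x * M j2 y - M j2 y * M k x" using that by (simp add: bracket_def)
    also have "\<dots> = M j2 y * (M j2 x - M k x)" by (simp add: algebra_simps)
    also have "\<dots> \<le> 1 * (M j2 x - M k x)" using that lt1[of j2 y] by (intro mult_right_mono) auto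
    finally show ?thesis by simp
  qed
  have br2: "0 < bracket j2 k b a" "0 < bracket j2 k e a" if "k \<noteq> j2" for k
    using brsum[of j2 k b] brsum[of j2 k e] br_self[of j2 k b] br_self[of j2 k e]
      part[OF that p(5) p(6) lt2(2)[OF that] lt2(1)[OF that]]
      part[OF that p(6) p(5) lt2(1)[OF that] lt2(2)[OF that]] br(2,3)[OF that] by linarith+
  have dist1: "distinct [a, b, e]" using d by auto
  obtain s1 where s1: "s1 \<noteq> j1" "c s1 = a" "0 < Q a s1" "Q b s1 < 0" "Q e s1 < 0"
    using exit_pair_shared[OF h1b(1) h1e(1) dist1] .
  obtain s2 where s2: "s2 \<noteq> j2" "c s2 = a" "0 < Q a s2" "Q b s2 < 0" "Q e s2 < 0"
    using exit_pair_shared[OF exit_pair_sym[OF h2b(1)] exit_pair_sym[OF h2e(1)] dist1] .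
  obtain t where t: "t \<noteq> j1" "t \<noteq> j2" "t \<noteq> s1" using fourth_index by blast
  define z where "z i = Q i s1" for i
  have z: "0 < z a" "z b < 0" "z e < 0" using s1 by (auto simp: z_def)
  have M_z: "M k a * z a + M k b * z b + M k e * z e + M k d * z d = (if k = s1 then 1 else 0)" for k
    using MQ[of k s1] by (simp add: sum4 z_def)
  \<comment> \<open>Eliminating \<open>z a\<close> between rows \<open>j1\<close> and
    \<open>t\<close>, both orthogonal to \<open>z\<close>, determines the sign of
    \<open>z d\<close>.\<close>
  have "bracket j1 t a b * z b + bracket j1 t a e * z e + bracket j1 t a d * z d =
      M j1 a * (M t a * z a + M t b * z b + M t e * z e + M t d * z d) -
      M t a * (M j1 a * z a + M j1 b * z b + M j1 e * z e + M j1 d * z d)"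
    by (simp add: bracket_def algebra_simps)
  then have "bracket j1 t a b * z b + bracket j1 t a e * z e + bracket j1 t a d * z d = 0"
    using M_z[of t] M_z[of j1] t s1 by simp
  moreover have "bracket j1 t a b * z b < 0" "bracket j1 t a e * z e < 0"
    using br1[OF t(1)] z by (auto simp: mult_pos_neg)
  ultimately have "0 < bracket j1 t a d * z d" by linarith
  then have zd: "z d < 0" using br(1)[OF t(1)] by (auto simp: zero_less_mult_iff)
  \<comment> \<open>The entry \<open>z d\<close> is replaced by a variable \<open>y\<close>, because
    in the case \<open>s1 = j2\<close> row \<open>j2\<close> is not orthogonal to \<open>z\<close>
    itself. Multiplying by \<open>T\<close> turns the claim into a combination of brackets of row
    \<open>j2\<close> with known signs.\<close>
  have key: "0 < M t a * z a + M t b * z b + M t e * z e + M t d * y"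
    if y: "y < 0" "M j2 a * z a + M j2 b * z b + M j2 e * z e + M j2 d * y = 0" for y
  proof -
    define T where "T = - M j2 b * z b - M j2 e * z e"
    have "M j2 b * z b < 0" "M j2 e * z e < 0" using p z by (auto simp: mult_pos_neg)
    then have T: "0 < T" by (simp add: T_def)
    have eq: "M j2 a * z a + M j2 d * y = T" using y by (simp add: T_def)
    have "T * (M t a * z a + M t b * z b + M t e * z e + M t d * y) =
        T * (M t a * z a + M t d * y) + (M j2 a * z a + M j2 d * y) * (M t b * z b + M t e * z e)"
      unfolding eq by (simp add: algebra_simps)
    also have "\<dots> = - z b * (z a * bracket j2 t b a + y * bracket j2 t b d) - z e * (z a * bracket j2 t e a + y * bracket j2 t e d)"
      by (simp add: T_def bracket_def algebra_simps)
    also have "\<dots> > 0"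
    proof -
      have "0 < z a * bracket j2 t b a + y * bracket j2 t b d" "0 < z a * bracket j2 t e a + y * bracket j2 t e d"
        using z y br2[OF t(2)] br(2,3)[OF t(2)]
        by (auto intro!: add_pos_nonneg mult_pos_pos mult_nonpos_nonpos)
      then have "z b * (z a * bracket j2 t b a + y * bracket j2 t b d) < 0"
        "z e * (z a * bracket j2 t e a + y * bracket j2 t e d) < 0" using z by (auto simp: mult_neg_pos)
      then show ?thesis by simp
    qed
    finally show ?thesis using T by (simp add: zero_less_mult_iff)
  qed
  show False
  proof (cases "s1 = j2")
    case False
    then show False using key[OF zd] M_z[of j2] M_z[of t] t by simp
  next
    case True
    have e1: "M j1 a * z a + M j1 b * z b + M j1 e * z e + M j1 d * z d = 0"
      using M_z[of j1] s1 by simp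
    have e2: "M j2 a * z a + M j2 b * z b + M j2 e * z e + M j2 d * z d = 1"
      using M_z[of j2] True by simp
    have "M j2 a * z a \<le> M j1 a * z a" using lt[of j2] j12 z by simp
    moreover have "M j2 b * z b \<le> M j1 b * z b" "M j2 e * z e \<le> M j1 e * z e"
      using lt2[of j1] j12 z by auto
    moreover have "0 \<le> M j1 d * z d" using neg zd by (simp add: mult_nonpos_nonpos)
    ultimately have ge: "1 \<le> M j2 d * z d" using e1 e2 by linarith
    then have nd: "M j2 d < 0" using zd neg[of j2] by (cases "M j2 d = 0") auto
    have strict: "1 < M j2 d * z d"
    proof -
      have "M j2 a * z a < M j1 a * z a" using lt[of j2] j12 z by simp
      then show ?thesis
        using \<open>M j2 b * z b \<le> M j1 b * z b\<close> \<open>M j2 e * z e \<le> M j1 e * z e\<close>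
          \<open>0 \<le> M j1 d * z d\<close> e1 e2 by linarith
    qed
    \<comment> \<open>Row \<open>j2\<close> has product 1 with \<open>z\<close>; this change of the
      entry at \<open>d\<close> makes the product zero, as \<open>key\<close> requires.\<close>
    define y where "y = z d - 1 / M j2 d"
    have edge_end: "M j2 d * y = M j2 d * z d - 1" using nd by (simp add: y_def field_simps)
    then have "0 < M j2 d * y" using strict by simp
    then have y: "y < 0" using nd by (simp add: zero_less_mult_iff)
    have "0 < M t a * z a + M t b * z b + M t e * z e + M t d * y"
      using key[OF y] e2 edge_end by simp
    also have "\<dots> = - (M t d / M j2 d)" using M_z[of t] t by (simp add: y_def algebra_simps)
    also have "\<dots> \<le> 0" using neg[of t] nd by (simp add: divide_nonpos_neg)
    finally show False by simp
  qed
qed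

text \<open>Either a column is nonpositive in a row in which an edge ends and positive in another
  row, or one column \<open>d\<close> is nonpositive throughout. The first case is excluded by
  comparing three rows. In the second, the remaining three edges end in only two facets of
  \<open>v\<close>, which \<open>two_tops\<close> excludes.\<close>

theorem reach_4: "R 4 (\<lambda>_. 0)"
proof (rule ccontr)
  assume nR: "\<not> R 4 (\<lambda>_. 0)"
  show False
  proof (cases "\<exists>j a d k. ends_in j a \<and> M j d \<le> 0 \<and> 0 < M k d")
    case True
    then obtain j a d k where a: "ends_in j a" and d: "M j d \<le> 0" "0 < M k d" by blast
    obtain d0 where 1: "M j d0 \<le> 0" "\<And>i. i \<noteq> d0 \<Longrightarrow> 0 < M j i" "c ` (- {j}) = - {d0}"
      "inj_on c (- {j})" "\<And>a k. ends_in j a \<Longrightarrow> k \<noteq> j \<Longrightarrow> bracket j k a d0 \<le> 0"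
      using ends_in_row[OF nR a] by metis
    have d0: "d0 = d" using 1(2)[of d] d by fastforce
    note 1 = 1[unfolded d0]
    obtain j' where d': "ends_in j' d" using ends_in_exists[OF nR d(2)] .
    have jj: "j' \<noteq> j" using d d' by (auto simp: ends_in_def)
    obtain a0 where 2: "M j' a0 \<le> 0" "\<And>i. i \<noteq> a0 \<Longrightarrow> 0 < M j' i" "c ` (- {j'}) = - {a0}"
      "\<And>a k. ends_in j' a \<Longrightarrow> k \<noteq> j' \<Longrightarrow> bracket j' k a a0 \<le> 0"
      using ends_in_row[OF nR d'] by metis
    have M'd: "0 < M j' d" using d' by (simp add: ends_in_def)
    \<comment> \<open>The bracket condition with \<open>d\<close> forces \<open>M j d\<close> and
      \<open>M j' u\<close> to be negative, so \<open>u\<close> is the only nonpositive index of row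
      \<open>j'\<close>.\<close>
    have all_a: "u = a0 \<and> M j d < 0" if "ends_in j u" for u
    proof -
      have "M j u * M j' d \<le> M j d * M j' u" using 1(5)[OF that jj] by (simp add: bracket_def)
      moreover have "0 < M j u * M j' d" using that M'd by (simp add: ends_in_def)
      ultimately have "0 < M j d * M j' u" by linarith
      then have "M j d < 0 \<and> M j' u < 0" using d(1) by (auto simp: zero_less_mult_iff)
      then show ?thesis using 2(2)[of u] by fastforce
    qed
    then have a0: "a0 = a" and Md: "M j d < 0" using a by auto
    note 2 = 2[unfolded a0]
    have Ma: "0 < M j a" using a by (simp add: ends_in_def)
    have all_d: "u = d" if "ends_in j' u" for u
    proof -
      have "M j' u * M j a \<le> M j' a * M j u" using 2(4)[OF that jj[symmetric]] by (simp add: bracket_def)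
      moreover have "0 < M j' u * M j a" using that Ma by (simp add: ends_in_def)
      ultimately have "0 < M j' a * M j u" by linarith
      then have "M j u < 0" using 2(1) by (auto simp: zero_less_mult_iff)
      then show ?thesis using 1(2)[of u] by fastforce
    qed
    obtain b where b: "b \<noteq> a" "b \<noteq> d" using fourth_index by blast
    obtain j'' where j'': "ends_in j'' b" using ends_in_exists[OF nR 1(2)[OF b(2)]] .
    have ne: "j'' \<noteq> j" "j'' \<noteq> j'" using all_a all_d j'' b a0 by auto
    obtain d'' where 3: "\<And>i. i \<noteq> d'' \<Longrightarrow> 0 < M j'' i" "c ` (- {j''}) = - {d''}"
      using ends_in_row[OF nR j''] by metis
    have ad: "a \<noteq> d" using Ma Md by auto
    \<comment> \<open>The value \<open>d\<close> is taken by \<open>c\<close> outside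
      \<open>j'\<close> but not outside \<open>j\<close>, so only at \<open>j\<close>; likewise
      \<open>a\<close> only at \<open>j'\<close>. Both remain values outside \<open>j''\<close>, so
      row \<open>j''\<close> is positive at \<open>a\<close> and \<open>d\<close>, against its
      bracket with row \<open>j\<close>.\<close>
    have "d \<in> c ` (- {j'})" "d \<notin> c ` (- {j})" "a \<in> c ` (- {j})" "a \<notin> c ` (- {j'})"
      using 1(3) 2(3) ad by auto
    then have "c j = d" "c j' = a" by (auto simp: image_iff)
    then have "d \<in> c ` (- {j''})" "a \<in> c ` (- {j''})" using ne by auto
    then have "d'' \<noteq> d" "d'' \<noteq> a" using 3(2) by auto
    then have "0 < M j'' a" "0 < M j'' d" using 3(1) by auto
    moreover have "M j a * M j'' d \<le> M j d * M j'' a" using 1(5)[OF a ne(1)] by (simp add: bracket_def)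
    ultimately show False using Ma Md by (smt (verit) mult_neg_pos mult_pos_pos)
  next
    case False
    then have neg: "\<And>j a d k. ends_in j a \<Longrightarrow> M j d \<le> 0 \<Longrightarrow> M k d \<le> 0" by (meson not_le)
    have "0 < (\<Sum>a\<in>UNIV. M 1 a)" using row_sum[of 1] by simp
    then obtain a where "0 < M 1 a" by (rule sum_pos_obtains)
    then obtain j1 where a: "ends_in j1 a" by (rule ends_in_exists[OF nR])
    obtain d where 1: "M j1 d \<le> 0" "\<And>i. i \<noteq> d \<Longrightarrow> 0 < M j1 i" "c ` (- {j1}) = - {d}"
      "inj_on c (- {j1})" "\<And>a k. ends_in j1 a \<Longrightarrow> k \<noteq> j1 \<Longrightarrow> bracket j1 k a d \<le> 0"
      using ends_in_row[OF nR a] by metis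
    have Md: "M k d \<le> 0" for k using neg[OF a 1(1)] .
    have row: "(\<forall>i. i \<noteq> d \<longrightarrow> 0 < M j i) \<and> c ` (- {j}) = - {d} \<and> inj_on c (- {j}) \<and>
        (\<forall>a k. ends_in j a \<longrightarrow> k \<noteq> j \<longrightarrow> bracket j k a d \<le> 0)" if u: "ends_in j u" for j u
    proof -
      obtain d' where *: "M j d' \<le> 0" "\<And>i. i \<noteq> d' \<Longrightarrow> 0 < M j i" "c ` (- {j}) = - {d'}"
        "inj_on c (- {j})" "\<And>a k. ends_in j a \<Longrightarrow> k \<noteq> j \<Longrightarrow> bracket j k a d' \<le> 0"
        using ends_in_row[OF nR u] by metis
      have "d' = d" using *(2)[of d] Md[of j] by fastforce
      then show ?thesis using * by auto
    qed
    obtain b where b: "0 < M j1 b" "\<not> ends_in j1 b" using not_all_top[OF nR a] by blast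
    obtain j2 where j2: "j2 \<noteq> j1" "ends_in j2 b" using ends_in_hit_pos(3)[OF nR a b] by blast
    have abd: "a \<noteq> b" "a \<noteq> d" "b \<noteq> d" using a b 1(1) by (auto simp: ends_in_def)
    obtain e where e: "e \<noteq> a" "e \<noteq> b" "e \<noteq> d" using fourth_index by blast
    obtain j3 where j3: "ends_in j3 e" using ends_in_exists[OF nR 1(2)[OF e(3)]] .
    have "j3 = j1 \<or> j3 = j2"
    proof (rule ccontr)
      assume n: "\<not> ?thesis"
      \<comment> \<open>\<open>c\<close> takes the same values outside \<open>j1\<close> as outside
        \<open>j2\<close>, so two indices share a value. If \<open>c\<close> is injective on
        \<open>- {j}\<close>, then \<open>j\<close> is one of these two, which is impossible for
        three different rows.\<close>
      have "\<not> inj_on c UNIV"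
      proof
        assume i: "inj_on c UNIV"
        have "c j1 \<in> c ` (- {j2})" using j2 by auto
        then have "c j1 \<noteq> d" using row[OF j2(2)] by auto
        then have "c j1 \<in> c ` (- {j1})" using 1(3) by auto
        then show False using i by (auto simp: inj_on_def)
      qed
      then obtain x y where xy: "x \<noteq> y" "c x = c y" by (auto simp: inj_on_def)
      have *: "j = x \<or> j = y" if "inj_on c (- {j})" for j
        using inj_onD[OF that xy(2)] xy(1) by blast
      have "inj_on c (- {j2})" "inj_on c (- {j3})" using row[OF j2(2)] row[OF j3] by simp_all
      then show False using *[OF 1(4)] *[of j2] *[of j3] n j2(1) by metis
    qed
    have r1: "0 < M j1 i \<and> 0 < M j2 i" if "i \<noteq> d" for i
      using row[OF a] row[OF j2(2)] that by blast
    have inj: "inj_on c (- {j1})" "inj_on c (- {j2})" using row[OF a] row[OF j2(2)] by simp_all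
    have br_le: "bracket j k u d \<le> 0" if "ends_in j u" "k \<noteq> j" for j k u using row[OF that(1)] that by blast
    from \<open>j3 = j1 \<or> j3 = j2\<close> show False
    proof
      assume j: "j3 = j2"
      have d: "distinct [a, b, e, d]" using abd e by auto
      show False
        by (rule two_tops[OF nR d _ a j2(2) j3[unfolded j] Md r1 br_le br_le br_le inj(2)])
          (use a j2 j3[unfolded j] in auto)
    next
      assume j: "j3 = j1"
      have d: "distinct [b, a, e, d]" using abd e by auto
      have r2: "0 < M j2 i \<and> 0 < M j1 i" if "i \<noteq> d" for i using r1[OF that] by simp
      show False
        by (rule two_tops[OF nR d _ j2(2) a j3[unfolded j] Md r2 br_le br_le br_le inj(1)])
          (use a j2 j3[unfolded j] in auto)
    qed
  qed
qed

end

section \<open>Circuit steps and coordinates on faces\<close>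

text \<open>Induction on \<open>F\<close>. If \<open>a f\<close> vanishes on \<open>L\<close>, it is
  skipped. Otherwise the dual basis of its kernel in \<open>L\<close> is extended by a vector with
  value 1 at \<open>f\<close>, corrected so that it vanishes at the other chosen
  functionals.\<close>

lemma dual_basis:
  fixes a :: "'i \<Rightarrow> 'x :: real_inner"
  assumes "finite F" "subspace L" "\<forall>x\<in>L. (\<forall>i\<in>F. a i \<bullet> x = 0) \<longrightarrow> x = 0"
  shows "\<exists>B e. B \<subseteq> F \<and> (\<forall>i\<in>B. e i \<in> L) \<and>
    (\<forall>i\<in>B. \<forall>j\<in>B. a j \<bullet> e i = (if i = j then 1 else 0)) \<and>
    (\<forall>x\<in>L. x = (\<Sum>i\<in>B. (a i \<bullet> x) *\<^sub>R e i))"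
  using assms
proof (induction F arbitrary: L rule: finite_induct)
  case empty
  then have "L \<subseteq> {0}" by blast
  then show ?case by auto
next
  case (insert f F)
  show ?case
  proof (cases "\<forall>x\<in>L. a f \<bullet> x = 0")
    case True
    then have "\<forall>x\<in>L. (\<forall>i\<in>F. a i \<bullet> x = 0) \<longrightarrow> x = 0" using insert.prems(2) by simp
    from insert.IH[OF insert.prems(1) this] obtain B e where "B \<subseteq> F" "\<forall>i\<in>B. e i \<in> L"
      "\<forall>i\<in>B. \<forall>j\<in>B. a j \<bullet> e i = (if i = j then 1 else 0)"
      "\<forall>x\<in>L. x = (\<Sum>i\<in>B. (a i \<bullet> x) *\<^sub>R e i)" by blast
    then show ?thesis by (intro exI[of _ B] exI[of _ e]) auto
  next
    case False
    then obtain x0 where x0: "x0 \<in> L" "a f \<bullet> x0 \<noteq> 0" by blast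
    define L' where "L' = {x \<in> L. a f \<bullet> x = 0}"
    have L': "subspace L'"
      using insert.prems(1) unfolding L'_def subspace_def by (simp add: inner_add_right)
    have "\<forall>x\<in>L'. (\<forall>i\<in>F. a i \<bullet> x = 0) \<longrightarrow> x = 0"
      using insert.prems(2) by (simp add: L'_def)
    from insert.IH[OF L' this] obtain B e where B: "B \<subseteq> F" "\<And>i. i \<in> B \<Longrightarrow> e i \<in> L'"
      "\<And>i j. i \<in> B \<Longrightarrow> j \<in> B \<Longrightarrow> a j \<bullet> e i = (if i = j then 1 else 0)"
      "\<And>x. x \<in> L' \<Longrightarrow> x = (\<Sum>i\<in>B. (a i \<bullet> x) *\<^sub>R e i)" by blast
    have fB: "finite B" using B(1) insert.hyps finite_subset by blast
    have f: "f \<notin> B" using B(1) insert.hyps by blast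
    define x1 where "x1 = (1 / (a f \<bullet> x0)) *\<^sub>R x0"
    have x1: "x1 \<in> L" "a f \<bullet> x1 = 1"
      using x0 insert.prems(1) by (auto simp: x1_def subspace_scale)
    have eL: "e i \<in> L" "a f \<bullet> e i = 0" if "i \<in> B" for i using B(2)[OF that] by (auto simp: L'_def)
    define e0 where "e0 = x1 - (\<Sum>i\<in>B. (a i \<bullet> x1) *\<^sub>R e i)"
    have e0L: "e0 \<in> L"
      unfolding e0_def using x1 eL insert.prems(1)
      by (intro subspace_diff subspace_sum subspace_scale) auto
    have e0f: "a f \<bullet> e0 = 1" using x1 eL by (simp add: e0_def inner_diff_right inner_sum_right)
    have e0j: "a j \<bullet> e0 = 0" if "j \<in> B" for j
    proof -
      have "(\<Sum>i\<in>B. (a i \<bullet> x1) * (a j \<bullet> e i)) = (\<Sum>i\<in>B. if i = j then a i \<bullet> x1 else 0)"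
        using B(3) that by (intro sum.cong) auto
      then show ?thesis using fB that by (simp add: e0_def inner_diff_right inner_sum_right)
    qed
    define e' where "e' = e(f := e0)"
    have rep: "x = (\<Sum>i\<in>insert f B. (a i \<bullet> x) *\<^sub>R e' i)" if "x \<in> L" for x
    proof -
      define y where "y = x - (a f \<bullet> x) *\<^sub>R e0"
      have "y \<in> L'"
        unfolding L'_def y_def using that e0L e0f insert.prems(1)
        by (auto simp: inner_diff_right intro: subspace_diff subspace_scale)
      then have "y = (\<Sum>i\<in>B. (a i \<bullet> y) *\<^sub>R e i)" by (rule B(4))
      also have "\<dots> = (\<Sum>i\<in>B. (a i \<bullet> x) *\<^sub>R e' i)"
        using e0j f by (intro sum.cong) (auto simp: y_def e'_def inner_diff_right)
      finally have "x = (a f \<bullet> x) *\<^sub>R e0 + (\<Sum>i\<in>B. (a i \<bullet> x) *\<^sub>R e' i)"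
        by (simp add: y_def algebra_simps)
      then show ?thesis using f fB by (simp add: e'_def)
    qed
    show ?thesis
    proof (intro exI conjI)
      show "insert f B \<subseteq> insert f F" using B(1) by blast
      show "\<forall>i\<in>insert f B. e' i \<in> L" using e0L eL by (auto simp: e'_def)
      show "\<forall>i\<in>insert f B. \<forall>j\<in>insert f B. a j \<bullet> e' i = (if i = j then 1 else 0)"
        using e0f e0j eL B(3) f by (auto simp: e'_def)
      show "\<forall>x\<in>L. x = (\<Sum>i\<in>insert f B. (a i \<bullet> x) *\<^sub>R e' i)" using rep by blast
    qed
  qed
qed

lemma dim_dual_basis:
  fixes a :: "'i \<Rightarrow> 'x :: euclidean_space"
  assumes "finite B" "\<And>i. i \<in> B \<Longrightarrow> e i \<in> L"
    and dual: "\<And>i j. i \<in> B \<Longrightarrow> j \<in> B \<Longrightarrow> a j \<bullet> e i = (if i = j then 1 else 0)"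
    and rep: "\<And>x. x \<in> L \<Longrightarrow> x = (\<Sum>i\<in>B. (a i \<bullet> x) *\<^sub>R e i)"
  shows "dim L = card B"
proof -
  have inj: "inj_on e B"
  proof
    fix i j assume "i \<in> B" "j \<in> B" "e i = e j"
    then show "i = j" using dual[of i i] dual[of j i] by (metis zero_neq_one)
  qed
  have "independent (e ` B)"
  proof (rule independent_if_scalars_zero)
    show "finite (e ` B)" using assms by simp
    fix g x assume s: "(\<Sum>x\<in>e ` B. g x *\<^sub>R x) = 0" and x: "x \<in> e ` B"
    then obtain j where j: "j \<in> B" "x = e j" by blast
    have "(\<Sum>i\<in>B. g (e i) *\<^sub>R e i) = 0" using s by (simp add: sum.reindex[OF inj])
    then have "0 = a j \<bullet> (\<Sum>i\<in>B. g (e i) *\<^sub>R e i)" by simp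
    also have "\<dots> = (\<Sum>i\<in>B. if i = j then g (e i) else 0)"
      unfolding inner_sum_right using dual j by (intro sum.cong) auto
    also have "\<dots> = g x" using j assms(1) by simp
    finally show "g x = 0" by simp
  qed
  moreover have "L \<subseteq> span (e ` B)"
  proof
    fix x assume "x \<in> L"
    then have "x = (\<Sum>i\<in>B. (a i \<bullet> x) *\<^sub>R e i)" by (rule rep)
    moreover have "(\<Sum>i\<in>B. (a i \<bullet> x) *\<^sub>R e i) \<in> span (e ` B)"
      by (intro span_sum span_scale span_base) auto
    ultimately show "x \<in> span (e ` B)" by simp
  qed
  moreover have "e ` B \<subseteq> L" using assms(2) by blast
  ultimately have "card (e ` B) = dim L" using basis_card_eq_dim by blast
  then show ?thesis by (simp add: card_image[OF inj])
qed

lemma span_pair_dim_2: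
  fixes L :: "'x :: euclidean_space set"
  assumes "subspace L" "dim L = 2" "m \<in> L" "n \<in> L" "m \<noteq> 0" "n \<notin> span {m}" "h \<in> L"
  obtains \<alpha> \<beta> where "h = \<alpha> *\<^sub>R m + \<beta> *\<^sub>R n"
proof -
  have ind: "independent {m, n}"
    using assms independent_insert[of n "{m}"] by (simp add: insert_commute)
  have "m \<noteq> n" using assms span_base by blast
  then have "card {m, n} = dim L" using assms by simp
  then have "L \<subseteq> span {m, n}"
    using card_eq_dim[of "{m, n}" L] ind assms by auto
  then have "h \<in> span {m, n}" using assms by blast
  then obtain \<alpha> where "h - \<alpha> *\<^sub>R m \<in> span {n}" by (auto simp: span_insert)
  then obtain \<beta> where "h - \<alpha> *\<^sub>R m = \<beta> *\<^sub>R n" by (auto simp: span_singleton)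
  then have "h = \<alpha> *\<^sub>R m + \<beta> *\<^sub>R n" by (simp add: algebra_simps)
  then show ?thesis by (rule that)
qed

section \<open>Circuit steps, walks and vertices\<close>

lemma mem_polyhedron: "z \<in> polyhedron_of A b \<longleftrightarrow> (\<forall>i. b $ i \<le> A $ i \<bullet> z)"
  by (simp add: polyhedron_of_def less_eq_vec_def matrix_vector_mul_component)

lemma circuit_scale:
  fixes A :: "real ^ 'd ^ 'f"
  assumes g: "g \<noteq> 0" and min: "\<And>x. x \<noteq> 0 \<Longrightarrow> \<not> supp (A *v x) \<subset> supp (A *v g)"
  obtains c where "0 < c" "circuit A (c *\<^sub>R g)"
proof -
  have supp_scale: "supp (A *v (c *\<^sub>R g)) = supp (A *v g)" if "c \<noteq> 0" for c
    using that by (simp add: supp_def matrix_vector_mul_component)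
  have circ: "circuit A (c *\<^sub>R g)"
    if "0 < c" "(\<exists>d>0. integral_vec (d *\<^sub>R c *\<^sub>R g)) \<longrightarrow> coprime_integral_vec (c *\<^sub>R g)" for c
    using that g min supp_scale unfolding circuit_def by auto
  show ?thesis
  proof (cases "\<exists>c>0. integral_vec (c *\<^sub>R g)")
    case False
    then have "circuit A (1 *\<^sub>R g)" by (intro circ) auto
    then show ?thesis using that[of 1] by simp
  next
    case True
    then obtain c where c: "0 < c" "integral_vec (c *\<^sub>R g)" by blast
    then have "\<forall>i. \<exists>z. (c *\<^sub>R g) $ i = of_int z" unfolding integral_vec_def by (blast elim: Ints_cases)
    then obtain z :: "'d \<Rightarrow> int" where z: "\<And>i. (c *\<^sub>R g) $ i = of_int (z i)" by metis
    define G where "G = Gcd (range z)"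
    obtain i where "g $ i \<noteq> 0" using g by (auto simp: vec_eq_iff)
    then have zi: "z i \<noteq> 0" using z[of i] c by auto
    then have G0: "G \<noteq> 0" unfolding G_def by (auto simp: Gcd_0_iff)
    have "0 \<le> G" unfolding G_def by simp
    then have G: "0 < G" using G0 by simp
    define z' where "z' i = z i div G" for i
    have zz: "z i = G * z' i" for i
      unfolding z'_def using dvd_mult_div_cancel[of G "z i"] by (simp add: G_def)
    then have "range z = (*) G ` range z'" by (auto simp: image_iff)
    then have "G = normalize (G * Gcd (range z'))" unfolding G_def by (metis Gcd_mult)
    then have "G = G * Gcd (range z')" using G by (simp add: abs_mult)
    then have "Gcd (range z') = 1" using G by simp
    moreover have "((c / of_int G) *\<^sub>R g) $ i = of_int (z' i)" for i
      using z[of i] zz[of i] G by (simp add: field_simps)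
    ultimately have "coprime_integral_vec ((c / of_int G) *\<^sub>R g)"
      unfolding coprime_integral_vec_def by blast
    then have "circuit A ((c / of_int G) *\<^sub>R g)" using c G by (intro circ) auto
    then show ?thesis using that c G by (meson divide_pos_pos of_int_0_less_iff)
  qed
qed

text \<open>By \<open>el\<close> the rows that are constant along the segment determine its
  direction up to scale, so its support is minimal. Row \<open>i\<close> becomes tight at
  \<open>y'\<close> and is violated beyond it.\<close>

lemma circuit_stepI:
  fixes A :: "real ^ 'd ^ 'f"
  assumes ne: "y' \<noteq> y"
    and el: "\<And>h. (\<And>i. A $ i \<bullet> y = A $ i \<bullet> y' \<Longrightarrow> A $ i \<bullet> h = 0) \<Longrightarrow> \<exists>c. h = c *\<^sub>R (y' - y)"
    and bl: "A $ i \<bullet> y' = b $ i" "b $ i < A $ i \<bullet> y"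
  shows "circuit_step A b y y'"
proof -
  have "\<not> supp (A *v x) \<subset> supp (A *v (y' - y))" if "x \<noteq> 0" for x
  proof
    assume s: "supp (A *v x) \<subset> supp (A *v (y' - y))"
    have "A $ i \<bullet> x = 0" if "A $ i \<bullet> y = A $ i \<bullet> y'" for i
      using s that by (auto simp: supp_def matrix_vector_mul_component inner_diff_right)
    then obtain c where "x = c *\<^sub>R (y' - y)" using el by blast
    then have "supp (A *v x) = supp (A *v (y' - y))"
      using \<open>x \<noteq> 0\<close> by (simp add: supp_def matrix_vector_mul_component)
    then show False using s by simp
  qed
  then obtain c where c: "0 < c" "circuit A (c *\<^sub>R (y' - y))"
    using circuit_scale[of "y' - y" A] ne by (metis right_minus_eq)
  have "y + \<beta> *\<^sub>R c *\<^sub>R (y' - y) \<notin> polyhedron_of A b" if "\<beta> > 1 / c" for \<beta>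
  proof -
    have "1 < \<beta> * c" using that c by (simp add: field_simps)
    then have "(\<beta> * c - 1) * (A $ i \<bullet> y - b $ i) > 0" using bl by simp
    then have "A $ i \<bullet> (y + \<beta> *\<^sub>R c *\<^sub>R (y' - y)) < b $ i"
      using bl(1) by (simp add: inner_add_right inner_diff_right algebra_simps)
    then show ?thesis by (auto simp: mem_polyhedron not_le)
  qed
  then show ?thesis
    unfolding circuit_step_def using c by (intro exI[of _ "c *\<^sub>R (y' - y)"] exI[of _ "1 / c"]) auto
qed

definition reach :: "real ^ 'd ^ 'f \<Rightarrow> real ^ 'f \<Rightarrow> real ^ 'd \<Rightarrow> nat \<Rightarrow> real ^ 'd \<Rightarrow> bool" where
  "reach A b v k y \<longleftrightarrow> (\<exists>m\<le>k. \<exists>Y. circuit_walk A b m Y \<and> Y 0 = y \<and> Y m = v)"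

lemma reach_0: "v \<in> polyhedron_of A b \<Longrightarrow> reach A b v 0 v"
  unfolding reach_def circuit_walk_def by (intro exI[of _ 0] conjI exI[of _ "\<lambda>_. v"]) auto

lemma reach_mono: "reach A b v k y \<Longrightarrow> k \<le> l \<Longrightarrow> reach A b v l y"
  unfolding reach_def by (blast intro: le_trans)

lemma reach_step:
  assumes "y \<in> polyhedron_of A b" "circuit_step A b y y'" "reach A b v k y'"
  shows "reach A b v (Suc k) y"
proof -
  obtain m Y where Y: "m \<le> k" "circuit_walk A b m Y" "Y 0 = y'" "Y m = v"
    using assms(3) unfolding reach_def by blast
  have "circuit_walk A b (Suc m) (case_nat y Y)"
    using Y assms unfolding circuit_walk_def by (auto split: nat.split simp: less_Suc_eq_0_disj)
  then show ?thesis
    unfolding reach_def using Y by (intro exI[of _ "Suc m"] conjI exI[of _ "case_nat y Y"]) auto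
qed

lemma circuit_distance_le: "reach A b v k u \<Longrightarrow> circuit_distance A b u v \<le> enat k"
proof -
  assume "reach A b v k u"
  then obtain m Y where "m \<le> k" "circuit_walk A b m Y" "Y 0 = u" "Y m = v"
    unfolding reach_def by blast
  then have "circuit_distance A b u v \<le> enat m"
    unfolding circuit_distance_def by (intro Inf_lower) blast
  then show ?thesis using \<open>m \<le> k\<close> by (meson enat_ord_simps(1) order_trans)
qed

text \<open>Otherwise \<open>u\<close> is the midpoint of \<open>u + t *\<^sub>R h\<close> and
  \<open>u - t *\<^sub>R h\<close>, which for small \<open>t\<close> lie in the polyhedron: tight
  rows do not change, and the others have room.\<close>

lemma extreme_point_tight_rows:
  fixes A :: "real ^ 'd ^ 'f"
  assumes u: "u extreme_point_of polyhedron_of A b"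
    and h: "\<And>i. A $ i \<bullet> u = b $ i \<Longrightarrow> A $ i \<bullet> h = 0"
  shows "h = 0"
proof (rule ccontr)
  assume "h \<noteq> 0"
  have uP: "u \<in> polyhedron_of A b" using u by (simp add: extreme_point_of_def)
  have "\<forall>\<^sub>F t in at_right 0. \<forall>i. t * \<bar>A $ i \<bullet> h\<bar> \<le> A $ i \<bullet> u - b $ i"
  proof (rule eventually_all_finite)
    fix i
    show "\<forall>\<^sub>F t in at_right 0. t * \<bar>A $ i \<bullet> h\<bar> \<le> A $ i \<bullet> u - b $ i"
    proof (cases "A $ i \<bullet> u = b $ i")
      case True
      then show ?thesis using h by simp
    next
      case False
      then have "0 < A $ i \<bullet> u - b $ i" using uP by (simp add: mem_polyhedron order_less_le)
      moreover have "((\<lambda>t. t * \<bar>A $ i \<bullet> h\<bar>) \<longlongrightarrow> 0 * \<bar>A $ i \<bullet> h\<bar>) (at_right 0)"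
        by (intro tendsto_intros)
      ultimately have "\<forall>\<^sub>F t in at_right 0. t * \<bar>A $ i \<bullet> h\<bar> < A $ i \<bullet> u - b $ i"
        using order_tendstoD(2)[of "\<lambda>t. t * \<bar>A $ i \<bullet> h\<bar>" 0] by simp
      then show ?thesis by (rule eventually_mono) simp
    qed
  qed
  then have "\<forall>\<^sub>F t in at_right 0. 0 < t \<and> (\<forall>i. t * \<bar>A $ i \<bullet> h\<bar> \<le> A $ i \<bullet> u - b $ i)"
    using eventually_at_right_less by (rule eventually_elim2) auto
  then obtain t where t: "0 < t" "\<And>i. t * \<bar>A $ i \<bullet> h\<bar> \<le> A $ i \<bullet> u - b $ i"
    using eventually_happens'[OF trivial_limit_at_right_real] by blast
  have "\<bar>t * (A $ i \<bullet> h)\<bar> \<le> A $ i \<bullet> u - b $ i" for i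
    using t by (simp add: abs_mult)
  then have "u + t *\<^sub>R h \<in> polyhedron_of A b" "u - t *\<^sub>R h \<in> polyhedron_of A b"
    by (auto simp: mem_polyhedron inner_add_right inner_diff_right abs_le_iff)
      (smt (verit))+
  moreover have "u \<in> open_segment (u + t *\<^sub>R h) (u - t *\<^sub>R h)"
  proof -
    have "midpoint (u + t *\<^sub>R h) (u - t *\<^sub>R h) = u" by (simp add: midpoint_def algebra_simps flip: scaleR_2)
    moreover have "u + t *\<^sub>R h \<noteq> u - t *\<^sub>R h"
    proof
      assume "u + t *\<^sub>R h = u - t *\<^sub>R h"
      then have "(2 * t) *\<^sub>R h = 0" by (simp add: algebra_simps flip: scaleR_2)
      then show False using t \<open>h \<noteq> 0\<close> by simp
    qed
    ultimately show ?thesis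
      using midpoint_in_open_segment[of "u + t *\<^sub>R h" "u - t *\<^sub>R h"] by simp
  qed
  ultimately show False using u unfolding extreme_point_of_def by blast
qed

section \<open>The upper bound\<close>

text \<open>If a row of \<open>T\<close> is tight at \<open>y\<close>, one step along its line leads
  to \<open>v\<close>. Otherwise the rows \<open>E1\<close> and \<open>E2\<close> that bound the
  face at \<open>v\<close> serve as coordinates, at most four rows remain outside \<open>Z\<close>,
  and \<open>four_if_card_4\<close> applies.\<close>

lemma dim_polyhedral_face_2_reach:
  fixes A :: "real ^ 'd ^ 'f" and b :: "real ^ 'f"
  defines "P \<equiv> polyhedron_of A b"
  assumes v: "v \<in> P" and y: "y \<in> P"
    and L: "L = {h. \<forall>i\<in>Z. A $ i \<bullet> h = 0}" and Z: "\<And>i. i \<in> Z \<Longrightarrow> A $ i \<bullet> v = b $ i"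
    and yL: "y - v \<in> L" and dim: "dim L = 2"
    and trivial: "\<And>h. h \<in> L \<Longrightarrow> (\<And>i. A $ i \<bullet> v = b $ i \<Longrightarrow> A $ i \<bullet> h = 0) \<Longrightarrow> h = 0"
    and card: "card (- Z) \<le> 6"
  shows "reach A b v 4 y"
    and "A $ k \<bullet> y = b $ k \<Longrightarrow> b $ k < A $ k \<bullet> v \<Longrightarrow> reach A b v 3 y"
proof -
  let ?G = "reach A b v 4 y \<and> (\<forall>k. A $ k \<bullet> y = b $ k \<longrightarrow> b $ k < A $ k \<bullet> v \<longrightarrow> reach A b v 3 y)"
  have few: ?G if "reach A b v j y" "j \<le> 3" for j
    using that reach_mono[of A b v j y] by auto
  have subL: "subspace L" unfolding L subspace_def by (simp add: inner_add_right)
  define m where "m = y - v"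
  have mL: "m \<in> L" using yL by (simp add: m_def)
  have ge: "0 \<le> A $ i \<bullet> m" if "A $ i \<bullet> v = b $ i" for i
    using y that by (simp add: m_def P_def mem_polyhedron inner_diff_right)
  define T where "T = {i. A $ i \<bullet> v = b $ i \<and> (\<exists>h\<in>L. A $ i \<bullet> h \<noteq> 0)}"
  have trivT: "h = 0" if "h \<in> L" "\<And>i. i \<in> T \<Longrightarrow> A $ i \<bullet> h = 0" for h
    using trivial[OF that(1)] that by (auto simp: T_def)
  have TZ: "i \<notin> Z" if "i \<in> T" for i using that L by (auto simp: T_def)
  have ?G
  proof (cases "m = 0")
    case True
    then have "reach A b v 0 y" using reach_0 v by (simp add: m_def P_def)
    then show ?thesis by (rule few) simp
  next
    case m0: False
    obtain k0 where k0: "k0 \<in> T" "A $ k0 \<bullet> m \<noteq> 0" using trivT[OF mL] m0 by blast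
    show ?thesis
    proof (cases "\<exists>i\<in>T. A $ i \<bullet> m = 0")
      case True
      then obtain i where i: "i \<in> T" "A $ i \<bullet> m = 0" by blast
      obtain n where n: "n \<in> L" "A $ i \<bullet> n \<noteq> 0" using i by (auto simp: T_def)
      have nm: "n \<notin> span {m}" using i n by (auto simp: span_singleton)
      have "circuit_step A b y v"
      proof (rule circuit_stepI)
        show "v \<noteq> y" using m0 by (auto simp: m_def)
        show "A $ k0 \<bullet> v = b $ k0" using k0 by (simp add: T_def)
        then show "b $ k0 < A $ k0 \<bullet> y"
          using ge[of k0] k0 by (simp add: m_def inner_diff_right)
        fix h assume h: "\<And>i. A $ i \<bullet> y = A $ i \<bullet> v \<Longrightarrow> A $ i \<bullet> h = 0"
        have "A $ i \<bullet> h = 0" if "i \<in> Z" for i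
          using h[of i] mL that by (simp add: L m_def inner_diff_right)
        then have "h \<in> L" by (simp add: L)
        then obtain \<alpha> \<beta> where ab: "h = \<alpha> *\<^sub>R m + \<beta> *\<^sub>R n"
          using span_pair_dim_2[OF subL dim mL n(1) m0 nm] by blast
        have "A $ i \<bullet> h = 0" using h[of i] i by (simp add: m_def inner_diff_right)
        then have "\<beta> = 0" using ab i n by (simp add: inner_add_right)
        then have "h = (- \<alpha>) *\<^sub>R (v - y)" using ab by (simp add: m_def algebra_simps)
        then show "\<exists>c. h = c *\<^sub>R (v - y)" by blast
      qed
      then have "reach A b v (Suc 0) y" using reach_step y v reach_0 unfolding P_def by blast
      then show ?thesis by (rule few) simp
    next
      case False
      have pos: "0 < A $ i \<bullet> m" if "i \<in> T" for i
        using ge[of i] False that by (force simp: T_def)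
      have "\<exists>n\<in>L. n \<notin> span {m}"
      proof (rule ccontr)
        assume "\<not> ?thesis"
        then have "L \<subseteq> span {m}" by blast
        then have "dim L \<le> card {m}" by (rule dim_le_card) simp
        then show False using dim by simp
      qed
      then obtain n where n: "n \<in> L" "n \<notin> span {m}" by blast
      \<comment> \<open>On \<open>L\<close>, a row of \<open>T\<close> is determined up to a
        positive factor by its value on \<open>n\<close> relative to that on \<open>m\<close>. Every
        row of \<open>T\<close> is on \<open>L\<close> a nonnegative combination of the two with
        extreme ratio, which gives \<open>cc_zero\<close>.\<close>
      define t where "t i = (A $ i \<bullet> n) / (A $ i \<bullet> m)" for i
      have t: "A $ i \<bullet> n = t i * (A $ i \<bullet> m)" if "i \<in> T" for i
        using pos[OF that] by (simp add: t_def)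
      have finT: "finite T" "T \<noteq> {}" using k0 by auto
      define E1 where "E1 = arg_min_on t T"
      define E2 where "E2 = arg_min_on (\<lambda>i. - t i) T"
      have E: "E1 \<in> T" "E2 \<in> T"
        using arg_min_if_finite(1)[OF finT] by (auto simp: E1_def E2_def)
      have tE: "t E1 \<le> t i" "t i \<le> t E2" if "i \<in> T" for i
        using arg_min_least[OF finT that, of t] arg_min_least[OF finT that, of "\<lambda>i. - t i"]
        by (auto simp: E1_def E2_def)
      have lt: "t E1 < t E2"
      proof (rule ccontr)
        assume "\<not> ?thesis"
        then have "t i = t E1" if "i \<in> T" for i using tE[OF that] tE[OF E(1)] tE[OF E(2)] by linarith
        then have "A $ i \<bullet> (n - t E1 *\<^sub>R m) = 0" if "i \<in> T" for i
          using t[OF that] that by (simp add: inner_diff_right)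
        moreover have "n - t E1 *\<^sub>R m \<in> L" using subL n mL by (intro subspace_diff subspace_scale)
        ultimately have "n - t E1 *\<^sub>R m = 0" using trivT by blast
        then have "n \<in> span {m}" by (auto simp: span_singleton)
        then show False using n by simp
      qed
      \<comment> \<open>\<open>f1\<close> and \<open>f2\<close> form the basis of \<open>L\<close>
        dual to \<open>E1\<close> and \<open>E2\<close>; they are the edge directions at
        \<open>v\<close>.\<close>
      define f1 where "f1 = (1 / ((A $ E1 \<bullet> m) * (t E2 - t E1))) *\<^sub>R (t E2 *\<^sub>R m - n)"
      define f2 where "f2 = (1 / ((A $ E2 \<bullet> m) * (t E2 - t E1))) *\<^sub>R (n - t E1 *\<^sub>R m)"
      have fL: "f1 \<in> L" "f2 \<in> L"
        unfolding f1_def f2_def using subL n mL by (auto intro!: subspace_diff subspace_scale)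
      have Af1: "A $ i \<bullet> f1 = (A $ i \<bullet> m) * (t E2 - t i) / ((A $ E1 \<bullet> m) * (t E2 - t E1))"
        and Af2: "A $ i \<bullet> f2 = (A $ i \<bullet> m) * (t i - t E1) / ((A $ E2 \<bullet> m) * (t E2 - t E1))"
        if "i \<in> T" for i
        using t[OF that] by (simp_all add: f1_def f2_def inner_diff_right algebra_simps diff_divide_distrib)
      have dual: "A $ E1 \<bullet> f1 = 1" "A $ E1 \<bullet> f2 = 0" "A $ E2 \<bullet> f1 = 0" "A $ E2 \<bullet> f2 = 1"
        using Af1[OF E(1)] Af2[OF E(1)] Af1[OF E(2)] Af2[OF E(2)] pos[OF E(1)] pos[OF E(2)] lt by auto
      have rep: "h = (A $ E1 \<bullet> h) *\<^sub>R f1 + (A $ E2 \<bullet> h) *\<^sub>R f2" if "h \<in> L" for h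
      proof -
        define d where "d = h - ((A $ E1 \<bullet> h) *\<^sub>R f1 + (A $ E2 \<bullet> h) *\<^sub>R f2)"
        have "d \<in> L" unfolding d_def using that fL subL
          by (intro subspace_diff subspace_add subspace_scale)
        then obtain \<alpha> \<beta> where ab: "d = \<alpha> *\<^sub>R m + \<beta> *\<^sub>R n"
          using span_pair_dim_2[OF subL dim mL n(1) m0 n(2)] by blast
        have "A $ E1 \<bullet> d = 0" "A $ E2 \<bullet> d = 0"
          unfolding d_def using dual by (auto simp: inner_diff_right inner_add_right)
        then have "(A $ E1 \<bullet> m) * (\<alpha> + \<beta> * t E1) = 0" "(A $ E2 \<bullet> m) * (\<alpha> + \<beta> * t E2) = 0"
          unfolding ab using t[OF E(1)] t[OF E(2)] by (auto simp: inner_add_right algebra_simps)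
        then have z: "\<alpha> + \<beta> * t E1 = 0" "\<alpha> + \<beta> * t E2 = 0" using pos[OF E(1)] pos[OF E(2)] by auto
        have "\<beta> * (t E2 - t E1) = (\<alpha> + \<beta> * t E2) - (\<alpha> + \<beta> * t E1)" by (simp add: algebra_simps)
        then have "\<beta> * (t E2 - t E1) = 0" using z by simp
        then have "\<beta> = 0" using lt by simp
        then have "d = 0" using z ab by simp
        then show ?thesis by (simp add: d_def)
      qed
      define I where "I = - Z - {E1, E2}"
      have E12: "E1 \<noteq> E2" using lt by auto
      have cI: "card I \<le> 4"
      proof -
        have "{E1, E2} \<subseteq> - Z" using TZ E by auto
        then have "card I = card (- Z) - 2" unfolding I_def using E12 by (subst card_Diff_subset) auto
        then show ?thesis using card by simp
      qed
      define pt where "pt p q = v + p *\<^sub>R f1 + q *\<^sub>R f2" for p q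
      have Apt: "A $ i \<bullet> pt p q = A $ i \<bullet> v + p * (A $ i \<bullet> f1) + q * (A $ i \<bullet> f2)" for i p q
        by (simp add: pt_def inner_add_right)
      have ZL: "A $ i \<bullet> h = 0" if "i \<in> Z" "h \<in> L" for i h using that L by blast
      have Ev: "A $ E1 \<bullet> v = b $ E1" "A $ E2 \<bullet> v = b $ E2" using E by (auto simp: T_def)
      have ptP: "pt p q \<in> P" if "0 \<le> p" "0 \<le> q"
        "\<forall>i\<in>I. - (A $ i \<bullet> f1) * p + - (A $ i \<bullet> f2) * q \<le> A $ i \<bullet> v - b $ i" for p q
        unfolding P_def mem_polyhedron
      proof
        fix i
        consider "i \<in> Z" | "i = E1" | "i = E2" | "i \<in> I" by (auto simp: I_def)
        then show "b $ i \<le> A $ i \<bullet> pt p q"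
        proof cases
          case 1 then show ?thesis using Z[OF 1] ZL[OF 1] fL by (simp add: Apt)
        next
          case 4 then show ?thesis using that(3) by (force simp: Apt algebra_simps)
        qed (use that Ev dual in \<open>auto simp: Apt\<close>)
      qed
      interpret polygon "\<lambda>k p q. reach A b v k (pt p q)" I
        "\<lambda>i. - (A $ i \<bullet> f1)" "\<lambda>i. - (A $ i \<bullet> f2)" "\<lambda>i. A $ i \<bullet> v - b $ i"
      proof
        show "finite I" by simp
        show "0 \<le> A $ i \<bullet> v - b $ i" for i using v by (simp add: P_def mem_polyhedron)
        show "- (A $ i \<bullet> f1) \<le> 0 \<and> - (A $ i \<bullet> f2) \<le> 0"
          if "i \<in> I" "A $ i \<bullet> v - b $ i = 0" for i
        proof (cases "i \<in> T")
          case True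
          then show ?thesis
            using Af1 Af2 pos[OF True] pos[OF E(1)] pos[OF E(2)] tE[OF True] lt
            by (simp add: zero_le_divide_iff zero_le_mult_iff)
        next
          case False
          then have "A $ i \<bullet> f1 = 0 \<and> A $ i \<bullet> f2 = 0" using that fL by (auto simp: T_def)
          then show ?thesis by simp
        qed
        show "reach A b v 0 (pt 0 0)" using reach_0 v by (simp add: pt_def P_def)
        show "reach A b v (Suc k) (pt p q)" if "reach A b v k (pt p q)" for k p q
          using reach_mono[OF that] by simp
      next
        fix p q p' q' :: real and k
        assume 1: "0 \<le> p" "0 \<le> q"
            "\<forall>i\<in>I. - (A $ i \<bullet> f1) * p + - (A $ i \<bullet> f2) * q \<le> A $ i \<bullet> v - b $ i"
          and 2: "0 \<le> p'" "0 \<le> q'"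
            "\<forall>i\<in>I. - (A $ i \<bullet> f1) * p' + - (A $ i \<bullet> f2) * q' \<le> A $ i \<bullet> v - b $ i"
          and ne: "p' \<noteq> p \<or> q' \<noteq> q"
          and el: "p' = p \<or> q' = q \<or> (\<exists>i\<in>I. (- (A $ i \<bullet> f1) \<noteq> 0 \<or> - (A $ i \<bullet> f2) \<noteq> 0) \<and>
            - (A $ i \<bullet> f1) * p' + - (A $ i \<bullet> f2) * q' = - (A $ i \<bullet> f1) * p + - (A $ i \<bullet> f2) * q)"
          and bl: "p' = 0 \<and> 0 < p \<or> q' = 0 \<and> 0 < q \<or>
            (\<exists>i\<in>I. - (A $ i \<bullet> f1) * p' + - (A $ i \<bullet> f2) * q' = A $ i \<bullet> v - b $ i \<and>
              - (A $ i \<bullet> f1) * p + - (A $ i \<bullet> f2) * q < A $ i \<bullet> v - b $ i)"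
          and R: "reach A b v k (pt p' q')"
        have Apt1: "A $ E1 \<bullet> pt p q = b $ E1 + p" "A $ E2 \<bullet> pt p q = b $ E2 + q" for p q
          using Ev dual by (simp_all add: Apt)
        obtain i where i: "A $ i \<bullet> pt p' q' = b $ i" "b $ i < A $ i \<bullet> pt p q"
        proof -
          from bl consider "p' = 0" "0 < p" | "q' = 0" "0 < q" |
            i where "- (A $ i \<bullet> f1) * p' + - (A $ i \<bullet> f2) * q' = A $ i \<bullet> v - b $ i"
              "- (A $ i \<bullet> f1) * p + - (A $ i \<bullet> f2) * q < A $ i \<bullet> v - b $ i" by blast
          then show ?thesis
          proof cases
            case 1 then show ?thesis using that[of E1] by (simp add: Apt1)
          next
            case 2 then show ?thesis using that[of E2] by (simp add: Apt1)
          next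
            case 3 then show ?thesis using that[of i] by (simp add: Apt algebra_simps)
          qed
        qed
        have "circuit_step A b (pt p q) (pt p' q')"
        proof (rule circuit_stepI[OF _ _ i])
          show "pt p' q' \<noteq> pt p q" using i by auto
          fix h assume h: "\<And>i. A $ i \<bullet> pt p q = A $ i \<bullet> pt p' q' \<Longrightarrow> A $ i \<bullet> h = 0"
          have "A $ i \<bullet> h = 0" if "i \<in> Z" for i
            using h[of i] ZL[OF that] fL by (simp add: Apt)
          then have hL: "h \<in> L" by (simp add: L)
          define \<alpha> where "\<alpha> = A $ E1 \<bullet> h"
          define \<beta> where "\<beta> = A $ E2 \<bullet> h"
          have hr: "h = \<alpha> *\<^sub>R f1 + \<beta> *\<^sub>R f2" using rep[OF hL] by (simp add: \<alpha>_def \<beta>_def)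
          have "\<exists>c. \<alpha> = c * (p' - p) \<and> \<beta> = c * (q' - q)"
          proof -
            from el consider "p' = p" | "q' = q" | i where
              "A $ i \<bullet> f1 \<noteq> 0 \<or> A $ i \<bullet> f2 \<noteq> 0"
              "- (A $ i \<bullet> f1) * p' + - (A $ i \<bullet> f2) * q' = - (A $ i \<bullet> f1) * p + - (A $ i \<bullet> f2) * q"
              by auto
            then show ?thesis
            proof cases
              case 1
              then have "\<alpha> = 0" using h[of E1] by (simp add: Apt1 \<alpha>_def)
              then show ?thesis using 1 ne by (intro exI[of _ "\<beta> / (q' - q)"]) auto
            next
              case 2
              then have "\<beta> = 0" using h[of E2] by (simp add: Apt1 \<beta>_def)
              then show ?thesis using 2 ne by (intro exI[of _ "\<alpha> / (p' - p)"]) auto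
            next
              case 3
              then have "A $ i \<bullet> h = 0" using h[of i] by (simp add: Apt algebra_simps)
              then have "(A $ i \<bullet> f1) * \<alpha> + (A $ i \<bullet> f2) * \<beta> = 0"
                unfolding hr by (simp add: inner_add_right algebra_simps)
              moreover have "(A $ i \<bullet> f1) * (p' - p) + (A $ i \<bullet> f2) * (q' - q) = 0"
                using 3 by (simp add: algebra_simps)
              ultimately show ?thesis by (rule collinear_2) (use 3(1) ne in auto)
            qed
          qed
          then obtain c where c: "\<alpha> = c * (p' - p)" "\<beta> = c * (q' - q)" by blast
          have "h = c *\<^sub>R (pt p' q' - pt p q)" unfolding hr c by (simp add: pt_def algebra_simps)
          then show "\<exists>c. h = c *\<^sub>R (pt p' q' - pt p q)" by blast
        qed
        then show "reach A b v (Suc k) (pt p q)"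
          using reach_step ptP[OF 1] R unfolding P_def by blast
      qed
      define p where "p = A $ E1 \<bullet> m"
      define q where "q = A $ E2 \<bullet> m"
      have y_pt: "y = pt p q" using rep[OF mL] by (simp add: pt_def p_def q_def m_def algebra_simps)
      have feas: "feas p q"
        unfolding feas_def
      proof (intro conjI ballI)
        show "0 \<le> p" "0 \<le> q" using pos[OF E(1)] pos[OF E(2)] by (auto simp: p_def q_def)
        fix i
        have "b $ i \<le> A $ i \<bullet> pt p q" using y unfolding y_pt P_def mem_polyhedron by blast
        then show "- (A $ i \<bullet> f1) * p + - (A $ i \<bullet> f2) * q \<le> A $ i \<bullet> v - b $ i"
          by (simp add: Apt algebra_simps)
      qed
      have "reach A b v 3 y" if "A $ k \<bullet> y = b $ k" "b $ k < A $ k \<bullet> v" for k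
      proof -
        have "k \<in> I" using that Z Ev by (auto simp: I_def)
        moreover have "- (A $ k \<bullet> f1) * p + - (A $ k \<bullet> f2) * q = A $ k \<bullet> v - b $ k"
          using that(1) unfolding y_pt by (simp add: Apt algebra_simps)
        ultimately show ?thesis using four_if_card_4(2)[OF feas cI] that(2) y_pt by simp
      qed
      then show ?thesis using four_if_card_4(1)[OF feas cI] y_pt by blast
    qed
  qed
  then show "reach A b v 4 y"
    and "A $ k \<bullet> y = b $ k \<Longrightarrow> b $ k < A $ k \<bullet> v \<Longrightarrow> reach A b v 3 y"
    by blast+
qed

text \<open>Here \<open>U\<close> and \<open>V\<close> hold rows tight at \<open>u\<close> resp. at \<open>v\<close>. There may be one more row \<open>z\<close>; it is
  kept from blocking by combining two edge directions so that it stays constant.\<close>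

lemma first_step_dim_3:
  fixes A :: "real ^ 'd ^ 'f" and b :: "real ^ 'f"
  defines "P \<equiv> polyhedron_of A b"
  assumes u: "u \<in> P" and v: "v \<in> P"
    and L: "L = {h. \<forall>i\<in>S. A $ i \<bullet> h = 0}" and uv: "v - u \<in> L"
    and U: "card U = 3" "\<And>i. i \<in> U \<Longrightarrow> A $ i \<bullet> u = b $ i \<and> b $ i < A $ i \<bullet> v"
    and V: "V \<noteq> {}" "\<And>j. j \<in> V \<Longrightarrow> A $ j \<bullet> v = b $ j \<and> b $ j < A $ j \<bullet> u"
    and e: "\<And>i. i \<in> U \<Longrightarrow> e i \<in> L"
      "\<And>i j. i \<in> U \<Longrightarrow> j \<in> U \<Longrightarrow> A $ j \<bullet> e i = (if i = j then 1 else 0)"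
      "\<And>x. x \<in> L \<Longrightarrow> x = (\<Sum>i\<in>U. (A $ i \<bullet> x) *\<^sub>R e i)"
    and S: "\<And>i. i \<in> S \<Longrightarrow> A $ i \<bullet> u = b $ i"
    and card: "card (- (S \<union> U \<union> V)) \<le> 1"
  obtains y i j where "y \<in> P" "y - u \<in> L" "i \<in> U" "A $ i \<bullet> y = b $ i" "j \<in> V" "A $ j \<bullet> y = b $ j"
    "\<And>k w. reach A b w k y \<Longrightarrow> reach A b w (Suc k) u"
proof (rule ccontr)
  note result = that
  assume nothesis: "\<not> thesis"
  have subL: "subspace L" unfolding L subspace_def by (simp add: inner_add_right)
  define zs where "zs = - (S \<union> U \<union> V)"
  have fU: "finite U" using U(1) card.infinite by fastforce
  have zs: "z = z'" if "z \<in> zs" "z' \<in> zs" for z z'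
    using card that card_le_Suc0_iff_eq[of zs] by (auto simp: zs_def)
  define W where "W j = A $ j \<bullet> u - b $ j" for j
  have W: "0 < W j" if "j \<in> V" for j using V(2)[OF that] by (simp add: W_def)
  define F where "F j i = - (A $ j \<bullet> e i)" for j i
  \<comment> \<open>\<open>zs\<close> has at most one element, so the sums pick out the values of
    this row, or give 0 if there is none. \<open>r i\<close> and \<open>F j i\<close> are the rates
    at which the slacks of \<open>z\<close> and \<open>j\<close> shrink along
    \<open>e i\<close>.\<close>
  define r where "r i = - (\<Sum>z\<in>zs. A $ z \<bullet> e i)" for i
  define z0 where "z0 = (\<Sum>z\<in>zs. A $ z \<bullet> u - b $ z)"
  have z0: "0 \<le> z0" unfolding z0_def using u by (intro sum_nonneg) (auto simp: P_def mem_polyhedron)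
  have single: "r i = - (A $ z \<bullet> e i)" "z0 = A $ z \<bullet> u - b $ z" if "z \<in> zs" for z i
  proof -
    have "zs = {z}" using zs that by blast
    then show "r i = - (A $ z \<bullet> e i)" "z0 = A $ z \<bullet> u - b $ z" by (auto simp: r_def z0_def)
  qed
  \<comment> \<open>A circuit direction that keeps a row of \<open>U\<close> tight and is not
    blocked by \<open>z\<close> before it reaches a row of \<open>V\<close> would give a point
    \<open>y\<close> as required.\<close>
  have ray: False
    if g: "g \<in> L" and gU: "\<And>i. i \<in> U \<Longrightarrow> 0 \<le> A $ i \<bullet> g"
      and hit: "j0 \<in> V" "A $ j0 \<bullet> g < 0"
      and el: "\<And>h. h \<in> L \<Longrightarrow> (\<And>i. i \<in> U \<Longrightarrow> A $ i \<bullet> g = 0 \<Longrightarrow> A $ i \<bullet> h = 0) \<Longrightarrow>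
        (\<And>z. z \<in> zs \<Longrightarrow> A $ z \<bullet> g = 0 \<Longrightarrow> A $ z \<bullet> h = 0) \<Longrightarrow> \<exists>c. h = c *\<^sub>R g"
      and z: "\<And>t z. 0 < t \<Longrightarrow> (\<And>j. j \<in> V \<Longrightarrow> t * - (A $ j \<bullet> g) \<le> W j) \<Longrightarrow> z \<in> zs \<Longrightarrow>
        0 \<le> A $ z \<bullet> u - b $ z + t * (A $ z \<bullet> g)"
      and i0: "i0 \<in> U" "A $ i0 \<bullet> g = 0" for g j0 i0
  proof -
    define K where "K = {j\<in>V. A $ j \<bullet> g < 0}"
    have K: "finite K" "K \<noteq> {}" using hit by (auto simp: K_def)
    define t where "t = Min ((\<lambda>j. W j / - (A $ j \<bullet> g)) ` K)"
    have "t \<in> (\<lambda>j. W j / - (A $ j \<bullet> g)) ` K" unfolding t_def using K by (intro Min_in) auto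
    then obtain j where j: "j \<in> V" "A $ j \<bullet> g < 0" "t = W j / - (A $ j \<bullet> g)" by (auto simp: K_def)
    have t: "0 < t" using j W[OF j(1)] by (simp add: divide_pos_neg)
    have le: "t * - (A $ k \<bullet> g) \<le> W k" if "k \<in> V" for k
    proof (cases "A $ k \<bullet> g < 0")
      case True
      then have "t \<le> W k / - (A $ k \<bullet> g)"
        unfolding t_def using K that by (intro Min_le) (auto simp: K_def)
      then show ?thesis using True by (simp add: field_simps)
    next
      case False
      then have "t * - (A $ k \<bullet> g) \<le> 0" using t by (simp add: mult_le_0_iff)
      then show ?thesis using W[OF that] by linarith
    qed
    define y where "y = u + t *\<^sub>R g"
    have Ay: "A $ k \<bullet> y = A $ k \<bullet> u + t * (A $ k \<bullet> g)" for k by (simp add: y_def inner_add_right)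
    have yj: "A $ j \<bullet> y = b $ j" using j by (simp add: Ay W_def)
    have yP: "y \<in> P"
      unfolding P_def mem_polyhedron
    proof
      fix k
      consider "k \<in> S" | "k \<in> U" | "k \<in> V" | "k \<in> zs" by (auto simp: zs_def)
      then show "b $ k \<le> A $ k \<bullet> y"
      proof cases
        case 1 then show ?thesis using g S[OF 1] by (simp add: Ay L)
      next
        case 2 then show ?thesis using gU[OF 2] U(2)[OF 2] t by (simp add: Ay)
      next
        case 3 then show ?thesis using le[OF 3] by (simp add: Ay W_def)
      next
        case 4 then show ?thesis using z[OF t le 4] by (simp add: Ay)
      qed
    qed
    have "circuit_step A b u y"
    proof (rule circuit_stepI[where i = j])
      show "A $ j \<bullet> y = b $ j" by (rule yj)
      show "b $ j < A $ j \<bullet> u" using V(2)[OF j(1)] by simp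
      then show "y \<noteq> u" using yj by auto
      fix h assume h: "\<And>i. A $ i \<bullet> u = A $ i \<bullet> y \<Longrightarrow> A $ i \<bullet> h = 0"
      have h': "A $ i \<bullet> h = 0" if "A $ i \<bullet> g = 0" for i using h[of i] that by (simp add: Ay)
      have "h \<in> L" using h' g by (simp add: L)
      then obtain c where "h = c *\<^sub>R g" using el h' by blast
      then have "h = (c / t) *\<^sub>R (y - u)" using t by (simp add: y_def)
      then show "\<exists>c. h = c *\<^sub>R (y - u)" by blast
    qed
    then have "\<And>k w. reach A b w k y \<Longrightarrow> reach A b w (Suc k) u"
      using reach_step u unfolding P_def by blast
    moreover have "y - u \<in> L" using g subL by (simp add: y_def subspace_scale)
    moreover have "A $ i0 \<bullet> y = b $ i0" using U(2)[OF i0(1)] i0 by (simp add: Ay)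
    ultimately show False using result[of y i0 j] nothesis yP i0(1) j(1) yj by blast
  qed
  have third: "\<exists>i\<in>U. i \<noteq> p \<and> i \<noteq> n" for p n
  proof (rule ccontr)
    assume "\<not> ?thesis"
    then have "U \<subseteq> {p, n}" by blast
    then have "card U \<le> 2" using card_mono[of "{p, n}" U] card_insert_le_m1[of 2 "{n}" p] by simp
    then show False using U(1) by simp
  qed
  \<comment> \<open>Along an edge either no row of \<open>V\<close> is approached, or
    \<open>z\<close> blocks strictly before all of them: \<open>z0 / r i\<close> is less than
    \<open>W j / F j i\<close> whenever the latter rate is positive.\<close>
  have edge: "(\<forall>j\<in>V. F j i \<le> 0) \<or> (0 < r i \<and> (\<forall>j\<in>V. F j i * z0 < W j * r i))" if i: "i \<in> U" for i
  proof (rule disjCI)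
    assume "\<not> (0 < r i \<and> (\<forall>j\<in>V. F j i * z0 < W j * r i))"
    then have no: "0 < r i \<Longrightarrow> \<exists>j\<in>V. W j * r i \<le> F j i * z0" by (auto simp: not_less)
    show "\<forall>j\<in>V. F j i \<le> 0"
    proof (rule ccontr)
      assume "\<not> ?thesis"
      then obtain j0 where j0: "j0 \<in> V" "A $ j0 \<bullet> e i < 0" by (auto simp: F_def not_le)
      obtain i0 where i0: "i0 \<in> U" "i0 \<noteq> i" using third by blast
      show False
      proof (rule ray[OF e(1)[OF i] _ j0])
        show "i0 \<in> U" "A $ i0 \<bullet> e i = 0" using i0 i e(2) by auto
        show "0 \<le> A $ k \<bullet> e i" if "k \<in> U" for k using e(2)[OF i that] by simp
        fix h assume h: "h \<in> L" "\<And>k. k \<in> U \<Longrightarrow> A $ k \<bullet> e i = 0 \<Longrightarrow> A $ k \<bullet> h = 0"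
        have "h = (\<Sum>k\<in>U. (A $ k \<bullet> h) *\<^sub>R e k)" by (rule e(3)[OF h(1)])
        also have "\<dots> = (\<Sum>k\<in>U. if k = i then (A $ k \<bullet> h) *\<^sub>R e k else 0)"
          using h(2) e(2)[OF i] by (intro sum.cong) auto
        also have "\<dots> = (A $ i \<bullet> h) *\<^sub>R e i" using fU i by simp
        finally show "\<exists>c. h = c *\<^sub>R e i" by blast
      next
        fix t z assume t: "0 < t" "\<And>j. j \<in> V \<Longrightarrow> t * - (A $ j \<bullet> e i) \<le> W j" and z: "z \<in> zs"
        show "0 \<le> A $ z \<bullet> u - b $ z + t * (A $ z \<bullet> e i)"
        proof (rule ccontr)
          assume "\<not> ?thesis"
          then have lt: "z0 < t * r i" using single[OF z] by simp
          then have r: "0 < r i" using z0 t by (smt (verit) mult_nonneg_nonpos)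
          then obtain j where j: "j \<in> V" "W j * r i \<le> F j i * z0" using no by blast
          have "0 < W j * r i" using W[OF j(1)] r by simp
          then have Fj: "0 < F j i" using j z0 by (smt (verit) mult_nonneg_nonpos2 mult_nonpos_nonneg)
          have "F j i * z0 < F j i * (t * r i)" using lt Fj by simp
          also have "\<dots> = (t * F j i) * r i" by simp
          also have "\<dots> \<le> W j * r i" using t(2)[OF j(1)] r by (intro mult_right_mono) (auto simp: F_def)
          finally show False using j by simp
        qed
      qed
    qed
  qed
  \<comment> \<open>The combination of two edge directions that keeps \<open>z\<close> constant
    cannot approach a row of \<open>V\<close>.\<close>
  have pair: "r p * F j n - r n * F j p \<le> 0" if p: "p \<in> U" "0 < r p" and n: "n \<in> U" "r n \<le> 0" and j: "j \<in> V" for p n j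
  proof (rule ccontr)
    assume "\<not> ?thesis"
    then have pos: "0 < r p * F j n - r n * F j p" by simp
    have pn: "p \<noteq> n" using p n by auto
    define g where "g = (- r n) *\<^sub>R e p + r p *\<^sub>R e n"
    have Ag: "A $ k \<bullet> g = - r n * (A $ k \<bullet> e p) + r p * (A $ k \<bullet> e n)" for k
      by (simp add: g_def inner_add_right inner_diff_right)
    have gL: "g \<in> L" unfolding g_def using e(1) p n subL by (intro subspace_add subspace_scale) auto
    have zs0: "A $ z \<bullet> g = 0" if "z \<in> zs" for z
      using single(1)[OF that, of p] single(1)[OF that, of n] by (simp add: Ag)
    obtain i0 where i0: "i0 \<in> U" "i0 \<noteq> p" "i0 \<noteq> n" using third by blast
    show False
    proof (rule ray[OF gL _ j])
      show "A $ j \<bullet> g < 0" using pos by (simp add: Ag F_def)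
      show "i0 \<in> U" "A $ i0 \<bullet> g = 0" using i0 e(2) p n by (auto simp: Ag)
      show "0 \<le> A $ k \<bullet> g" if "k \<in> U" for k using e(2) p n that by (auto simp: Ag)
      show "0 \<le> A $ z \<bullet> u - b $ z + t * (A $ z \<bullet> g)" if "z \<in> zs" for t z
        using u zs0[OF that] by (simp add: P_def mem_polyhedron)
      fix h assume h: "h \<in> L" "\<And>k. k \<in> U \<Longrightarrow> A $ k \<bullet> g = 0 \<Longrightarrow> A $ k \<bullet> h = 0"
        "\<And>z. z \<in> zs \<Longrightarrow> A $ z \<bullet> g = 0 \<Longrightarrow> A $ z \<bullet> h = 0"
      have k0: "A $ k \<bullet> h = 0" if "k \<in> U" "k \<noteq> p" "k \<noteq> n" for k
        using h(2)[OF that(1)] e(2) p n that by (auto simp: Ag)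
      have "h = (\<Sum>k\<in>U. (A $ k \<bullet> h) *\<^sub>R e k)" by (rule e(3)[OF h(1)])
      also have "\<dots> = (\<Sum>k\<in>{p, n}. (A $ k \<bullet> h) *\<^sub>R e k)"
        using fU p n k0 by (intro sum.mono_neutral_right) auto
      finally have hpn: "h = (A $ p \<bullet> h) *\<^sub>R e p + (A $ n \<bullet> h) *\<^sub>R e n" using pn by simp
      have "zs \<noteq> {}" using p(2) by (auto simp: r_def)
      then obtain z where z: "z \<in> zs" by blast
      have "A $ z \<bullet> h = 0" using h(3)[OF z zs0[OF z]] .
      moreover have "A $ z \<bullet> h = (A $ p \<bullet> h) * (A $ z \<bullet> e p) + (A $ n \<bullet> h) * (A $ z \<bullet> e n)"
        by (subst hpn) (simp add: inner_add_right)
      ultimately have "r p * (A $ p \<bullet> h) = - r n * (A $ n \<bullet> h)"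
        using single(1)[OF z, of p] single(1)[OF z, of n] by (simp add: algebra_simps)
      then have "A $ p \<bullet> h = (A $ n \<bullet> h) / r p * - r n" using p(2) by (simp add: field_simps)
      then have "h = ((A $ n \<bullet> h) / r p) *\<^sub>R g"
        using hpn p(2) by (simp add: g_def algebra_simps)
      then show "\<exists>c. h = c *\<^sub>R g" by blast
    qed
  qed
  obtain j where j: "j \<in> V" using V by blast
  define \<xi> where "\<xi> i = A $ i \<bullet> (v - u)" for i
  have \<xi>: "0 < \<xi> i" if "i \<in> U" for i using U(2)[OF that] by (simp add: \<xi>_def inner_diff_right)
  have vu: "A $ k \<bullet> (v - u) = (\<Sum>i\<in>U. \<xi> i * (A $ k \<bullet> e i))" for k
    by (subst e(3)[OF uv]) (simp add: inner_sum_right \<xi>_def)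
  define P' where "P' = {i\<in>U. 0 < r i}"
  define N where "N = {i\<in>U. r i \<le> 0}"
  have un: "U = P' \<union> N" "P' \<inter> N = {}" by (auto simp: P'_def N_def)
  have fin: "finite P'" "finite N" using fU by (auto simp: P'_def N_def)
  have split: "(\<Sum>i\<in>U. g i) = (\<Sum>i\<in>P'. g i) + (\<Sum>i\<in>N. g i)" for g :: "'f \<Rightarrow> real"
    unfolding un(1) using un(2) fin by (intro sum.union_disjoint) auto
  define T where "T = (\<Sum>i\<in>P'. r i * \<xi> i)"
  define RN where "RN = (\<Sum>i\<in>N. r i * \<xi> i)"
  define FP where "FP = (\<Sum>i\<in>P'. F j i * \<xi> i)"
  define FN where "FN = (\<Sum>i\<in>N. F j i * \<xi> i)"
  have "W j = - (A $ j \<bullet> (v - u))" using V(2)[OF j] by (simp add: W_def inner_diff_right)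
  also have "\<dots> = (\<Sum>i\<in>U. F j i * \<xi> i)" by (simp add: vu F_def sum_negf mult.commute)
  finally have Wj: "W j = FP + FN" by (simp add: split FP_def FN_def)
  have "T + RN = (\<Sum>i\<in>U. r i * \<xi> i)" by (simp add: split T_def RN_def)
  also have "\<dots> = - (\<Sum>z\<in>zs. A $ z \<bullet> (v - u))"
    unfolding vu r_def sum_negf[symmetric] sum_distrib_right
    by (subst sum.swap) (simp add: mult.commute)
  also have "\<dots> = z0 - (\<Sum>z\<in>zs. A $ z \<bullet> v - b $ z)"
    by (simp add: z0_def inner_diff_right sum_subtractf)
  also have "\<dots> \<le> z0" using v by (auto simp: P_def mem_polyhedron intro!: sum_nonneg)
  finally have TR: "T + RN \<le> z0" .
  have RN: "RN \<le> 0" unfolding RN_def using \<xi> by (intro sum_nonpos) (auto simp: N_def mult_le_0_iff less_imp_le)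
  have "F j i \<le> 0" if "i \<in> N" for i using edge[of i] that j by (auto simp: N_def)
  then have FN: "FN \<le> 0" unfolding FN_def using \<xi>
    by (intro sum_nonpos) (auto simp: N_def mult_le_0_iff less_imp_le)
  then have FP: "0 < FP" using Wj W[OF j] by linarith
  then have ne: "P' \<noteq> {}" by (auto simp: FP_def)
  have T: "0 < T" unfolding T_def using ne fin \<xi> by (intro sum_pos) (auto simp: P'_def)
  have strict: "F j i * z0 < W j * r i" if "i \<in> P'" for i
  proof -
    have i: "i \<in> U" "0 < r i" using that by (auto simp: P'_def)
    from edge[OF i(1)] show ?thesis
    proof
      assume "\<forall>j\<in>V. F j i \<le> 0"
      then have "F j i * z0 \<le> 0" using j z0 by (simp add: mult_le_0_iff)
      also have "0 < W j * r i" using W[OF j] i by simp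
      finally show ?thesis .
    qed (use j in blast)
  qed
  have "FP * z0 = (\<Sum>i\<in>P'. (F j i * z0) * \<xi> i)" unfolding FP_def sum_distrib_right by (intro sum.cong) auto
  also have "\<dots> < (\<Sum>i\<in>P'. (W j * r i) * \<xi> i)"
    using ne fin strict \<xi> by (intro sum_strict_mono) (auto simp: P'_def)
  also have "\<dots> = W j * T" by (simp add: T_def sum_distrib_left mult.assoc)
  finally have 1: "FP * z0 < W j * T" .
  \<comment> \<open>Weighted with the coordinates \<open>\<xi>\<close> of \<open>v - u\<close>,
    \<open>pair\<close> gives \<open>T * W j \<le> FP * (T + RN)\<close>, which is at most
    \<open>FP * z0\<close> because \<open>v\<close> satisfies \<open>z\<close>; \<open>edge\<close>
    gave the strict opposite.\<close>
  have "(\<Sum>p\<in>P'. \<Sum>n\<in>N. \<xi> p * \<xi> n * (r p * F j n - r n * F j p)) \<le> 0"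
    using pair j \<xi> by (intro sum_nonpos) (auto simp: P'_def N_def mult_le_0_iff less_imp_le)
  then have "T * FN - FP * RN \<le> 0"
    unfolding sum_bracket T_def RN_def FP_def FN_def .
  then have "T * W j \<le> FP * (T + RN)" by (simp add: Wj algebra_simps)
  also have "\<dots> \<le> FP * z0" using TR FP by simp
  finally show False using 1 by (simp add: mult.commute)
qed

section \<open>Faces of dimension four\<close>

text \<open>Slacks are divided by their values at the other vertex. With this scaling and up to
  sign, \<open>M\<close> and \<open>Q\<close> are the base changes between the two dual bases, hence
  inverse to each other; the rows of \<open>M\<close> sum to 1 because all rows of \<open>V\<close>
  are tight at \<open>v\<close>.\<close>

lemma spindle_reach:
  fixes A :: "real ^ 'd ^ 'f" and b :: "real ^ 'f"
  defines "P \<equiv> polyhedron_of A b"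
  assumes u: "u \<in> P" and v: "v \<in> P"
    and U: "card U = 4" "\<And>i. i \<in> U \<Longrightarrow> A $ i \<bullet> u = b $ i \<and> b $ i < A $ i \<bullet> v"
    and V: "card V = 4" "\<And>j. j \<in> V \<Longrightarrow> A $ j \<bullet> v = b $ j \<and> b $ j < A $ j \<bullet> u"
    and UV: "U \<union> V = UNIV"
    and e: "\<And>i j. i \<in> U \<Longrightarrow> j \<in> U \<Longrightarrow> A $ j \<bullet> e i = (if i = j then 1 else 0)"
      "\<And>x. x = (\<Sum>i\<in>U. (A $ i \<bullet> x) *\<^sub>R e i)"
    and e': "\<And>i j. i \<in> V \<Longrightarrow> j \<in> V \<Longrightarrow> A $ j \<bullet> e' i = (if i = j then 1 else 0)"
      "\<And>x. x = (\<Sum>i\<in>V. (A $ i \<bullet> x) *\<^sub>R e' i)"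
  shows "reach A b v 4 u"
proof -
  have fin: "finite U" "finite V" using U V card.infinite by fastforce+
  obtain h where h: "bij_betw h (UNIV :: 4 set) U"
    using finite_same_card_bij[of "UNIV :: 4 set" U] fin U by auto
  obtain k where k: "bij_betw k (UNIV :: 4 set) V"
    using finite_same_card_bij[of "UNIV :: 4 set" V] fin V by auto
  have hU: "h i \<in> U" for i using h by (auto simp: bij_betw_def)
  have kV: "k i \<in> V" for i using k by (auto simp: bij_betw_def)
  have hinj: "h i = h j \<longleftrightarrow> i = j" for i j using h by (auto simp: bij_betw_def inj_on_def)
  have kinj: "k i = k j \<longleftrightarrow> i = j" for i j using k by (auto simp: bij_betw_def inj_on_def)
  have sumU: "(\<Sum>i\<in>U. g i) = (\<Sum>i\<in>UNIV. g (h i))" for g :: "'f \<Rightarrow> real ^ 'd"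
    using sum.reindex_bij_betw[OF h, of g] by simp
  have sumV: "(\<Sum>i\<in>V. g i) = (\<Sum>i\<in>UNIV. g (k i))" for g :: "'f \<Rightarrow> real ^ 'd"
    using sum.reindex_bij_betw[OF k, of g] by simp
  define \<xi> where "\<xi> i = A $ h i \<bullet> v - b $ h i" for i
  define \<eta> where "\<eta> j = A $ k j \<bullet> u - b $ k j" for j
  have \<xi>: "0 < \<xi> i" for i using U(2)[OF hU] by (simp add: \<xi>_def)
  have \<eta>: "0 < \<eta> j" for j using V(2)[OF kV] by (simp add: \<eta>_def)
  have \<xi>0: "\<xi> i \<noteq> 0" and \<eta>0: "\<eta> j \<noteq> 0" for i j using \<xi>[of i] \<eta>[of j] by auto
  define M where "M j i = - (A $ k j \<bullet> e (h i)) * \<xi> i / \<eta> j" for j i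
  define Q where "Q i j = - (A $ h i \<bullet> e' (k j)) * \<eta> j / \<xi> i" for i j
  define point where "point x = u + (\<Sum>i\<in>UNIV. (x i * \<xi> i) *\<^sub>R e (h i))" for x :: "4 \<Rightarrow> real"
  have Ah: "A $ h i \<bullet> point x = b $ h i + x i * \<xi> i" for i x
  proof -
    have "A $ h i \<bullet> point x = A $ h i \<bullet> u + (\<Sum>j\<in>UNIV. (x j * \<xi> j) * (A $ h i \<bullet> e (h j)))"
      by (simp add: point_def inner_add_right inner_sum_right)
    also have "(\<Sum>j\<in>UNIV. (x j * \<xi> j) * (A $ h i \<bullet> e (h j))) = (\<Sum>j\<in>UNIV. if j = i then x j * \<xi> j else 0)"
      using e(1)[OF hU hU] hinj by (intro sum.cong) auto
    finally show ?thesis using U(2)[OF hU] by simp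
  qed
  have Ak: "A $ k j \<bullet> point x = b $ k j + slack M x j * \<eta> j" for j x
  proof -
    have "A $ k j \<bullet> point x = A $ k j \<bullet> u + (\<Sum>i\<in>UNIV. (x i * \<xi> i) * (A $ k j \<bullet> e (h i)))"
      by (simp add: point_def inner_add_right inner_sum_right)
    moreover have "(\<Sum>i\<in>UNIV. (x i * \<xi> i) * (A $ k j \<bullet> e (h i))) = - (\<Sum>i\<in>UNIV. M j i * x i) * \<eta> j"
      unfolding sum_distrib_right sum_negf[symmetric] using \<eta>[of j] by (intro sum.cong) (auto simp: M_def)
    ultimately show ?thesis by (simp add: slack_def \<eta>_def algebra_simps)
  qed
  have rows: "(\<exists>j. i = h j) \<or> (\<exists>j. i = k j)" for i
  proof -
    have "i \<in> U \<or> i \<in> V" using UV by blast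
    then show ?thesis using h k by (auto simp: bij_betw_def)
  qed
  have ptP: "point x \<in> P" if "feasible M x" for x
    unfolding P_def mem_polyhedron
  proof
    fix i
    from rows[of i] show "b $ i \<le> A $ i \<bullet> point x"
    proof (elim disjE exE)
      fix j assume "i = h j"
      then show ?thesis using that \<xi>[of j] by (simp add: Ah feasible_def)
    next
      fix j assume "i = k j"
      then show ?thesis using that \<eta>[of j] by (simp add: Ak feasible_def)
    qed
  qed
  have pt1: "point (\<lambda>_. 1) = v"
  proof -
    have "v - u = (\<Sum>i\<in>UNIV. (A $ h i \<bullet> (v - u)) *\<^sub>R e (h i))" by (subst e(2)[of "v - u"]) (simp only: sumU)
    also have "\<dots> = (\<Sum>i\<in>UNIV. \<xi> i *\<^sub>R e (h i))"
      using U(2)[OF hU] by (simp add: \<xi>_def inner_diff_right)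
    finally show ?thesis by (simp add: point_def algebra_simps)
  qed
  have hrep: "A $ k j \<bullet> x = (\<Sum>i\<in>UNIV. (A $ h i \<bullet> x) * (A $ k j \<bullet> e (h i)))" for j x
    by (subst e(2)[of x]) (simp add: sumU inner_sum_right)
  have krep: "A $ h i \<bullet> x = (\<Sum>j\<in>UNIV. (A $ k j \<bullet> x) * (A $ h i \<bullet> e' (k j)))" for i x
    by (subst e'(2)[of x]) (simp add: sumV inner_sum_right)
  interpret spindle M Q "\<lambda>n x. reach A b v n (point x)"
  proof
    fix j j' i i' :: 4
    show "(\<Sum>i\<in>UNIV. M j i) = 1"
    proof -
      have "slack M (\<lambda>_. 1) j * \<eta> j = 0" using Ak[of j "\<lambda>_. 1"] V(2)[OF kV] by (simp add: pt1)
      then show ?thesis using \<eta>[of j] by (simp add: slack_def)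
    qed
    show "(\<Sum>i\<in>UNIV. M j i * Q i j') = (if j = j' then 1 else 0)"
    proof -
      have "(\<Sum>i\<in>UNIV. M j i * Q i j') =
          (\<Sum>i\<in>UNIV. (A $ h i \<bullet> e' (k j')) * (A $ k j \<bullet> e (h i))) * (\<eta> j' / \<eta> j)"
        unfolding sum_distrib_right by (intro sum.cong) (auto simp: M_def Q_def \<xi>0)
      also have "\<dots> = (A $ k j \<bullet> e' (k j')) * (\<eta> j' / \<eta> j)" by (simp add: hrep[of j "e' (k j')"])
      finally show ?thesis using e'(1)[OF kV[of j'] kV[of j]] kinj \<eta>[of j] by auto
    qed
    show "(\<Sum>j\<in>UNIV. Q i j * M j i') = (if i = i' then 1 else 0)"
    proof -
      have "(\<Sum>j\<in>UNIV. Q i j * M j i') =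
          (\<Sum>j\<in>UNIV. (A $ k j \<bullet> e (h i')) * (A $ h i \<bullet> e' (k j))) * (\<xi> i' / \<xi> i)"
        unfolding sum_distrib_right by (intro sum.cong) (auto simp: M_def Q_def \<eta>0)
      also have "\<dots> = (A $ h i \<bullet> e (h i')) * (\<xi> i' / \<xi> i)" by (simp add: krep[of i "e (h i')"])
      finally show ?thesis using e(1)[OF hU[of i'] hU[of i]] hinj \<xi>[of i] by auto
    qed
    show "reach A b v 0 (point (\<lambda>_. 1))" using reach_0 v by (simp add: pt1 P_def)
    show "reach A b v (Suc n) (point x)" if "reach A b v n (point x)" for n x
      using reach_mono[OF that] by simp
  next
    fix n :: nat and x y :: "4 \<Rightarrow> real"
    assume fx: "feasible M x" and fy: "feasible M y" and ne: "\<exists>i. x i \<noteq> y i"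
      and el: "\<And>g. (\<And>i. x i = y i \<Longrightarrow> g i = 0) \<Longrightarrow>
         (\<And>j. slack M x j = slack M y j \<Longrightarrow> (\<Sum>i\<in>UNIV. M j i * g i) = 0) \<Longrightarrow> \<exists>c. \<forall>i. g i = c * (y i - x i)"
      and bl: "(\<exists>i. y i = 0 \<and> 0 < x i) \<or> (\<exists>j. slack M y j = 0 \<and> 0 < slack M x j)"
      and R: "reach A b v n (point y)"
    obtain r where r: "A $ r \<bullet> point y = b $ r" "b $ r < A $ r \<bullet> point x"
    proof -
      from bl show ?thesis
      proof (elim disjE exE conjE)
        fix i assume "y i = 0" "0 < x i"
        then show ?thesis using that[of "h i"] \<xi>[of i] by (simp add: Ah)
      next
        fix j assume "slack M y j = 0" "0 < slack M x j"
        then show ?thesis using that[of "k j"] \<eta>[of j] by (simp add: Ak)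
      qed
    qed
    have "circuit_step A b (point x) (point y)"
    proof (rule circuit_stepI[OF _ _ r])
      show "point y \<noteq> point x" using r by auto
      fix H assume H: "\<And>i. A $ i \<bullet> point x = A $ i \<bullet> point y \<Longrightarrow> A $ i \<bullet> H = 0"
      define g where "g i = (A $ h i \<bullet> H) / \<xi> i" for i
      have g: "A $ h i \<bullet> H = g i * \<xi> i" for i using \<xi>[of i] by (simp add: g_def)
      have Hrep: "H = (\<Sum>i\<in>UNIV. (g i * \<xi> i) *\<^sub>R e (h i))"
        by (subst e(2)[of H]) (simp only: sumU g)
      have "\<exists>c. \<forall>i. g i = c * (y i - x i)"
      proof (rule el)
        show "g i = 0" if "x i = y i" for i using H[of "h i"] that by (simp add: Ah g_def)
        show "(\<Sum>i\<in>UNIV. M j i * g i) = 0" if "slack M x j = slack M y j" for j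
        proof -
          have "A $ k j \<bullet> H = 0" using H[of "k j"] that by (simp add: Ak)
          then have "(\<Sum>i\<in>UNIV. (g i * \<xi> i) * (A $ k j \<bullet> e (h i))) = 0"
            using hrep[of j H] by (simp add: g)
          moreover have "(\<Sum>i\<in>UNIV. M j i * g i) = - (\<Sum>i\<in>UNIV. (g i * \<xi> i) * (A $ k j \<bullet> e (h i))) / \<eta> j"
            unfolding sum_divide_distrib sum_negf[symmetric] by (intro sum.cong) (auto simp: M_def)
          ultimately show ?thesis by simp
        qed
      qed
      then obtain c where c: "\<And>i. g i = c * (y i - x i)" by blast
      have "H = c *\<^sub>R (point y - point x)"
        by (subst Hrep) (simp add: c point_def scaleR_sum_right sum_subtractf[symmetric] algebra_simps)
      then show "\<exists>c. H = c *\<^sub>R (point y - point x)" by blast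
    qed
    then show "reach A b v (Suc n) (point x)" using reach_step ptP[OF fx] R unfolding P_def by blast
  qed
  have "point (\<lambda>_. 0) = u" by (simp add: point_def)
  then show ?thesis using reach_4 by simp
qed

section \<open>Combination of the dimensions\<close>

text \<open>\<open>L\<close> is the direction space of the smallest face containing both vertices.
  The functionals in \<open>U\<close> and in \<open>V\<close> are bases of the dual space of
  \<open>L\<close>, so both have \<open>dim L\<close> elements, and the cases follow this
  dimension.\<close>

theorem reach_4_between_vertices:
  fixes A :: "real ^ 4 ^ 8" and b :: "real ^ 8"
  assumes u: "u extreme_point_of polyhedron_of A b" and v: "v extreme_point_of polyhedron_of A b"
  shows "reach A b v 4 u"
proof -
  have uP: "u \<in> polyhedron_of A b" and vP: "v \<in> polyhedron_of A b"
    using u v by (auto simp: extreme_point_of_def)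
  have ge: "b $ i \<le> A $ i \<bullet> u" "b $ i \<le> A $ i \<bullet> v" for i using uP vP by (auto simp: mem_polyhedron)
  define Tu where "Tu = {i. A $ i \<bullet> u = b $ i}"
  define Tv where "Tv = {i. A $ i \<bullet> v = b $ i}"
  define S where "S = Tu \<inter> Tv"
  define L where "L = {h. \<forall>i\<in>S. A $ i \<bullet> h = 0}"
  have subL: "subspace L" unfolding L_def subspace_def by (simp add: inner_add_right)
  have vuL: "v - u \<in> L" "u - v \<in> L" by (auto simp: L_def S_def Tu_def Tv_def inner_diff_right)
  have trU: "\<forall>h\<in>L. (\<forall>i\<in>Tu - S. A $ i \<bullet> h = 0) \<longrightarrow> h = 0"
    using extreme_point_tight_rows[OF u] by (auto simp: L_def Tu_def)
  have trV: "\<forall>h\<in>L. (\<forall>i\<in>Tv - S. A $ i \<bullet> h = 0) \<longrightarrow> h = 0"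
    using extreme_point_tight_rows[OF v] by (auto simp: L_def Tv_def)
  obtain U e where U: "U \<subseteq> Tu - S" and e: "\<forall>i\<in>U. e i \<in> L"
    "\<forall>i\<in>U. \<forall>j\<in>U. A $ j \<bullet> e i = (if i = j then 1 else 0)"
    "\<forall>x\<in>L. x = (\<Sum>i\<in>U. (A $ i \<bullet> x) *\<^sub>R e i)"
    using dual_basis[OF finite subL trU] by (elim exE conjE)
  obtain V e' where V: "V \<subseteq> Tv - S" and e': "\<forall>i\<in>V. e' i \<in> L"
    "\<forall>i\<in>V. \<forall>j\<in>V. A $ j \<bullet> e' i = (if i = j then 1 else 0)"
    "\<forall>x\<in>L. x = (\<Sum>i\<in>V. (A $ i \<bullet> x) *\<^sub>R e' i)"
    using dual_basis[OF finite subL trV] by (elim exE conjE)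
  note e = e[rule_format] and e' = e'[rule_format]
  have fin: "finite U" "finite V" by auto
  have dim: "dim L = card U" "dim L = card V"
    using dim_dual_basis[OF fin(1) e] dim_dual_basis[OF fin(2) e'] by simp_all
  have Urow: "A $ i \<bullet> u = b $ i \<and> b $ i < A $ i \<bullet> v" if "i \<in> U" for i
    using U that ge(2)[of i] by (force simp: S_def Tu_def Tv_def)
  have Vrow: "A $ j \<bullet> v = b $ j \<and> b $ j < A $ j \<bullet> u" if "j \<in> V" for j
    using V that ge(1)[of j] by (force simp: S_def Tu_def Tv_def)
  have disj: "U \<inter> V = {}" "S \<inter> U = {}" "S \<inter> V = {}" using Urow Vrow U V by fastforce+
  \<comment> \<open>\<open>S\<close> and \<open>U\<close> together have trivial kernel, so they
    contain at least four rows; hence at most \<open>4 + card U\<close> of the eight rows lie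
    outside \<open>S\<close>.\<close>
  have cardS: "4 \<le> card S + card U"
  proof -
    have tr: "\<forall>x\<in>UNIV. (\<forall>i\<in>S \<union> U. A $ i \<bullet> x = 0) \<longrightarrow> x = 0"
    proof (intro ballI impI)
      fix x assume x: "\<forall>i\<in>S \<union> U. A $ i \<bullet> x = 0"
      then have "x \<in> L" by (simp add: L_def)
      then have "x = (\<Sum>i\<in>U. (A $ i \<bullet> x) *\<^sub>R e i)" by (rule e(3))
      also have "\<dots> = 0" using x by simp
      finally show "x = 0" .
    qed
    obtain B f where B: "B \<subseteq> S \<union> U" "\<forall>i\<in>B. f i \<in> UNIV"
      "\<forall>i\<in>B. \<forall>j\<in>B. A $ j \<bullet> f i = (if i = j then 1 else 0)"
      "\<forall>x\<in>UNIV. x = (\<Sum>i\<in>B. (A $ i \<bullet> x) *\<^sub>R f i)"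
      using dual_basis[OF finite subspace_UNIV tr] by (elim exE conjE)
    note B' = B(2-4)[rule_format]
    have "dim (UNIV :: (real ^ 4) set) = card B"
      by (rule dim_dual_basis[OF finite B'])
    then have "4 = card B" by simp
    also have "\<dots> \<le> card (S \<union> U)" using B(1) by (intro card_mono) auto
    also have "\<dots> \<le> card S + card U" by (rule card_Un_le)
    finally show ?thesis .
  qed
  have card_compl: "card (- X) = 8 - card X" for X :: "8 set"
    by (simp add: Compl_eq_Diff_UNIV card_Diff_subset)
  have cardSU: "card (S \<union> U \<union> V) = card S + card U + card V"
    using disj fin by (subst card_Un_disjoint, simp, simp, blast, subst card_Un_disjoint) auto
  have "card U \<le> 4" using dim dim_subset_UNIV[of L] by simp
  then consider "card U = 0" | "card U = 1" | "card U = 2" | "card U = 3" | "card U = 4" by linarith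
  then show ?thesis
  proof cases
    case 1
    then have "v - u = 0" using e(3)[OF vuL(1)] fin by simp
    then show ?thesis using reach_mono[OF reach_0[OF vP]] by simp
  next
    case 2
    then obtain i where i: "U = {i}" by (auto simp: card_1_singleton_iff)
    obtain j where j: "j \<in> V" using 2 dim by fastforce
    have "circuit_step A b u v"
    proof (rule circuit_stepI)
      show "A $ j \<bullet> v = b $ j" "b $ j < A $ j \<bullet> u" using Vrow[OF j] by auto
      then show "v \<noteq> u" by auto
      fix h assume h: "\<And>i. A $ i \<bullet> u = A $ i \<bullet> v \<Longrightarrow> A $ i \<bullet> h = 0"
      have hL: "h \<in> L" using h by (simp add: L_def S_def Tu_def Tv_def)
      have hi: "h = (A $ i \<bullet> h) *\<^sub>R e i" using e(3)[OF hL] i by simp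
      have vi: "v - u = (A $ i \<bullet> (v - u)) *\<^sub>R e i" using e(3)[OF vuL(1)] i by simp
      have "A $ i \<bullet> (v - u) \<noteq> 0" using Urow[of i] i by (simp add: inner_diff_right)
      then have "(A $ i \<bullet> h / (A $ i \<bullet> (v - u))) *\<^sub>R ((A $ i \<bullet> (v - u)) *\<^sub>R e i) = (A $ i \<bullet> h) *\<^sub>R e i"
        by simp
      then have "h = (A $ i \<bullet> h / (A $ i \<bullet> (v - u))) *\<^sub>R (v - u)" using hi vi by metis
      then show "\<exists>c. h = c *\<^sub>R (v - u)" by blast
    qed
    then have "reach A b v (Suc 0) u" using reach_step uP vP reach_0 by blast
    then show ?thesis by (rule reach_mono) simp
  next
    case 3
    show ?thesis
    proof (rule dim_polyhedral_face_2_reach(1)[OF vP uP L_def _ vuL(2)])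
      show "A $ i \<bullet> v = b $ i" if "i \<in> S" for i using that by (simp add: S_def Tv_def)
      show "dim L = 2" using 3 dim by simp
      show "h = 0" if "h \<in> L" "\<And>i. A $ i \<bullet> v = b $ i \<Longrightarrow> A $ i \<bullet> h = 0" for h
        using extreme_point_tight_rows[OF v] that by blast
      show "card (- S) \<le> 6" using cardS 3 by (simp add: card_compl)
    qed
  next
    case 4
    have V3: "card V = 3" using 4 dim by simp
    have c1: "card (- (S \<union> U \<union> V)) \<le> 1" using cardSU cardS 4 V3 unfolding card_compl by simp
    have "V \<noteq> {}" using V3 by auto
    have Su: "A $ i \<bullet> u = b $ i" if "i \<in> S" for i using that by (simp add: S_def Tu_def)
    obtain y i j where y: "y \<in> polyhedron_of A b" "y - u \<in> L" "i \<in> U" "A $ i \<bullet> y = b $ i"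
      "j \<in> V" "A $ j \<bullet> y = b $ j" "\<And>k w. reach A b w k y \<Longrightarrow> reach A b w (Suc k) u"
      using first_step_dim_3[OF uP vP L_def vuL(1) 4 Urow \<open>V \<noteq> {}\<close> Vrow e Su c1] by blast
    \<comment> \<open>After the first step, \<open>y\<close> and \<open>v\<close> lie in the
      two-dimensional face on which \<open>j\<close> is tight as well. Row \<open>i\<close> of
      \<open>U\<close> is tight at \<open>y\<close> but not at \<open>v\<close>, so three more steps
      suffice.\<close>
    define L' where "L' = {h. \<forall>i\<in>insert j S. A $ i \<bullet> h = 0}"
    have L'L: "h \<in> L' \<longleftrightarrow> h \<in> L \<and> A $ j \<bullet> h = 0" for h by (auto simp: L'_def L_def)
    have "reach A b v 3 y"
    proof (rule dim_polyhedral_face_2_reach(2)[OF vP y(1) L'_def])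
      show "A $ i \<bullet> v = b $ i" if "i \<in> insert j S" for i
        using that Vrow[OF y(5)] by (auto simp: S_def Tv_def)
      have "y - v = (y - u) + (u - v)" by simp
      then have "y - v \<in> L" using subspace_add[OF subL y(2) vuL(2)] by simp
      then show "y - v \<in> L'" using y(6) Vrow[OF y(5)] by (simp add: L'L inner_diff_right)
      have "dim L' = card (V - {j})"
      proof (rule dim_dual_basis[of _ e' _ "\<lambda>i. A $ i"])
        show "e' i \<in> L'" if "i \<in> V - {j}" for i using that e'(1,2) y(5) by (simp add: L'L)
        show "A $ k \<bullet> e' i = (if i = k then 1 else 0)" if "i \<in> V - {j}" "k \<in> V - {j}" for i k
          using that e'(2) by simp
        fix x assume x: "x \<in> L'"
        then have "x = (\<Sum>i\<in>V. (A $ i \<bullet> x) *\<^sub>R e' i)" using e'(3) L'L by blast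
        also have "\<dots> = (\<Sum>i\<in>V - {j}. (A $ i \<bullet> x) *\<^sub>R e' i)"
          using x y(5) by (simp add: L'L sum.remove[of V j])
        finally show "x = (\<Sum>i\<in>V - {j}. (A $ i \<bullet> x) *\<^sub>R e' i)" .
      qed simp
      then show "dim L' = 2" using V3 y(5) by simp
      show "h = 0" if "h \<in> L'" "\<And>i. A $ i \<bullet> v = b $ i \<Longrightarrow> A $ i \<bullet> h = 0" for h
        using extreme_point_tight_rows[OF v] that by blast
      have "j \<notin> S" using y(5) disj by blast
      then show "card (- insert j S) \<le> 6" using cardS 4 unfolding card_compl by simp
      show "A $ i \<bullet> y = b $ i" "b $ i < A $ i \<bullet> v" using y(4) Urow[OF y(3)] by auto
    qed
    then show ?thesis using y(7)[of v 3] by simp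
  next
    case 5
    have V4: "card V = 4" using 5 dim by simp
    have "card (S \<union> U \<union> V) \<le> 8" using card_mono[of UNIV "S \<union> U \<union> V"] by simp
    then have "S = {}" using cardSU 5 V4 by simp
    have L: "L = UNIV" using \<open>S = {}\<close> by (simp add: L_def)
    have "card (U \<union> V) = card (UNIV :: 8 set)" using cardSU \<open>S = {}\<close> 5 V4 by simp
    then have UV: "U \<union> V = UNIV" by (intro card_subset_eq) auto
    show ?thesis
      by (rule spindle_reach[OF uP vP 5 Urow V4 Vrow UV e(2) e(3) e'(2) e'(3)]) (simp_all add: L)
  qed
qed

section \<open>The lower bound\<close>

text \<open>The opposite vertices 0 and 1 of the unit cube differ in all four coordinates, and a
  circuit step changes only one.\<close>

lemma cube_lower_bound:
  "\<exists>(A :: real ^ 4 ^ 8) b. facet_system A b \<and> 4 \<le> circuit_diameter A b"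
proof -
  have "card (UNIV :: 8 set) = card (UNIV :: (4 \<times> bool) set)" by simp
  then obtain \<beta> :: "8 \<Rightarrow> 4 \<times> bool" where \<beta>: "bij \<beta>"
    using finite_same_card_bij[OF finite finite] by blast
  define ix where "ix i = fst (\<beta> i)" for i
  define lo where "lo i = snd (\<beta> i)" for i
  have idx: "\<exists>i. ix i = k \<and> lo i = s" for k s
    proof -
    obtain i where "(k, s) = \<beta> i" using surjD[OF bij_is_surj[OF \<beta>]] by blast
    then show ?thesis by (intro exI[of _ i]) (auto simp: ix_def lo_def dest: sym)
  qed
  have idx_inj: "i = j" if "ix i = ix j" "lo i = lo j" for i j
    using that by (intro injD[OF bij_is_inj[OF \<beta>]] prod_eqI) (auto simp: ix_def lo_def)
  define A :: "real ^ 4 ^ 8" where "A = (\<chi> i. if lo i then axis (ix i) 1 else - axis (ix i) 1)"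
  define b :: "real ^ 8" where "b = (\<chi> i. if lo i then 0 else - 1)"
  have Az: "A $ i \<bullet> z = (if lo i then z $ ix i else - z $ ix i)" for i z
    by (simp add: A_def inner_axis inner_commute)
  have bi: "b $ i = (if lo i then 0 else - 1)" for i by (simp add: b_def)
  define P where "P = polyhedron_of A b"
  have P: "P = cbox 0 1"
  proof (rule set_eqI)
    fix z
    have "z \<in> P \<longleftrightarrow> (\<forall>i. (lo i \<longrightarrow> 0 \<le> z $ ix i) \<and> (\<not> lo i \<longrightarrow> z $ ix i \<le> 1))"
      by (auto simp: P_def mem_polyhedron Az bi)
    also have "\<dots> \<longleftrightarrow> (\<forall>k. 0 \<le> z $ k \<and> z $ k \<le> 1)"
    proof safe
      fix k assume *: "\<forall>i. (lo i \<longrightarrow> 0 \<le> z $ ix i) \<and> (\<not> lo i \<longrightarrow> z $ ix i \<le> 1)"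
      show "0 \<le> z $ k" using * idx[of k True] by auto
      show "z $ k \<le> 1" using * idx[of k False] by auto
    qed auto
    finally show "z \<in> P \<longleftrightarrow> z \<in> cbox 0 1" by (simp add: mem_box_cart)
  qed
  have int: "interior P \<noteq> {}"
  proof -
    have "(\<chi> k. 1 / 2) \<in> box 0 (1 :: real ^ 4)" by (simp add: mem_box_cart)
    then show ?thesis by (auto simp: P interior_cbox)
  qed
  define H where "H i = {z. b $ i \<le> A $ i \<bullet> z}" for i
  have PH: "P = (\<Inter>i. H i)" by (auto simp: P_def mem_polyhedron H_def)
  \<comment> \<open>A point that violates row \<open>i\<close> and no other row, which shows that
    the system is irredundant.\<close>
  define p where "p i = axis (ix i) (if lo i then - 1 else 2 :: real)" for i
  have p_out: "p i \<notin> H i" for i by (simp add: H_def p_def Az bi)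
  have p_in: "p i \<in> H j" if "j \<noteq> i" for i j
  proof -
    have "ix j \<noteq> ix i \<or> lo j \<noteq> lo i" using that idx_inj by blast
    then show ?thesis by (auto simp: H_def p_def Az bi axis_def)
  qed
  have H_inj: "i = j" if "H i = H j" for i j using p_in[of j i] p_out[of i] that by auto
  have facet: "(P \<inter> {z. A $ i \<bullet> z = b $ i}) facet_of P" for i
  proof -
    \<comment> \<open>The facet criterion is indexed by half-spaces as sets; \<open>id\<close>
      recovers the row, which is unique by \<open>H_inj\<close>.\<close>
    define id where "id h = (SOME i. H i = h)" for h
    have id: "id (H i) = i" for i unfolding id_def using H_inj by (intro some_equality) auto
    have "C facet_of P \<longleftrightarrow> (\<exists>h. h \<in> range H \<and> C = P \<inter> {x. - A $ id h \<bullet> x = - b $ id h})" for C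
    proof (rule facet_of_polyhedron_explicit)
      show "finite (range H)" by simp
      have aff: "affine hull P = UNIV" using int by (rule affine_hull_nonempty_interior)
      then show "P = affine hull P \<inter> \<Inter> (range H)" using PH by simp
      show "- A $ id h \<noteq> 0 \<and> h = {x. - A $ id h \<bullet> x \<le> - b $ id h}" if "h \<in> range H" for h
      proof -
        obtain i where h: "h = H i" using \<open>h \<in> range H\<close> by blast
        have "A $ i \<noteq> 0" by (simp add: A_def)
        then show ?thesis unfolding h id by (simp add: H_def)
      qed
      fix F' assume F': "F' \<subset> range H"
      then obtain i where i: "H i \<notin> F'" by blast
      have "p i \<in> \<Inter> F'"
      proof
        fix X assume "X \<in> F'"
        then obtain j where "X = H j" "j \<noteq> i" using F' i by blast
        then show "p i \<in> X" using p_in by simp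
      qed
      moreover have "p i \<notin> P" using p_out PH by blast
      moreover have "P \<subseteq> \<Inter> F'" using PH F' by blast
      ultimately show "P \<subset> affine hull P \<inter> \<Inter> F'" unfolding aff by blast
    qed
    then show ?thesis using id by (auto intro!: exI[of _ "H i"])
  qed
  have fs: "facet_system A b"
    unfolding facet_system_def P_def[symmetric]
  proof (intro conjI allI)
    show "aff_dim P = int CARD(4)" using aff_dim_nonempty_interior[OF int] by simp
    show "{z. \<forall>j. j \<noteq> i \<longrightarrow> b $ j \<le> (A *v z) $ j} \<noteq> P" for i
    proof
      assume e: "{z. \<forall>j. j \<noteq> i \<longrightarrow> b $ j \<le> (A *v z) $ j} = P"
      have "p i \<in> {z. \<forall>j. j \<noteq> i \<longrightarrow> b $ j \<le> (A *v z) $ j}"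
        using p_in by (auto simp: H_def matrix_vector_mul_component)
      then show False using p_out PH unfolding e by blast
    qed
    show "{z \<in> P. (A *v z) $ i = b $ i} facet_of P" for i
    proof -
      have "{z \<in> P. (A *v z) $ i = b $ i} = P \<inter> {z. A $ i \<bullet> z = b $ i}"
        by (auto simp: matrix_vector_mul_component)
      then show ?thesis using facet by simp
    qed
  qed
  have ext: "u extreme_point_of P" if u: "u = 0 \<or> u = 1" for u
    unfolding extreme_point_of_def
  proof (intro conjI ballI)
    show "u \<in> P" using u by (auto simp: P mem_box_cart)
    fix x y assume xy: "x \<in> P" "y \<in> P"
    show "u \<notin> open_segment x y"
    proof
      assume "u \<in> open_segment x y"
      then obtain t where t: "x \<noteq> y" "0 < t" "t < 1" "u = (1 - t) *\<^sub>R x + t *\<^sub>R y"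
        by (auto simp: in_segment)
      have "x $ k = y $ k" for k
      proof -
        have xk: "0 \<le> x $ k" "x $ k \<le> 1" "0 \<le> y $ k" "y $ k \<le> 1"
          using xy by (auto simp: P mem_box_cart)
        have uk: "u $ k = (1 - t) * x $ k + t * y $ k" using t(4) by simp
        have n: "0 \<le> (1 - t) * x $ k" "0 \<le> t * y $ k"
          "0 \<le> (1 - t) * (1 - x $ k)" "0 \<le> t * (1 - y $ k)"
          using t xk by auto
        from u show ?thesis
        proof
          assume "u = 0"
          then have "(1 - t) * x $ k + t * y $ k = 0" using uk by simp
          then have "(1 - t) * x $ k = 0" "t * y $ k = 0" using n by linarith+
          then show ?thesis using t by simp
        next
          assume "u = 1"
          then have "(1 - t) * (1 - x $ k) + t * (1 - y $ k) = 0" using uk by (simp add: algebra_simps)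
          then have "(1 - t) * (1 - x $ k) = 0" "t * (1 - y $ k) = 0" using n by linarith+
          then show ?thesis using t by simp
        qed
      qed
      then show False using t(1) by (simp add: vec_eq_iff)
    qed
  qed
  have circ: "\<exists>k. \<forall>l. l \<noteq> k \<longrightarrow> g $ l = 0" if g: "circuit A g" for g
  proof -
    have "g \<noteq> 0" using g by (simp add: circuit_def)
    then obtain k where k: "g $ k \<noteq> 0" by (auto simp: vec_eq_iff)
    have supp: "supp (A *v x) = {i. x $ ix i \<noteq> 0}" for x
      by (auto simp: supp_def matrix_vector_mul_component Az)
    \<comment> \<open>The support of a unit vector at a nonzero coordinate of \<open>g\<close> is
      contained in that of \<open>g\<close>, so by minimality the two agree.\<close>
    have "axis k (1::real) \<noteq> 0" by simp
    then have "\<not> supp (A *v axis k 1) \<subset> supp (A *v g)" using g unfolding circuit_def by blast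
    moreover have "supp (A *v axis k 1) \<subseteq> supp (A *v g)"
      using k unfolding supp by (auto simp: axis_def)
    ultimately have eq: "supp (A *v axis k 1) = supp (A *v g)" by blast
    have "g $ l = 0" if "l \<noteq> k" for l
    proof -
      obtain i where i: "ix i = l" using idx by blast
      have "i \<notin> supp (A *v axis k 1)" using i that by (simp add: supp axis_def)
      then have "i \<notin> supp (A *v g)" using eq by blast
      then show ?thesis using i by (simp add: supp)
    qed
    then show ?thesis by blast
  qed
  have walk: "4 \<le> m" if Y: "circuit_walk A b m Y" "Y 0 = 0" "Y m = 1" for m Y
  proof -
    have "i \<le> m \<Longrightarrow> card {k. Y i $ k \<noteq> 0} \<le> i" for i
    proof (induction i)
      case 0
      then show ?case using Y by simp
    next
      case (Suc i)
      then have "circuit_step A b (Y i) (Y (Suc i))" using Y by (simp add: circuit_walk_def)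
      then obtain g \<alpha> where g: "circuit A g" "Y (Suc i) - Y i = \<alpha> *\<^sub>R g"
        unfolding circuit_step_def by blast
      obtain k where k: "\<And>l. l \<noteq> k \<Longrightarrow> g $ l = 0" using circ[OF g(1)] by blast
      have "Y (Suc i) $ l = Y i $ l" if "l \<noteq> k" for l
      proof -
        have "(Y (Suc i) - Y i) $ l = 0" using g(2) k[OF that] by simp
        then show ?thesis by simp
      qed
      then have "{l. Y (Suc i) $ l \<noteq> 0} \<subseteq> insert k {l. Y i $ l \<noteq> 0}" by auto
      then have "card {l. Y (Suc i) $ l \<noteq> 0} \<le> card (insert k {l. Y i $ l \<noteq> 0})"
        by (intro card_mono) auto
      also have "\<dots> \<le> Suc (card {l. Y i $ l \<noteq> 0})" by (rule card_insert_le_m1) auto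
      finally show ?case using Suc by simp
    qed
    from this[of m] show ?thesis using Y(3) by simp
  qed
  have "4 \<le> circuit_distance A b 0 1"
    unfolding circuit_distance_def
  proof (rule Inf_greatest)
    fix x assume "x \<in> {enat k |k. \<exists>y. circuit_walk A b k y \<and> y 0 = 0 \<and> y k = 1}"
    then show "4 \<le> x" using walk by (auto simp: numeral_eq_enat)
  qed
  also have "\<dots> \<le> circuit_diameter A b"
    unfolding circuit_diameter_def using ext unfolding P_def by (intro Sup_upper) blast
  finally show ?thesis using fs by blast
qed

theorem theorem5: "max_circuit_diameter TYPE(8) TYPE(4) = 4"
proof (rule antisym)
  show "max_circuit_diameter TYPE(8) TYPE(4) \<le> 4"
    unfolding max_circuit_diameter_def
  proof (rule Sup_least, elim CollectE exE conjE)
    fix x and A :: "real ^ 4 ^ 8" and b :: "real ^ 8"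
    assume x: "x = circuit_diameter A b"
    show "x \<le> 4"
      unfolding x circuit_diameter_def
    proof (rule Sup_least, elim CollectE exE conjE)
      fix y u v
      assume "y = circuit_distance A b u v"
        "u extreme_point_of polyhedron_of A b" "v extreme_point_of polyhedron_of A b"
      then show "y \<le> 4"
        using circuit_distance_le[OF reach_4_between_vertices] by (simp add: numeral_eq_enat)
    qed
  qed
next
  obtain A :: "real ^ 4 ^ 8" and b where "facet_system A b" "4 \<le> circuit_diameter A b"
    using cube_lower_bound by blast
  moreover from this(1) have "circuit_diameter A b \<le> max_circuit_diameter TYPE(8) TYPE(4)"
    unfolding max_circuit_diameter_def by (intro Sup_upper) blast
  ultimately show "4 \<le> max_circuit_diameter TYPE(8) TYPE(4)" by (meson order_trans)
qed

end
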